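(* Let $\Gamma$ be a countable amenable group acting on a compact metrizable group $X$ by automorphisms. Let $\mu_X$ be the normalized Haar measure of $X$. Then the following hold: (1) The set $\mathrm{IE}(X)$ is a $\Gamma$-invariant closed normal subgroup of $X$. (2) For any $k\in\mathbb{N}$, the set $\mathrm{IE}_k(X)$ is a $\Gamma$-invariant (under the product action of $\Gamma$ on $X^k$) closed subgroup of the group $X^k$, and $$\mathrm{IE}_k(X)=\{(x_1y,\dots,x_ky):x_1,\dots,x_k\in\mathrm{IE}(X),\,y\in X\}=\{(yx_1,\dots,yx_k):x_1,\dots,x_k\in\mathrm{IE}(X),\,y\in X\}.$$ (3) For any $\Gamma$-invariant Borel probability measure $\nu$ on $X$ and any $k\in\mathbb{N}$, one has $\mathrm{IE}^{\nu}_k(X)\subseteq\mathrm{IE}^{\mu_X}_k(X)=\mathrm{IE}_k(X)$. (4) $\mathrm{h}(X)>0$ if and only if $\mathrm{IE}(X)$ is nontrivial. (5) Let $Y$ be a closed $\Gamma$-invariant normal subgroup of $X$ and denote by $q$ the quotient map $X\to X/Y$. Consider the induced $\Gamma$-action on $X/Y$. Then $q(\mathrm{IE}(X))=\mathrm{IE}(X/Y)$.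
   Context: Let $\Gamma$ act continuously on a compact metrizable space $X$. For a tuple $(A_1,\dots,A_k)$ of subsets of $X$ and $D\subseteq X$, a finite set $F\subseteq\Gamma$ is an independence set for the tuple relative to $D$ if $D\cap\bigcap_{s\in F}s^{-1}A_{\sigma(s)}\ne\emptyset$ for every $\sigma:F\to\{1,\dots,k\}$; it is an independence set if this holds with $D=X$. IE-tuples: $(x_1,\dots,x_k)\in X^k$ belongs to $\mathrm{IE}_k(X)$ if for every product neighborhood $U_1\times\cdots\times U_k$ of it there exist a nonempty finite $K\subseteq\Gamma$ and $c,\varepsilon>0$ such that for any finite $F\subseteq\Gamma$ with $|KF\setminus F|\le\varepsilon|F|$ the tuple $(U_1,\dots,U_k)$ has an independence set $F'\subseteq F$ with $|F'|\ge c|F|$. $\mu$-IE-tuples: for a $\Gamma$-invariant Borel probability measure $\mu$, $(x_1,\dots,x_k)$ belongs to $\mathrm{IE}_k^\mu(X)$ if for every product neighborhood $U_1\times\cdots\times U_k$ of it there exist $c,\delta>0$ such that for any nonempty finite $K\subseteq\Gamma$ and $\varepsilon>0$ one can find a nonempty finite $F\subseteq\Gamma$ with $|KF\setminus F|\le\varepsilon|F|$ such that for every Borel $D\subseteq X$ with $\mu(D)\ge1-\delta$ the tuple $(U_1,\dots,U_k)$ has an independence set $F'\subseteq F$ relative to $D$ with $|F'|\ge c|F|$. When $X$ is a compact group and the action is by automorphisms, $\mathrm{IE}(X)=\{x\in X:(x,e_X)\in\mathrm{IE}_2(X)\}$. $\mathrm{h}(X)$ is the topological entropy of the action (equal to the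 measure entropy for $\mu_X$): $\mathrm{h}(X)=\sup_{\varepsilon>0}\limsup_n|F_n|^{-1}\log N_{\rho,F_n,\varepsilon}(X)$ for a compatible metric $\rho$ and a left F{\o}lner sequence $(F_n)$ (nonempty finite sets with $|KF_n\setminus F_n|/|F_n|\to0$ for every finite $K\subseteq\Gamma$), where $N_{\rho,F,\varepsilon}(X)$ is the maximal cardinality of $Z\subseteq X$ with $\max_{s\in F}\rho(sy,sz)>\varepsilon$ for all distinct $y,z\in Z$. *)

theory Defs
  imports
    "HOL-Analysis.Analysis"
    "HOL-Algebra.Coset"
    "HOL-Algebra.Bij"
    "HOL-Algebra.Product_Groups"
begin

definition left_Folner_sequence :: "('g, 'm) monoid_scheme \<Rightarrow> (nat \<Rightarrow> 'g set) \<Rightarrow> bool" where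
  "left_Folner_sequence G Fn \<longleftrightarrow>
     (\<forall>n. finite (Fn n) \<and> Fn n \<noteq> {} \<and> Fn n \<subseteq> carrier G) \<and>
     (\<forall>K. finite K \<and> K \<subseteq> carrier G \<longrightarrow>
        (\<lambda>n. real (card ((K <#>\<^bsub>G\<^esub> Fn n) - Fn n)) / real (card (Fn n))) \<longlonglongrightarrow> 0)"

definition countable_amenable_group :: "('g, 'm) monoid_scheme \<Rightarrow> bool" where
  "countable_amenable_group G \<longleftrightarrow>
     group G \<and> countable (carrier G) \<and> (\<exists>Fn. left_Folner_sequence G Fn)"

definition compact_metrizable_group :: "('x, 'n) monoid_scheme \<Rightarrow> 'x topology \<Rightarrow> bool" where
  "compact_metrizable_group X T \<longleftrightarrow>
     group X \<and> topspace T = carrier X \<and>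
     continuous_map (prod_topology T T) T (\<lambda>(x, y). x \<otimes>\<^bsub>X\<^esub> y) \<and>
     continuous_map T T (\<lambda>x. inv\<^bsub>X\<^esub> x) \<and>
     compact_space T \<and> metrizable_space T"

text \<open>The inverse of \<open>\<phi> g\<close> is \<open>\<phi> (inv g)\<close> on the carrier, so its continuity is included.
  Elements of \<^const>\<open>AutoGroup\<close> are extensional: \<open>\<phi> g\<close> is \<open>undefined\<close> outside the carrier.\<close>

definition acts_by_automorphisms ::
  "('g, 'm) monoid_scheme \<Rightarrow> ('x, 'n) monoid_scheme \<Rightarrow> 'x topology \<Rightarrow> ('g \<Rightarrow> 'x \<Rightarrow> 'x) \<Rightarrow> bool" where
  "acts_by_automorphisms G X T \<phi> \<longleftrightarrow>
     group_hom G (AutoGroup X) \<phi> \<and> (\<forall>g\<in>carrier G. continuous_map T T (\<phi> g))"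

definition invariant_subset ::
  "('g, 'm) monoid_scheme \<Rightarrow> ('g \<Rightarrow> 'x \<Rightarrow> 'x) \<Rightarrow> 'x set \<Rightarrow> bool" where
  "invariant_subset G \<phi> A \<longleftrightarrow> (\<forall>g\<in>carrier G. \<phi> g ` A = A)"

definition product_action :: "nat \<Rightarrow> ('g \<Rightarrow> 'x \<Rightarrow> 'x) \<Rightarrow> 'g \<Rightarrow> (nat \<Rightarrow> 'x) \<Rightarrow> (nat \<Rightarrow> 'x)" where
  "product_action k \<phi> g x = (\<lambda>i\<in>{1..k}. \<phi> g (x i))"

definition quotient_topology :: "'x topology \<Rightarrow> ('x \<Rightarrow> 'y) \<Rightarrow> 'y topology" where
  "quotient_topology T q =
     topology (\<lambda>V. V \<subseteq> q ` topspace T \<and> openin T {x \<in> topspace T. q x \<in> V})"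

lemma openin_quotient_topology:
  "openin (quotient_topology T q) V \<longleftrightarrow>
     V \<subseteq> q ` topspace T \<and> openin T {x \<in> topspace T. q x \<in> V}"
proof -
  let ?L = "\<lambda>V. V \<subseteq> q ` topspace T \<and> openin T {x \<in> topspace T. q x \<in> V}"
  have "istopology ?L"
    unfolding istopology_def
  proof (intro conjI allI impI)
    fix U V assume "?L U" "?L V"
    moreover have "{x \<in> topspace T. q x \<in> U \<inter> V} =
        {x \<in> topspace T. q x \<in> U} \<inter> {x \<in> topspace T. q x \<in> V}"
      by auto
    ultimately show "U \<inter> V \<subseteq> q ` topspace T" "openin T {x \<in> topspace T. q x \<in> U \<inter> V}"
      by auto
  next
    fix \<K> assume "\<forall>K\<in>\<K>. ?L K"
    moreover have "{x \<in> topspace T. q x \<in> \<Union>\<K>} = (\<Union>K\<in>\<K>. {x \<in> topspace T. q x \<in> K})"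
      by auto
    ultimately show "\<Union>\<K> \<subseteq> q ` topspace T" "openin T {x \<in> topspace T. q x \<in> \<Union>\<K>}"
      by auto
  qed
  then show ?thesis
    by (simp add: quotient_topology_def topology_inverse')
qed

lemma topspace_quotient_topology: "topspace (quotient_topology T q) = q ` topspace T"
proof (rule antisym)
  show "topspace (quotient_topology T q) \<subseteq> q ` topspace T"
    using openin_quotient_topology[of T q "topspace (quotient_topology T q)"] by simp
  have "{x \<in> topspace T. q x \<in> q ` topspace T} = topspace T"
    by auto
  then have "openin (quotient_topology T q) (q ` topspace T)"
    by (simp add: openin_quotient_topology)
  then show "q ` topspace T \<subseteq> topspace (quotient_topology T q)"
    by (rule openin_subset)
qed

lemma quotient_map_quotient_topology: "quotient_map T (quotient_topology T q) q"
  by (auto simp: quotient_map_def topspace_quotient_topology openin_quotient_topology)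

definition quotient_action ::
  "('x, 'n) monoid_scheme \<Rightarrow> 'x set \<Rightarrow> ('g \<Rightarrow> 'x \<Rightarrow> 'x) \<Rightarrow> 'g \<Rightarrow> 'x set \<Rightarrow> 'x set" where
  "quotient_action X Y \<phi> g = (\<lambda>C\<in>carrier (X Mod Y). \<phi> g ` C)"

definition Borel_prob_measure :: "'x topology \<Rightarrow> 'x measure \<Rightarrow> bool" where
  "Borel_prob_measure T \<mu> \<longleftrightarrow>
     space \<mu> = topspace T \<and> sets \<mu> = sigma_sets (topspace T) {U. openin T U} \<and>
     emeasure \<mu> (topspace T) = 1"

definition invariant_measure ::
  "('g, 'm) monoid_scheme \<Rightarrow> ('g \<Rightarrow> 'x \<Rightarrow> 'x) \<Rightarrow> 'x measure \<Rightarrow> bool" where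
  "invariant_measure G \<phi> \<mu> \<longleftrightarrow>
     (\<forall>g\<in>carrier G. \<forall>A\<in>sets \<mu>. emeasure \<mu> (\<phi> g -` A \<inter> space \<mu>) = emeasure \<mu> A)"

text \<open>On a compact metrizable group every Borel probability measure is regular, so the
  normalized Haar measure is the translation-invariant one.\<close>

definition normalized_Haar_measure ::
  "('x, 'n) monoid_scheme \<Rightarrow> 'x topology \<Rightarrow> 'x measure \<Rightarrow> bool" where
  "normalized_Haar_measure X T \<mu> \<longleftrightarrow>
     Borel_prob_measure T \<mu> \<and>
     (\<forall>x\<in>carrier X. \<forall>A\<in>sets \<mu>. emeasure \<mu> (x <#\<^bsub>X\<^esub> A) = emeasure \<mu> A)"

text \<open>Tuples of length \<open>k\<close> are indexed by \<open>{1..k}\<close>; points of the \<open>k\<close>-th power are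
  extensional functions, as in \<^const>\<open>product_topology\<close> and \<^const>\<open>product_group\<close>.\<close>

definition independence_set ::
  "('g, 'm) monoid_scheme \<Rightarrow> 'x topology \<Rightarrow> ('g \<Rightarrow> 'x \<Rightarrow> 'x) \<Rightarrow> nat \<Rightarrow> (nat \<Rightarrow> 'x set)
     \<Rightarrow> 'x set \<Rightarrow> 'g set \<Rightarrow> bool" where
  "independence_set G T \<phi> k A D F \<longleftrightarrow>
     finite F \<and> F \<subseteq> carrier G \<and>
     (\<forall>\<sigma> \<in> F \<rightarrow> {1..k}. D \<inter> (\<Inter>s\<in>F. {x \<in> topspace T. \<phi> s x \<in> A (\<sigma> s)}) \<noteq> {})"

definition IE_tuples ::
  "('g, 'm) monoid_scheme \<Rightarrow> 'x topology \<Rightarrow> ('g \<Rightarrow> 'x \<Rightarrow> 'x) \<Rightarrow> nat \<Rightarrow> (nat \<Rightarrow> 'x) set" where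
  "IE_tuples G T \<phi> k =
     {x \<in> (\<Pi>\<^sub>E i\<in>{1..k}. topspace T).
       \<forall>U. (\<forall>i\<in>{1..k}. openin T (U i) \<and> x i \<in> U i) \<longrightarrow>
         (\<exists>K c \<epsilon>. finite K \<and> K \<noteq> {} \<and> K \<subseteq> carrier G \<and> c > (0::real) \<and> \<epsilon> > (0::real) \<and>
           (\<forall>F. finite F \<and> F \<subseteq> carrier G \<and>
                real (card ((K <#>\<^bsub>G\<^esub> F) - F)) \<le> \<epsilon> * real (card F) \<longrightarrow>
              (\<exists>F'\<subseteq>F. independence_set G T \<phi> k U (topspace T) F' \<and>
                 real (card F') \<ge> c * real (card F))))}"

definition measure_IE_tuples ::
  "('g, 'm) monoid_scheme \<Rightarrow> 'x topology \<Rightarrow> ('g \<Rightarrow> 'x \<Rightarrow> 'x) \<Rightarrow> 'x measure \<Rightarrow> nat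
     \<Rightarrow> (nat \<Rightarrow> 'x) set" where
  "measure_IE_tuples G T \<phi> \<mu> k =
     {x \<in> (\<Pi>\<^sub>E i\<in>{1..k}. topspace T).
       \<forall>U. (\<forall>i\<in>{1..k}. openin T (U i) \<and> x i \<in> U i) \<longrightarrow>
         (\<exists>c \<delta>. c > (0::real) \<and> \<delta> > (0::real) \<and>
           (\<forall>K \<epsilon>. finite K \<and> K \<noteq> {} \<and> K \<subseteq> carrier G \<and> \<epsilon> > (0::real) \<longrightarrow>
             (\<exists>F. finite F \<and> F \<noteq> {} \<and> F \<subseteq> carrier G \<and>
                real (card ((K <#>\<^bsub>G\<^esub> F) - F)) \<le> \<epsilon> * real (card F) \<and>
                (\<forall>D\<in>sets \<mu>. measure \<mu> D \<ge> 1 - \<delta> \<longrightarrow>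
                  (\<exists>F'\<subseteq>F. independence_set G T \<phi> k U D F' \<and>
                     real (card F') \<ge> c * real (card F))))))}"

definition IE_group ::
  "('g, 'm) monoid_scheme \<Rightarrow> ('x, 'n) monoid_scheme \<Rightarrow> 'x topology \<Rightarrow> ('g \<Rightarrow> 'x \<Rightarrow> 'x) \<Rightarrow> 'x set" where
  "IE_group G X T \<phi> =
     {x \<in> carrier X. (\<lambda>i\<in>{1..2}. if i = 1 then x else \<one>\<^bsub>X\<^esub>) \<in> IE_tuples G T \<phi> 2}"

definition compatible_metric :: "'x topology \<Rightarrow> ('x \<Rightarrow> 'x \<Rightarrow> real) \<Rightarrow> bool" where
  "compatible_metric T \<rho> \<longleftrightarrow>
     Metric_space (topspace T) \<rho> \<and> Metric_space.mtopology (topspace T) \<rho> = T"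

text \<open>For compact \<open>T\<close>, a compatible metric, continuous \<open>\<phi> s\<close> and nonempty finite \<open>F\<close>, all
  separated sets are finite and their cardinalities are bounded, so the maximum exists.\<close>

definition separated_number ::
  "'x topology \<Rightarrow> ('g \<Rightarrow> 'x \<Rightarrow> 'x) \<Rightarrow> ('x \<Rightarrow> 'x \<Rightarrow> real) \<Rightarrow> 'g set \<Rightarrow> real \<Rightarrow> nat" where
  "separated_number T \<phi> \<rho> F \<epsilon> =
     Max {card Z |Z. Z \<subseteq> topspace T \<and> finite Z \<and>
       (\<forall>y\<in>Z. \<forall>z\<in>Z. y \<noteq> z \<longrightarrow> Max ((\<lambda>s. \<rho> (\<phi> s y) (\<phi> s z)) ` F) > \<epsilon>)}"

definition topological_entropy ::
  "'x topology \<Rightarrow> ('g \<Rightarrow> 'x \<Rightarrow> 'x) \<Rightarrow> ('x \<Rightarrow> 'x \<Rightarrow> real) \<Rightarrow> (nat \<Rightarrow> 'g set) \<Rightarrow> ereal" where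
  "topological_entropy T \<phi> \<rho> Fn =
     (SUP \<epsilon>\<in>{0<..}. limsup (\<lambda>n.
        ereal (ln (real (separated_number T \<phi> \<rho> (Fn n) \<epsilon>)) / real (card (Fn n)))))"

end

theory Submission
  imports Defs
begin

text \<open>Averaging over translates shows that a tuple is an IE-tuple iff every product neighbourhood
  has, for some \<open>c > 0\<close>, an independence set of size at least \<open>c |F|\<close> inside \<^emph>\<open>every\<close> finite
  \<open>F\<close>. Nested independence sets for two tuples then multiply pointwise, so IE-tuples form a group, and
  invariance of Haar measure puts the diagonal into it; (1) and (2) follow formally.

  The other parts rest on one weighted Sauer--Shelah inequality for families of words. For (3),
  translating the witnesses of an independence set by a Haar random element sends almost all of them
  into a set of nearly full measure. For (5), one letter of a finite cover is chosen at random at each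
  coordinate, which shows that positive independence density passes to a member of a cover, and
  compactness yields an IE-pair in the fibres. For (4), exponentially many separated orbits have
  distinct names with respect to a fine partition; after a random translation few letters are lost by
  shrinking the atoms to disjoint closed cores, so two of these cores have positive independence
  density.\<close>

section \<open>Shattering\<close>

text \<open>The combinatorial inequality serves with two systems of weights. Weight 1 on the empty
  set and on all pairs of letters, resting on r <= 1 + binomial(r, 2), suits families of merely
  exponential size; weights k - 1 on the empty set and 1 on the full alphabet suit families that
  fill almost all of the k^n words. All constants come before F, since a density must be uniform in
  F. What does depend on F, such as a member of a cover or a pair of cores, ranges over a finite
  set, so one value recurs infinitely often along a Folner sequence; hence the density criterion is
  stated with "infinitely often" instead of "eventually". The random element multiplies witnesses on
  the right: \<phi> s (z \<cdot> y) = \<phi> s z \<cdot> \<phi> s y separates the prescribed point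
  from the random one, while y \<mapsto> z \<cdot> y preserves Haar measure. The order of choices
  for (4) is delicate: the partition fixes the alphabet, the alphabet fixes the shattering constant,
  and only then can the measure lost by shrinking atoms to cores be prescribed.\<close>

definition shatters :: "('a \<Rightarrow> 'b) set \<Rightarrow> 'a set \<Rightarrow> ('a \<Rightarrow> 'b set) \<Rightarrow> bool" where
  "shatters S F q \<longleftrightarrow>
     (\<forall>f. (\<forall>s\<in>F. q s \<noteq> {} \<longrightarrow> f s \<in> q s) \<longrightarrow> (\<exists>w\<in>S. \<forall>s\<in>F. q s \<noteq> {} \<longrightarrow> w s = f s))"

text \<open>Induction on the coordinates. In a pattern \<open>q\<close> an empty set leaves its
  coordinate free, a nonempty one demands all of its letters. When the coordinate \<open>a\<close>
  is split off, a word \<open>u\<close> on the rest has a fibre \<open>R u\<close> of letters that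
  extend it. The one-coordinate hypothesis bounds the fibre by the weights of the sets inside it,
  and the induction hypothesis is applied to the words whose fibre contains a given
  \<open>p\<close>.\<close>

lemma card_le_weighted_shattered:
  fixes w :: "'b set \<Rightarrow> real"
  assumes "finite F" and L: "finite L" and "finite P" and "S \<subseteq> F \<rightarrow>\<^sub>E L"
    and w0: "\<And>p. p \<in> P \<Longrightarrow> 0 \<le> w p"
    and wR: "\<And>R. R \<subseteq> L \<Longrightarrow> R \<noteq> {} \<Longrightarrow> real (card R) \<le> (\<Sum>p\<in>{p \<in> P. p \<subseteq> R}. w p)"
  shows "real (card S) \<le> (\<Sum>q\<in>{q \<in> F \<rightarrow>\<^sub>E P. shatters S F q}. \<Prod>s\<in>F. w (q s))"
  using \<open>finite F\<close> \<open>S \<subseteq> F \<rightarrow>\<^sub>E L\<close>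
proof (induction F arbitrary: S rule: finite_induct)
  case empty
  show ?case
  proof (cases "S = {}")
    case True
    then show ?thesis by (simp add: shatters_def)
  next
    case False
    with empty have "S = {\<lambda>_. undefined}" by auto
    then have "{q \<in> {} \<rightarrow>\<^sub>E P. shatters S {} q} = {\<lambda>_. undefined}"
      by (auto simp: shatters_def)
    then show ?thesis using \<open>S = _\<close> by simp
  qed
next
  case (insert a F)
  define R where "R u = {j \<in> L. u(a := j) \<in> S}" for u
  \<comment> \<open>The fibre must be nonempty even for \<open>p = {}\<close>: a pattern that leaves
    \<open>a\<close> free is realized in \<open>S\<close> only if some letter extends
    \<open>u\<close>.\<close>
  define Sp where "Sp p = {u \<in> F \<rightarrow>\<^sub>E L. R u \<noteq> {} \<and> p \<subseteq> R u}" for p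
  let ?E = "F \<rightarrow>\<^sub>E L"
  let ?Q = "\<lambda>p. {q \<in> F \<rightarrow>\<^sub>E P. shatters (Sp p) F q}"
  have finE: "finite ?E" using insert.hyps(1) L by (intro finite_PiE) auto
  have finR: "finite (R u)" for u using L by (simp add: R_def)
  have inj: "inj_on (\<lambda>(u, j). u(a := j)) (Sigma ?E R)"
  proof (rule inj_on_inverseI[where g = "\<lambda>v. (v(a := undefined), v a)"])
    fix x assume "x \<in> Sigma ?E R"
    then obtain u j where x: "x = (u, j)" "u \<in> ?E" by auto
    from x(2) have "u a = undefined" using insert.hyps(2) by (rule PiE_arb)
    then show "(((\<lambda>(u, j). u(a := j)) x)(a := undefined), (\<lambda>(u, j). u(a := j)) x a) = x"
      by (auto simp: x fun_eq_iff)
  qed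
  have "(\<lambda>(u, j). u(a := j)) ` Sigma ?E R = S"
  proof
    show "(\<lambda>(u, j). u(a := j)) ` Sigma ?E R \<subseteq> S" by (auto simp: R_def)
    show "S \<subseteq> (\<lambda>(u, j). u(a := j)) ` Sigma ?E R"
    proof
      fix v assume v: "v \<in> S"
      then have "v \<in> insert a F \<rightarrow>\<^sub>E L" using insert.prems by auto
      then have "v(a := undefined) \<in> ?E" "v a \<in> L" using insert.hyps(2)
        by (auto simp: PiE_iff extensional_def)
      then show "v \<in> (\<lambda>(u, j). u(a := j)) ` Sigma ?E R"
        using v by (intro image_eqI[of _ _ "(v(a := undefined), v a)"]) (auto simp: R_def)
    qed
  qed
  then have "card S = card (Sigma ?E R)" using card_image[OF inj] by simp
  also have "\<dots> = (\<Sum>u\<in>?E. card (R u))" using finE finR by simp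
  finally have "real (card S) = (\<Sum>u\<in>?E. real (card (R u)))" by simp
  also have "\<dots> \<le> (\<Sum>u\<in>?E. \<Sum>p\<in>P. if R u \<noteq> {} \<and> p \<subseteq> R u then w p else 0)"
  proof (rule sum_mono)
    fix u assume "u \<in> ?E"
    show "real (card (R u)) \<le> (\<Sum>p\<in>P. if R u \<noteq> {} \<and> p \<subseteq> R u then w p else 0)"
    proof (cases "R u = {}")
      case False
      have "real (card (R u)) \<le> (\<Sum>p\<in>{p \<in> P. p \<subseteq> R u}. w p)"
        using False by (intro wR) (auto simp: R_def)
      then show ?thesis using False \<open>finite P\<close> by (simp add: sum.inter_filter)
    qed simp
  qed
  also have "\<dots> = (\<Sum>p\<in>P. \<Sum>u\<in>?E. if R u \<noteq> {} \<and> p \<subseteq> R u then w p else 0)"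
    by (rule sum.swap)
  also have "\<dots> = (\<Sum>p\<in>P. w p * real (card (Sp p)))"
    using finE by (intro sum.cong refl) (simp add: Sp_def flip: sum.inter_filter)
  also have "\<dots> \<le> (\<Sum>p\<in>P. w p * (\<Sum>q\<in>?Q p. \<Prod>s\<in>F. w (q s)))"
    using w0 by (intro sum_mono mult_left_mono insert.IH) (auto simp: Sp_def)
  also have "\<dots> = (\<Sum>p\<in>P. \<Sum>q\<in>?Q p. w p * (\<Prod>s\<in>F. w (q s)))"
    by (simp add: sum_distrib_left)
  also have "\<dots> = (\<Sum>(p, q)\<in>Sigma P ?Q. w p * (\<Prod>s\<in>F. w (q s)))"
    using \<open>finite P\<close> insert.hyps(1) by (intro sum.Sigma) (auto intro!: finite_PiE)
  also have "\<dots> = (\<Sum>x\<in>Sigma P ?Q. \<Prod>s\<in>insert a F. w (((snd x)(a := fst x)) s))"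
  proof (intro sum.cong refl, clarify)
    fix p q
    have "(\<Prod>s\<in>F. w ((q(a := p)) s)) = (\<Prod>s\<in>F. w (q s))"
      using insert.hyps(2) by (intro prod.cong) auto
    then show "w p * (\<Prod>s\<in>F. w (q s)) = (\<Prod>s\<in>insert a F. w (((snd (p, q))(a := fst (p, q))) s))"
      using insert.hyps by simp
  qed
  also have "\<dots> = (\<Sum>q\<in>(\<lambda>x. (snd x)(a := fst x)) ` Sigma P ?Q. \<Prod>s\<in>insert a F. w (q s))"
  proof (rule sum.reindex_cong[symmetric, OF _ refl refl])
    show "inj_on (\<lambda>x. (snd x)(a := fst x)) (Sigma P ?Q)"
    proof (rule inj_on_inverseI[where g = "\<lambda>v. (v a, v(a := undefined))"])
      fix x assume "x \<in> Sigma P ?Q"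
      then obtain p q where x: "x = (p, q)" "q \<in> F \<rightarrow>\<^sub>E P" by auto
      from x(2) have "q a = undefined" using insert.hyps(2) by (rule PiE_arb)
      then show "(((snd x)(a := fst x)) a, ((snd x)(a := fst x))(a := undefined)) = x"
        by (auto simp: x fun_eq_iff)
    qed
  qed
  also have "\<dots> \<le> (\<Sum>q\<in>{q \<in> insert a F \<rightarrow>\<^sub>E P. shatters S (insert a F) q}. \<Prod>s\<in>insert a F. w (q s))"
  proof (rule sum_mono2)
    show "finite {q \<in> insert a F \<rightarrow>\<^sub>E P. shatters S (insert a F) q}"
      using \<open>finite P\<close> insert.hyps(1) by (auto intro!: finite_PiE)
    show "(\<lambda>x. (snd x)(a := fst x)) ` Sigma P ?Q
        \<subseteq> {q \<in> insert a F \<rightarrow>\<^sub>E P. shatters S (insert a F) q}"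
    proof clarsimp
      fix p q assume p: "p \<in> P" and q: "q \<in> F \<rightarrow>\<^sub>E P" and sh: "shatters (Sp p) F q"
      have "shatters S (insert a F) (q(a := p))"
        unfolding shatters_def
      proof (intro allI impI)
        fix f assume f: "\<forall>s\<in>insert a F. (q(a := p)) s \<noteq> {} \<longrightarrow> f s \<in> (q(a := p)) s"
        then have "\<forall>s\<in>F. q s \<noteq> {} \<longrightarrow> f s \<in> q s"
          using insert.hyps(2) by (metis fun_upd_other insertI2)
        then obtain u where u: "u \<in> Sp p" "\<forall>s\<in>F. q s \<noteq> {} \<longrightarrow> u s = f s"
          using sh unfolding shatters_def by blast
        obtain j where j: "j \<in> R u" "p \<noteq> {} \<longrightarrow> j = f a"
          using u(1) f by (cases "p = {}") (auto simp: Sp_def)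
        then show "\<exists>w\<in>S. \<forall>s\<in>insert a F. (q(a := p)) s \<noteq> {} \<longrightarrow> w s = f s"
          using u(2) insert.hyps(2) by (intro bexI[of _ "u(a := j)"]) (auto simp: R_def)
      qed
      then show "q(a := p) \<in> insert a F \<rightarrow>\<^sub>E P \<and> shatters S (insert a F) (q(a := p))"
        using p q insert.hyps(2) by (auto simp: PiE_iff extensional_def)
    qed
    show "0 \<le> (\<Prod>s\<in>insert a F. w (q s))"
      if "q \<in> {q \<in> insert a F \<rightarrow>\<^sub>E P. shatters S (insert a F) q}
            - (\<lambda>x. (snd x)(a := fst x)) ` Sigma P ?Q" for q
      using that w0 by (intro prod_nonneg) auto
  qed
  finally show ?case .
qed

text \<open>An exponential moment argument. Damping each nonempty set by the factor
  \<open>t < 1\<close> gives a pattern with N constrained coordinates the extra factor t^N. If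
  always N < d, this factor exceeds t^d, so t^(-d) times the damped sum over all patterns would
  bound \<open>card S\<close>.\<close>

lemma exists_large_shattered:
  fixes w :: "'b set \<Rightarrow> real"
  assumes F: "finite F" and "finite L" and P: "finite P" and "S \<subseteq> F \<rightarrow>\<^sub>E L"
    and w0: "\<And>p. p \<in> P \<Longrightarrow> 0 \<le> w p"
    and "\<And>R. R \<subseteq> L \<Longrightarrow> R \<noteq> {} \<Longrightarrow> real (card R) \<le> (\<Sum>p\<in>{p \<in> P. p \<subseteq> R}. w p)"
    and t: "0 < t" "t < 1"
    and S: "t powr (- d) * (\<Sum>p\<in>P. w p * (if p = {} then 1 else t)) ^ card F < real (card S)"
  obtains q where "q \<in> F \<rightarrow>\<^sub>E P" "shatters S F q" "d \<le> real (card {s \<in> F. q s \<noteq> {}})"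
proof (rule ccontr)
  assume "\<not> thesis"
  with that have small: "real (card {s \<in> F. q s \<noteq> {}}) < d"
    if "q \<in> F \<rightarrow>\<^sub>E P" "shatters S F q" for q
    using that by (meson not_le)
  let ?g = "\<lambda>p. w p * (if p = {} then 1 else t)"
  have g: "(\<Prod>s\<in>F. ?g (q s)) = (\<Prod>s\<in>F. w (q s)) * t powr (real (card {s \<in> F. q s \<noteq> {}}))" for q
  proof -
    have "(\<Prod>s\<in>F. if q s = {} then 1 else t) = (\<Prod>s\<in>F. if q s \<noteq> {} then t else 1)"
      by (intro prod.cong) auto
    also have "\<dots> = t powr (real (card {s \<in> F. q s \<noteq> {}}))"
      using F t by (simp add: powr_realpow flip: prod.inter_filter)
    finally show ?thesis by (simp add: prod.distrib)
  qed
  have "real (card S) \<le> (\<Sum>q\<in>{q \<in> F \<rightarrow>\<^sub>E P. shatters S F q}. \<Prod>s\<in>F. w (q s))"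
    using assms by (intro card_le_weighted_shattered) auto
  also have "\<dots> \<le> (\<Sum>q\<in>{q \<in> F \<rightarrow>\<^sub>E P. shatters S F q}. t powr (- d) * (\<Prod>s\<in>F. ?g (q s)))"
  proof (rule sum_mono)
    fix q assume q: "q \<in> {q \<in> F \<rightarrow>\<^sub>E P. shatters S F q}"
    let ?N = "real (card {s \<in> F. q s \<noteq> {}})"
    have "0 \<le> (\<Prod>s\<in>F. w (q s))" using q w0 by (intro prod_nonneg) auto
    moreover have "t powr 0 \<le> t powr (?N - d)"
      using small[of q] q t by (intro powr_mono') auto
    then have "1 \<le> t powr (- d) * t powr ?N" using t by (simp flip: powr_add)
    ultimately have "(\<Prod>s\<in>F. w (q s)) * 1 \<le> (\<Prod>s\<in>F. w (q s)) * (t powr (- d) * t powr ?N)"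
      by (rule mult_left_mono[rotated])
    then show "(\<Prod>s\<in>F. w (q s)) \<le> t powr (- d) * (\<Prod>s\<in>F. ?g (q s))"
      unfolding g by (simp add: ac_simps)
  qed
  also have "\<dots> \<le> (\<Sum>q\<in>F \<rightarrow>\<^sub>E P. t powr (- d) * (\<Prod>s\<in>F. ?g (q s)))"
    using F P w0 t by (intro sum_mono2) (auto intro!: finite_PiE prod_nonneg mult_nonneg_nonneg)
  also have "\<dots> = t powr (- d) * (\<Prod>s\<in>F. \<Sum>p\<in>P. ?g p)"
    using prod_sum_PiE[OF F, of "\<lambda>_. P" "\<lambda>_. ?g"] P by (simp only: sum_distrib_left)
  also have "\<dots> = t powr (- d) * (\<Sum>p\<in>P. ?g p) ^ card F" by simp
  finally show False using S by simp
qed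


text \<open>Weight 1 on the empty set and on each pair is admissible because r <= 1 + binomial(r,
  2). The shattered pattern may use different pairs at different coordinates; a pigeonhole over the
  finitely many pairs makes it constant.\<close>

lemma constant_pair_shattered:
  assumes L: "finite L" and c: "0 < (c::real)"
  obtains c' :: real where "0 < c'"
    "\<And>(F :: 'a set) S. finite F \<Longrightarrow> F \<noteq> {} \<Longrightarrow> S \<subseteq> F \<rightarrow>\<^sub>E L \<Longrightarrow> exp (c * card F) \<le> card S \<Longrightarrow>
      \<exists>a\<in>L. \<exists>b\<in>L. a \<noteq> b \<and> (\<exists>J\<subseteq>F. c' * card F \<le> card J \<and>
        (\<forall>f\<in>J \<rightarrow> {a, b}. \<exists>w\<in>S. \<forall>s\<in>J. w s = f s))"
proof -
  define B where "B = {p. p \<subseteq> L \<and> card p = 2}"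
  define P where "P = insert {} B"
  have B: "finite B" "{} \<notin> B" using L by (auto simp: B_def)
  \<comment> \<open>One more than the number of pairs: this stays positive for alphabets with fewer
    than two letters and makes the pigeonhole strict.\<close>
  define M where "M = real (card B) + 1"
  have M: "M \<ge> 1" "M > 0" by (auto simp: M_def)
  \<comment> \<open>With this \<open>t\<close> the weight sum of one coordinate is at most exp(c/4),
    and \<open>d\<close> is chosen so that t^(-d n) = exp(c n / 4). The product exp(c n / 2) stays
    below the assumed size exp(c n).\<close>
  define t where "t = min (1/2) ((exp (c/4) - 1) / M)"
  have t: "0 < t" "t < 1" "1 + M * t \<le> exp (c/4)"
    using c M by (auto simp: t_def min_def field_simps)
  define d where "d = c / (4 * ln (1 / t))"
  have lnt: "ln (1 / t) > 0" using t by (simp add: ln_div)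
  have d: "d > 0" using c lnt by (simp add: d_def)
  have td: "t powr (- d * n) = exp (c/4 * n)" for n
    using t lnt by (simp add: powr_def d_def ln_div field_simps)
  show ?thesis
  proof (rule that[of "d / M"])
    show "0 < d / M" using d M by simp
    fix F :: "'a set" and S
    assume F: "finite F" "F \<noteq> {}" and S: "S \<subseteq> F \<rightarrow>\<^sub>E L" and big: "exp (c * card F) \<le> card S"
    define n where "n = card F"
    have n: "n > 0" using F by (auto simp: n_def card_gt_0_iff)
    have "(\<Sum>p\<in>P. (1::real) * (if p = {} then 1 else t)) = 1 + (\<Sum>p\<in>B. t)"
    proof -
      have "(\<Sum>p\<in>B. (1::real) * (if p = {} then 1 else t)) = (\<Sum>p\<in>B. t)"
        using B(2) by (intro sum.cong) auto
      then show ?thesis using B by (simp add: P_def)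
    qed
    also have "\<dots> \<le> 1 + M * t" using t by (simp add: M_def)
    finally have sum: "(\<Sum>p\<in>P. (1::real) * (if p = {} then 1 else t)) \<le> exp (c/4)"
      using t by simp
    obtain q where q: "q \<in> F \<rightarrow>\<^sub>E P" "shatters S F q" "d * n \<le> real (card {s \<in> F. q s \<noteq> {}})"
    proof (rule exists_large_shattered[OF F(1) L _ S, where P = P and w = "\<lambda>_. 1" and t = t
        and d = "d * n"])
      show "finite P" using B by (simp add: P_def)
      show "real (card R) \<le> (\<Sum>p\<in>{p \<in> P. p \<subseteq> R}. 1)" if R: "R \<subseteq> L" "R \<noteq> {}" for R
      proof -
        have fR: "finite R" using R L finite_subset by auto
        have "{p \<in> P. p \<subseteq> R} = insert {} {p. p \<subseteq> R \<and> card p = 2}" using R by (auto simp: P_def B_def)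
        then have "card {p \<in> P. p \<subseteq> R} = 1 + (card R choose 2)"
          using fR n_subsets[OF fR, of 2] by (simp add: card_insert_if)
        moreover have "r \<le> 1 + (r choose 2)" for r :: nat
        proof (induction r)
          case (Suc r)
          then show ?case by (cases r) (auto simp: numeral_2_eq_2)
        qed simp
        ultimately show ?thesis by (simp flip: of_nat_Suc)
      qed
      have "t powr (- (d * n)) * (\<Sum>p\<in>P. 1 * (if p = {} then 1 else t)) ^ card F
          \<le> exp (c/4 * n) * exp (c/4) ^ card F"
        using td[of n] t by (intro mult_mono power_mono sum) (auto intro!: sum_nonneg zero_le_power)
      also have "\<dots> = exp (c/2 * n)" by (simp add: n_def flip: exp_of_nat2_mult exp_add)
      also have "\<dots> < exp (c * n)" using c n by simp
      finally show "t powr (- (d * n)) * (\<Sum>p\<in>P. 1 * (if p = {} then 1 else t)) ^ card F < real (card S)"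
        using big by (simp add: n_def)
    qed (use t in auto)
    have "\<exists>p\<in>B. d / M * n \<le> card {s \<in> F. q s = p}"
    proof (rule ccontr)
      assume "\<not> ?thesis"
      then have less: "real (card {s \<in> F. q s = p}) \<le> d / M * n" if "p \<in> B" for p using that by force
      have "{s \<in> F. q s \<noteq> {}} = (\<Union>p\<in>B. {s \<in> F. q s = p})" using q(1) B by (auto simp: P_def PiE_iff)
      then have "real (card {s \<in> F. q s \<noteq> {}}) \<le> (\<Sum>p\<in>B. real (card {s \<in> F. q s = p}))"
        using B card_UN_le[of B "\<lambda>p. {s \<in> F. q s = p}"] by (simp flip: of_nat_sum)
      also have "\<dots> \<le> (M - 1) * (d / M * n)" using less sum_bounded_above[of B _ "d / M * n"]
          by (auto simp: M_def)
      also have "\<dots> < M * (d / M * n)" using d M n by (intro mult_strict_right_mono) auto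
      finally show False using q(3) M by simp
    qed
    then obtain p where p: "p \<in> B" "d / M * n \<le> card {s \<in> F. q s = p}" by blast
    then obtain a b where ab: "p = {a, b}" "a \<noteq> b" "a \<in> L" "b \<in> L"
      by (auto simp: B_def card_2_iff)
    show "\<exists>a\<in>L. \<exists>b\<in>L. a \<noteq> b \<and> (\<exists>J\<subseteq>F. d / M * card F \<le> card J \<and>
        (\<forall>f\<in>J \<rightarrow> {a, b}. \<exists>w\<in>S. \<forall>s\<in>J. w s = f s))"
    proof -
      let ?J = "{s \<in> F. q s = p}"
      have "\<exists>w\<in>S. \<forall>s\<in>?J. w s = f s" if f: "f \<in> ?J \<rightarrow> {a, b}" for f
      proof -
        \<comment> \<open>Shattering asks for letters at all constrained coordinates, so those
          carrying another pair are filled arbitrarily.\<close>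
        define g where "g s = (if q s = p then f s else SOME y. y \<in> q s)" for s
        have "g s \<in> q s" if s: "s \<in> F" "q s \<noteq> {}" for s
          using funcset_mem[OF f, of s] s ab(1) by (auto simp: g_def some_in_eq)
        then obtain w where "w \<in> S" "\<forall>s\<in>F. q s \<noteq> {} \<longrightarrow> w s = g s"
          using q(2)[unfolded shatters_def, rule_format, of g] by blast
        then show ?thesis using ab(1) by (intro bexI[of _ w]) (auto simp: g_def)
      qed
      then have "\<exists>J\<subseteq>F. d / M * card F \<le> card J \<and> (\<forall>f\<in>J \<rightarrow> {a, b}. \<exists>w\<in>S. \<forall>s\<in>J. w s = f s)"
        using p(2) by (intro exI[of _ ?J]) (simp add: n_def)
      then show ?thesis using ab(2,3,4) by blast
    qed
  qed
qed

text \<open>A proper subset of the alphabet has at most k - 1 letters, so the weights k - 1 on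
  \<open>{}\<close> and 1 on \<open>L\<close> are admissible. Damping by 1/2 makes a coordinate
  contribute k - 1/2, strictly less than k.\<close>

lemma dense_shatters_alphabet:
  assumes L: "finite L" "L \<noteq> {}"
  obtains c :: real where "0 < c"
    "\<And>(F :: 'a set) S. finite F \<Longrightarrow> F \<noteq> {} \<Longrightarrow> S \<subseteq> F \<rightarrow>\<^sub>E L \<Longrightarrow>
      (1 - 1 / (4 * card L)) * card L ^ card F < card S \<Longrightarrow>
      \<exists>J\<subseteq>F. c * card F \<le> card J \<and> (\<forall>f\<in>J \<rightarrow> L. \<exists>w\<in>S. \<forall>s\<in>J. w s = f s)"
proof -
  define k where "k = real (card L)"
  have "card L > 0" using L by (simp add: card_gt_0_iff)
  then have k: "k \<ge> 1" unfolding k_def by linarith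
  \<comment> \<open>Solves 2^d (k - 1/2) = k - 1/4. The resulting bound (k - 1/4)^n is at most (1 -
    1/(4k)) k^n because n >= 1, which explains the threshold in the hypothesis.\<close>
  define d where "d = log 2 ((k - 1/4) / (k - 1/2))"
  have d: "d > 0" using k by (simp add: d_def)
  have k4: "k - 1/4 = k * (1 - 1 / (4 * k))" using k by (simp add: field_simps)
  have d2: "(1/2) powr (- d) * (k - 1/2) = k - 1/4"
    using k by (simp add: d_def powr_minus_divide powr_divide)
  show ?thesis
  proof (rule that[OF d])
    fix F :: "'a set" and S
    assume F: "finite F" "F \<noteq> {}" and S: "S \<subseteq> F \<rightarrow>\<^sub>E L"
      and big: "(1 - 1 / (4 * card L)) * card L ^ card F < card S"
    let ?w = "\<lambda>p. if p = {} then k - 1 else 1"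
    define n where "n = card F"
    have n: "n > 0" using F by (auto simp: n_def card_gt_0_iff)
    obtain q where q: "q \<in> F \<rightarrow>\<^sub>E {{}, L}" "shatters S F q" "d * n \<le> real (card {s \<in> F. q s \<noteq> {}})"
    proof (rule exists_large_shattered[OF F(1) L(1) _ S, where P = "{{}, L}" and w = ?w and t = "1/2"
        and d = "d * n"])
      show "real (card R) \<le> (\<Sum>p\<in>{p \<in> {{}, L}. p \<subseteq> R}. ?w p)" if R: "R \<subseteq> L" "R \<noteq> {}" for R
      proof (cases "R = L")
        case True
        then have "{p \<in> {{}, L}. p \<subseteq> R} = {{}, L}" by auto
        then show ?thesis using L True by (simp add: k_def)
      next
        case False
        then have "{p \<in> {{}, L}. p \<subseteq> R} = {{}}" using R by auto
        moreover have "card R < card L" using R False L by (intro psubset_card_mono) auto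
        ultimately show ?thesis using L by (simp add: k_def)
      qed
      have "((1/2) powr (- d)) powr n = (1/2) powr (- (d * n))" by (simp add: powr_powr)
      then have "(1/2) powr (- (d * n)) * (\<Sum>p\<in>{{}, L}. ?w p * (if p = {} then 1 else 1/2)) ^ card F
          = ((1/2) powr (- d) * (k - 1/2)) ^ n"
        using L by (simp add: n_def power_mult_distrib powr_realpow)
      also have "\<dots> = k ^ n * (1 - 1 / (4 * k)) ^ n"
        using k by (simp only: d2 k4 power_mult_distrib)
      also have "\<dots> \<le> k ^ n * (1 - 1 / (4 * k))"
        using k n by (intro mult_left_mono power_decreasing[of 1 n, simplified]) (auto simp: field_simps)
      finally show "(1/2) powr (- (d * n)) * (\<Sum>p\<in>{{}, L}. ?w p * (if p = {} then 1 else 1/2)) ^ card F <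
          real (card S)"
        using big by (simp add: n_def k_def mult.commute)
    qed (use k in auto)
    show "\<exists>J\<subseteq>F. d * card F \<le> card J \<and> (\<forall>f\<in>J \<rightarrow> L. \<exists>w\<in>S. \<forall>s\<in>J. w s = f s)"
    proof (intro exI[of _ "{s \<in> F. q s \<noteq> {}}"] conjI ballI)
      fix f assume f: "f \<in> {s \<in> F. q s \<noteq> {}} \<rightarrow> L"
      have "f s \<in> q s" if s: "s \<in> F" "q s \<noteq> {}" for s
      proof -
        have "f s \<in> L" by (rule funcset_mem[OF f]) (use s in simp)
        moreover have "q s = {} \<or> q s = L" using PiE_mem[OF q(1) s(1)] by blast
        ultimately show ?thesis using s(2) by metis
      qed
      then have "\<exists>w\<in>S. \<forall>s\<in>F. q s \<noteq> {} \<longrightarrow> w s = f s"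
        using q(2)[unfolded shatters_def, rule_format, of f] by simp
      then show "\<exists>w\<in>S. \<forall>s\<in>{s \<in> F. q s \<noteq> {}}. w s = f s" by fastforce
    qed (use q(3) in \<open>auto simp: n_def\<close>)
  qed
qed

section \<open>Independence density\<close>

lemma sum_power_card_compl:
  fixes m :: real
  assumes "finite F"
  shows "(\<Sum>A\<in>Pow F. m ^ card (F - A)) = (1 + m) ^ card F"
  using prod_add[OF assms, of "\<lambda>_. 1" "\<lambda>_. m"] by simp

text \<open>A subset \<open>A\<close> follows \<open>r : F \<rightarrow> I\<close> if its labels
  agree with \<open>r\<close> on \<open>A\<close>. On average over \<open>r\<close> there are (1 +
  m)^n / m^n = (1 + 1/m)^n such subsets, so some \<open>r\<close> has exponentially many. As words
  with \<open>None\<close> off \<open>A\<close> they shatter a pair of letters; at \<open>s\<close>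
  only \<open>None\<close> and \<open>Some (r s)\<close> occur, so the pair can only be
  \<open>None\<close> and one \<open>Some i\<close>.\<close>

lemma exists_constant_choice:
  assumes I: "finite I" "I \<noteq> {}"
  obtains c :: real where "0 < c"
    "\<And>(F :: 'a set) \<tau>. finite F \<Longrightarrow> F \<noteq> {} \<Longrightarrow> \<forall>A\<subseteq>F. \<forall>s\<in>A. \<tau> A s \<in> I \<Longrightarrow>
      \<exists>i\<in>I. \<exists>J\<subseteq>F. c * card F \<le> card J \<and> (\<forall>B\<subseteq>J. \<exists>A\<subseteq>F. A \<inter> J = B \<and> (\<forall>s\<in>B. \<tau> A s = i))"
proof -
  define L where "L = insert None (Some ` I)"
  define m where "m = real (card I)"
  have m: "m > 0" using I by (simp add: m_def card_gt_0_iff)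
  have "finite L" "0 < ln (1 + 1 / m)" using I m by (auto simp: L_def intro!: ln_gt_zero)
  then obtain c :: real where c: "0 < c"
    "\<And>(F :: 'a set) S. finite F \<Longrightarrow> F \<noteq> {} \<Longrightarrow> S \<subseteq> F \<rightarrow>\<^sub>E L \<Longrightarrow> exp (ln (1 + 1 / m) * card F) \<le> card S \<Longrightarrow>
      \<exists>a\<in>L. \<exists>b\<in>L. a \<noteq> b \<and> (\<exists>J\<subseteq>F. c * card F \<le> card J \<and>
        (\<forall>f\<in>J \<rightarrow> {a, b}. \<exists>w\<in>S. \<forall>s\<in>J. w s = f s))"
    by (rule constant_pair_shattered) (rule that)
  show ?thesis
  proof (rule that[OF c(1)])
    fix F :: "'a set" and \<tau>
    assume F: "finite F" "F \<noteq> {}" and "\<forall>A\<subseteq>F. \<forall>s\<in>A. \<tau> A s \<in> I"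
    then have \<tau>: "\<And>A s. A \<subseteq> F \<Longrightarrow> s \<in> A \<Longrightarrow> \<tau> A s \<in> I" by blast
    define E where "E r = {A \<in> Pow F. \<forall>s\<in>A. \<tau> A s = r s}" for r
    let ?R = "F \<rightarrow>\<^sub>E I"
    have finR: "finite ?R" using F I by (intro finite_PiE) auto
    have "(\<Sum>r\<in>?R. real (card (E r))) = (\<Sum>r\<in>?R. \<Sum>A\<in>Pow F. if \<forall>s\<in>A. \<tau> A s = r s then 1 else 0)"
      using F by (simp add: E_def flip: sum.inter_filter)
    also have "\<dots> = (\<Sum>A\<in>Pow F. \<Sum>r\<in>?R. if \<forall>s\<in>A. \<tau> A s = r s then 1 else 0)"
      by (rule sum.swap)
    also have "\<dots> = (\<Sum>A\<in>Pow F. m ^ card (F - A))"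
    proof (rule sum.cong[OF refl])
      fix A assume A: "A \<in> Pow F"
      \<comment> \<open>A fixed \<open>A\<close> prescribes \<open>r\<close> on \<open>A\<close> and
        leaves \<open>m\<close> choices at every other point.\<close>
      have "{r \<in> ?R. \<forall>s\<in>A. \<tau> A s = r s} = PiE F (\<lambda>s. if s \<in> A then {\<tau> A s} else I)"
      proof (intro equalityI subsetI)
        fix r assume r: "r \<in> {r \<in> ?R. \<forall>s\<in>A. \<tau> A s = r s}"
        then have "r s \<in> I" if "s \<in> F" for s using that by auto
        moreover have "r s = undefined" if "s \<notin> F" for s using that r PiE_arb by fastforce
        ultimately show "r \<in> PiE F (\<lambda>s. if s \<in> A then {\<tau> A s} else I)"
          using r by (intro PiE_I) auto
      next
        fix r assume r: "r \<in> PiE F (\<lambda>s. if s \<in> A then {\<tau> A s} else I)"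
        then have mem: "r s \<in> (if s \<in> A then {\<tau> A s} else I)" if "s \<in> F" for s
          by (rule PiE_mem) (rule that)
        have "r s \<in> I" if "s \<in> F" for s
          using mem[OF that] A \<tau>[of A s] by (cases "s \<in> A") auto
        moreover have "r s = undefined" if "s \<notin> F" for s by (rule PiE_arb[OF r that])
        ultimately have "r \<in> ?R" by (intro PiE_I)
        moreover have "\<tau> A s = r s" if "s \<in> A" for s using mem[of s] that A by auto
        ultimately show "r \<in> {r \<in> ?R. \<forall>s\<in>A. \<tau> A s = r s}" by simp
      qed
      then have "(\<Sum>r\<in>?R. if \<forall>s\<in>A. \<tau> A s = r s then 1 else 0) = real (\<Prod>s\<in>F. card (if s \<in> A then {\<tau> A s}
          else I))"
        using F finR by (simp add: card_PiE flip: sum.inter_filter)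
      also have "\<dots> = (\<Prod>s\<in>F. if s \<in> F - A then m else 1)"
        unfolding of_nat_prod by (intro prod.cong) (auto simp: m_def)
      also have "\<dots> = m ^ card (F - A)"
      proof -
        have "(\<Prod>s\<in>F - A. m) = (\<Prod>s\<in>F. if s \<in> F - A then m else 1)"
          by (rule prod.mono_neutral_cong_left) (use F in auto)
        then show ?thesis by simp
      qed
      finally show "(\<Sum>r\<in>?R. if \<forall>s\<in>A. \<tau> A s = r s then 1 else 0) = m ^ card (F - A)" .
    qed
    also have "\<dots> = (1 + m) ^ card F" by (rule sum_power_card_compl[OF F(1)])
    also have "\<dots> = real (card ?R) * (1 + 1 / m) ^ card F"
      using F m by (simp add: card_PiE field_simps m_def flip: power_mult_distrib)
    finally have total: "(\<Sum>r\<in>?R. real (card (E r))) = real (card ?R) * (1 + 1 / m) ^ card F" .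
    have "\<exists>r\<in>?R. (1 + 1 / m) ^ card F \<le> real (card (E r))"
    proof (rule ccontr)
      assume "\<not> ?thesis"
      then have "(\<Sum>r\<in>?R. real (card (E r))) < (\<Sum>r\<in>?R. (1 + 1 / m) ^ card F)"
        using finR I by (intro sum_strict_mono) (auto simp: PiE_eq_empty_iff)
      then show False using total by simp
    qed
    then obtain r where r: "r \<in> ?R" "(1 + 1 / m) ^ card F \<le> real (card (E r))" by blast
    define word where "word A = (\<lambda>s\<in>F. if s \<in> A then Some (\<tau> A s) else None)" for A
    have "inj_on word (E r)"
    proof (rule inj_on_inverseI[where g = "\<lambda>w. {s \<in> F. w s \<noteq> None}"])
      show "{s \<in> F. word A s \<noteq> None} = A" if "A \<in> E r" for A
        using that by (auto simp: E_def word_def)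
    qed
    then have "card (word ` E r) = card (E r)" by (rule card_image)
    moreover have "exp (ln (1 + 1 / m) * card F) = (1 + 1 / m) ^ card F"
      using m by (simp add: exp_of_nat2_mult add_pos_pos)
    ultimately have "exp (ln (1 + 1 / m) * card F) \<le> card (word ` E r)" using r by simp
    moreover have "word ` E r \<subseteq> F \<rightarrow>\<^sub>E L"
    proof clarify
      fix A assume A: "A \<in> E r"
      have "word A s \<in> L" if "s \<in> F" for s
        using \<tau>[of A s] A that by (auto simp: word_def L_def E_def)
      then show "word A \<in> F \<rightarrow>\<^sub>E L" by (auto simp: word_def)
    qed
    ultimately obtain a b J where ab: "a \<in> L" "b \<in> L" "a \<noteq> b" "J \<subseteq> F" "c * card F \<le> card J"
      "\<And>f. f \<in> J \<rightarrow> {a, b} \<Longrightarrow> \<exists>w\<in>word ` E r. \<forall>s\<in>J. w s = f s"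
      using c(2)[OF F, of "word ` E r"] by metis
    have "J \<noteq> {}"
    proof
      assume "J = {}"
      then show False using ab(5) c(1) F by (simp add: mult_le_0_iff card_gt_0_iff)
    qed
    then obtain s0 where s0: "s0 \<in> J" by blast
    \<comment> \<open>The constant word \<open>x\<close> on \<open>J\<close> is realized by some
      member of \<open>E r\<close>, which restricts \<open>x\<close> at every coordinate of
      \<open>J\<close> at once.\<close>
    have letter: "s \<in> J \<Longrightarrow> x = None \<or> x = Some (r s)" if x: "x = a \<or> x = b" for x s
    proof -
      obtain A where A: "A \<in> E r" "\<forall>s\<in>J. word A s = x"
        using ab(6)[of "\<lambda>_. x"] x by auto
      assume s: "s \<in> J"
      then have "x = word A s" "s \<in> F" using A ab(4) by auto
      then show ?thesis using A(1) by (auto simp: word_def E_def)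
    qed
    obtain i where i: "{a, b} = {None, Some i}" "i \<in> I"
      using letter[of a s0] letter[of b s0] s0 ab(1-3) by (auto simp: L_def)
    have "\<exists>A\<subseteq>F. A \<inter> J = B \<and> (\<forall>s\<in>B. \<tau> A s = i)" if B: "B \<subseteq> J" for B
    proof -
      have "(\<lambda>s. if s \<in> B then Some i else None) \<in> J \<rightarrow> {a, b}" unfolding i(1) by auto
      then obtain A where A: "A \<in> E r" "\<And>s. s \<in> J \<Longrightarrow> word A s = (if s \<in> B then Some i else None)"
        using ab(6) by blast
      have "s \<in> A \<longleftrightarrow> s \<in> B" "s \<in> B \<longrightarrow> \<tau> A s = i" if "s \<in> J" for s
        using A(2)[OF that] ab(4) that by (auto simp: word_def split: if_splits)
      then show ?thesis using A(1) B by (intro exI[of _ A]) (auto simp: E_def)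
    qed
    then show "\<exists>i\<in>I. \<exists>J\<subseteq>F. c * card F \<le> card J \<and> (\<forall>B\<subseteq>J. \<exists>A\<subseteq>F. A \<inter> J = B \<and> (\<forall>s\<in>B. \<tau> A s = i))"
      using i(2) ab(4,5) by blast
  qed
qed


section \<open>Tuples of positive independence density\<close>

definition positive_density ::
  "('g, 'm) monoid_scheme \<Rightarrow> 'x topology \<Rightarrow> ('g \<Rightarrow> 'x \<Rightarrow> 'x) \<Rightarrow> nat \<Rightarrow> (nat \<Rightarrow> 'x set) \<Rightarrow> bool" where
  "positive_density G T \<phi> k U \<longleftrightarrow> (\<exists>c>0. \<forall>F. finite F \<and> F \<subseteq> carrier G \<longrightarrow>
     (\<exists>F'\<subseteq>F. independence_set G T \<phi> k U (topspace T) F' \<and> c * real (card F) \<le> real (card F')))"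

definition set_pair :: "'x set \<Rightarrow> 'x set \<Rightarrow> nat \<Rightarrow> 'x set" where
  "set_pair A B i = (if i = 1 then A else B)"

lemma independence_setE:
  assumes "independence_set G T \<phi> k A D F" "\<sigma> \<in> F \<rightarrow> {1..k}"
  obtains z where "z \<in> D" "\<And>s. s \<in> F \<Longrightarrow> z \<in> topspace T" "\<And>s. s \<in> F \<Longrightarrow> \<phi> s z \<in> A (\<sigma> s)"
proof -
  have "D \<inter> (\<Inter>s\<in>F. {x \<in> topspace T. \<phi> s x \<in> A (\<sigma> s)}) \<noteq> {}"
    by (rule bspec[OF _ assms(2)]) (use assms(1) in \<open>simp add: independence_set_def\<close>)
  then obtain z where "z \<in> D" "z \<in> (\<Inter>s\<in>F. {x \<in> topspace T. \<phi> s x \<in> A (\<sigma> s)})" by blast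
  then show ?thesis by (intro that[of z]) auto
qed

lemma independence_setI:
  assumes "finite F" "F \<subseteq> carrier G" "D \<subseteq> topspace T"
    "\<And>\<sigma>. \<sigma> \<in> F \<rightarrow> {1..k} \<Longrightarrow> \<exists>z\<in>D. \<forall>s\<in>F. \<phi> s z \<in> A (\<sigma> s)"
  shows "independence_set G T \<phi> k A D F"
  unfolding independence_set_def
proof (intro conjI ballI assms(1,2))
  fix \<sigma> assume "\<sigma> \<in> F \<rightarrow> {1..k}"
  then obtain z where "z \<in> D" "\<forall>s\<in>F. \<phi> s z \<in> A (\<sigma> s)" using assms(4) by blast
  then have "z \<in> D \<inter> (\<Inter>s\<in>F. {x \<in> topspace T. \<phi> s x \<in> A (\<sigma> s)})" using assms(3) by auto
  then show "D \<inter> (\<Inter>s\<in>F. {x \<in> topspace T. \<phi> s x \<in> A (\<sigma> s)}) \<noteq> {}" by blast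
qed

text \<open>A choice on \<open>F'\<close> extends to \<open>F\<close> by the index 1, which lies in
  \<open>{1..k}\<close> as soon as \<open>F'\<close> is nonempty. For empty \<open>F'\<close>, where
  k may be 0, all that is asked is a point of \<open>D\<close>.\<close>

lemma independence_set_subset:
  assumes F: "independence_set G T \<phi> k A D F" and "F' \<subseteq> F" and D: "D \<subseteq> topspace T" "D \<noteq> {}"
  shows "independence_set G T \<phi> k A D F'"
proof (rule independence_setI[OF _ _ D(1)])
  show "finite F'" "F' \<subseteq> carrier G"
    using F \<open>F' \<subseteq> F\<close> finite_subset by (auto simp: independence_set_def)
  fix \<sigma> assume \<sigma>: "\<sigma> \<in> F' \<rightarrow> {1..k}"
  show "\<exists>z\<in>D. \<forall>s\<in>F'. \<phi> s z \<in> A (\<sigma> s)"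
  proof (cases "F' = {}")
    case True
    then show ?thesis using D(2) by auto
  next
    case False
    then have "1 \<in> {1..k}" using \<sigma> by fastforce
    with \<sigma> have "(\<lambda>s. if s \<in> F' then \<sigma> s else 1) \<in> F \<rightarrow> {1..k}" by auto
    then show ?thesis by (rule independence_setE[OF F]) (use \<open>F' \<subseteq> F\<close> in fastforce)
  qed
qed

lemma positive_densityE:
  assumes "positive_density G T \<phi> k U"
  obtains c :: real where "c > 0" "\<And>F. finite F \<Longrightarrow> F \<subseteq> carrier G \<Longrightarrow>
     \<exists>F'\<subseteq>F. independence_set G T \<phi> k U (topspace T) F' \<and> c * real (card F) \<le> real (card F')"
proof -
  obtain c where "c > 0 \<and> (\<forall>F. finite F \<and> F \<subseteq> carrier G \<longrightarrow>
     (\<exists>F'\<subseteq>F. independence_set G T \<phi> k U (topspace T) F' \<and> c * real (card F) \<le> real (card F')))"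
    using assms unfolding positive_density_def by (elim exE) (rule that)
  then show ?thesis by (intro that[of c]) simp_all
qed

text \<open>A choice \<sigma> for \<open>V\<close> is played as the choice h \<circ> \<sigma> for
  \<open>U\<close>. This handles enlarging, permuting, repeating and dropping entries of a tuple in
  one statement.\<close>

lemma positive_density_relabel:
  assumes "positive_density G T \<phi> k U" "h \<in> {1..l} \<rightarrow> {1..k}"
    "\<And>i. i \<in> {1..l} \<Longrightarrow> U (h i) \<inter> topspace T \<subseteq> V i"
    and act: "\<And>s x. s \<in> carrier G \<Longrightarrow> x \<in> topspace T \<Longrightarrow> \<phi> s x \<in> topspace T"
  shows "positive_density G T \<phi> l V"
proof -
  have "independence_set G T \<phi> l V (topspace T) F" if F: "independence_set G T \<phi> k U (topspace T) F" for F
  proof (rule independence_setI[OF _ _ subset_refl])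
    show "finite F" "F \<subseteq> carrier G" using F by (auto simp: independence_set_def)
    fix \<sigma> assume \<sigma>: "\<sigma> \<in> F \<rightarrow> {1..l}"
    then have "(\<lambda>s. h (\<sigma> s)) \<in> F \<rightarrow> {1..k}" using assms(2) by (auto simp: Pi_iff)
    then obtain z where z: "z \<in> topspace T" "\<And>s. s \<in> F \<Longrightarrow> \<phi> s z \<in> U (h (\<sigma> s))"
      using F by (metis independence_setE)
    have "\<phi> s z \<in> V (\<sigma> s)" if "s \<in> F" for s
      using assms(3)[of "\<sigma> s"] z(2)[OF that] act[of s z] z(1) \<sigma> that \<open>F \<subseteq> carrier G\<close> by blast
    then show "\<exists>z\<in>topspace T. \<forall>s\<in>F. \<phi> s z \<in> V (\<sigma> s)" using z by blast
  qed
  then show ?thesis using assms(1) unfolding positive_density_def by meson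
qed

section \<open>Actions by automorphisms of a compact metrizable group\<close>

locale algebraic_action =
  fixes G :: "('g, 'm) monoid_scheme" and X :: "('x, 'n) monoid_scheme"
    and T :: "'x topology" and \<phi> :: "'g \<Rightarrow> 'x \<Rightarrow> 'x"
  assumes amenable: "countable_amenable_group G"
    and cmg: "compact_metrizable_group X T"
    and acts: "acts_by_automorphisms G X T \<phi>"
begin

sublocale G: group G using amenable by (simp add: countable_amenable_group_def)
sublocale X: group X using cmg by (simp add: compact_metrizable_group_def)

lemma topspace_T [simp]: "topspace T = carrier X"
  using cmg by (simp add: compact_metrizable_group_def)

abbreviation multX (infixl "\<cdot>" 70) where "x \<cdot> y \<equiv> x \<otimes>\<^bsub>X\<^esub> y"
abbreviation multG (infixl "\<star>" 70) where "s \<star> t \<equiv> s \<otimes>\<^bsub>G\<^esub> t"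
abbreviation "indep \<equiv> independence_set G T \<phi>"
abbreviation "pos_density \<equiv> positive_density G T \<phi>"
abbreviation "IE \<equiv> IE_tuples G T \<phi>"
abbreviation "IE_grp \<equiv> IE_group G X T \<phi>"

lemma openin_carrier [simp]: "openin T (carrier X)"
  using openin_topspace[of T] by simp

lemma \<phi>_auto: "s \<in> carrier G \<Longrightarrow> \<phi> s \<in> auto X"
  using acts group_hom.hom_closed[of G "AutoGroup X" \<phi> s]
  by (simp add: acts_by_automorphisms_def AutoGroup_def)

lemma \<phi>_closed [simp]: "s \<in> carrier G \<Longrightarrow> x \<in> carrier X \<Longrightarrow> \<phi> s x \<in> carrier X"
  using \<phi>_auto[of s] by (auto simp: auto_def hom_def)

lemma \<phi>_mult: "s \<in> carrier G \<Longrightarrow> x \<in> carrier X \<Longrightarrow> y \<in> carrier X \<Longrightarrow>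
    \<phi> s (x \<cdot> y) = \<phi> s x \<cdot> \<phi> s y"
  using \<phi>_auto[of s] by (auto simp: auto_def hom_def)

lemma \<phi>_one [simp]: "s \<in> carrier G \<Longrightarrow> \<phi> s \<one>\<^bsub>X\<^esub> = \<one>\<^bsub>X\<^esub>"
  using \<phi>_mult[of s "\<one>\<^bsub>X\<^esub>" "\<one>\<^bsub>X\<^esub>"] by simp

lemma \<phi>_inv: "s \<in> carrier G \<Longrightarrow> x \<in> carrier X \<Longrightarrow> \<phi> s (inv\<^bsub>X\<^esub> x) = inv\<^bsub>X\<^esub> (\<phi> s x)"
  using \<phi>_mult[of s "inv\<^bsub>X\<^esub> x" x] by (intro X.inv_equality[symmetric]) auto

lemma \<phi>_comp: "s \<in> carrier G \<Longrightarrow> t \<in> carrier G \<Longrightarrow> x \<in> carrier X \<Longrightarrow>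
    \<phi> (s \<star> t) x = \<phi> s (\<phi> t x)"
  using acts group_hom.hom_mult[of G "AutoGroup X" \<phi> s t] \<phi>_auto[of s] \<phi>_auto[of t]
  by (simp add: acts_by_automorphisms_def AutoGroup_def BijGroup_def auto_def compose_def)

lemma \<phi>_id [simp]: "x \<in> carrier X \<Longrightarrow> \<phi> \<one>\<^bsub>G\<^esub> x = x"
proof -
  assume x: "x \<in> carrier X"
  have "bij_betw (\<phi> \<one>\<^bsub>G\<^esub>) (carrier X) (carrier X)"
    using \<phi>_auto[of "\<one>\<^bsub>G\<^esub>"] by (auto simp: auto_def Bij_def)
  moreover have "\<phi> \<one>\<^bsub>G\<^esub> (\<phi> \<one>\<^bsub>G\<^esub> x) = \<phi> \<one>\<^bsub>G\<^esub> x" using \<phi>_comp[of "\<one>\<^bsub>G\<^esub>" "\<one>\<^bsub>G\<^esub>" x] x by simp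
  ultimately show ?thesis using x by (auto simp: bij_betw_def inj_on_def)
qed

lemma \<phi>_inverse [simp]:
  "s \<in> carrier G \<Longrightarrow> x \<in> carrier X \<Longrightarrow> \<phi> (inv\<^bsub>G\<^esub> s) (\<phi> s x) = x"
  "s \<in> carrier G \<Longrightarrow> x \<in> carrier X \<Longrightarrow> \<phi> s (\<phi> (inv\<^bsub>G\<^esub> s) x) = x"
  by (simp_all flip: \<phi>_comp)

lemma continuous_\<phi>: "s \<in> carrier G \<Longrightarrow> continuous_map T T (\<phi> s)"
  using acts by (simp add: acts_by_automorphisms_def)

lemma compact_T: "compact_space T" and metrizable_T: "metrizable_space T"
  using cmg by (auto simp: compact_metrizable_group_def)

lemma continuous_mult:
  assumes "continuous_map S T f" "continuous_map S T g"
  shows "continuous_map S T (\<lambda>x. f x \<cdot> g x)"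
proof -
  have "continuous_map S (prod_topology T T) (\<lambda>x. (f x, g x))"
    using assms by (simp add: continuous_map_pairwise o_def)
  moreover have "continuous_map (prod_topology T T) T (\<lambda>(x, y). x \<cdot> y)"
    using cmg by (simp add: compact_metrizable_group_def)
  ultimately show ?thesis using continuous_map_compose by (fastforce simp: o_def)
qed

lemma continuous_inv:
  assumes "continuous_map S T f"
  shows "continuous_map S T (\<lambda>x. inv\<^bsub>X\<^esub> f x)"
  using continuous_map_compose[OF assms, of T "\<lambda>x. inv\<^bsub>X\<^esub> x"] cmg
  by (simp add: compact_metrizable_group_def o_def)

text \<open>The average of \<open>card (E' \<inter> (F <#> m))\<close> over \<open>m \<in> F\<inverse> E\<close> is at least half of
  \<open>card E' * card F / card E\<close> by the invariance of \<open>E\<close>, and right translates of independence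
  sets are independence sets.\<close>

lemma independence_set_transfer:
  fixes c :: real
  assumes F: "finite F" "F \<subseteq> carrier G" and E: "finite E" "E \<subseteq> carrier G" "E \<noteq> {}"
    and inv: "card (((\<lambda>s. inv\<^bsub>G\<^esub> s) ` F <#>\<^bsub>G\<^esub> E) - E) \<le> card E"
    and E': "E' \<subseteq> E" "indep k A (topspace T) E'" "c * card E \<le> card E'"
  shows "\<exists>F'\<subseteq>F. indep k A (topspace T) F' \<and> c / 2 * card F \<le> card F'"
proof (cases "F = {}")
  case True
  have "indep k A (topspace T) {}"
    using X.one_closed by (auto simp: independence_set_def)
  then show ?thesis using True by auto
next
  case False
  \<comment> \<open>Almost invariance under the inverses of \<open>F\<close> makes \<open>M\<close>
    at most twice as large as \<open>E\<close>; this is where half of the density is lost.\<close>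
  define M where "M = (\<lambda>s. inv\<^bsub>G\<^esub> s) ` F <#>\<^bsub>G\<^esub> E"
  have M_eq: "M = (\<lambda>(s, e). inv\<^bsub>G\<^esub> s \<star> e) ` (F \<times> E)" by (auto simp: M_def set_mult_def)
  have M: "finite M" "M \<subseteq> carrier G" "M \<noteq> {}" using F E False by (auto simp: M_eq)
  have "card M \<le> card (M - E) + card E"
    using card_mono[of "(M - E) \<union> E" M] card_Un_le[of "M - E" E] M(1) E(1) by force
  then have cardM: "real (card M) \<le> 2 * card E" using inv by (simp add: M_def)
  have "(\<Sum>m\<in>M. card {f \<in> F. f \<star> m \<in> E'}) = (\<Sum>m\<in>M. \<Sum>f\<in>F. if f \<star> m \<in> E' then 1 else 0)"
    using F by (simp flip: sum.inter_filter)
  also have "\<dots> = (\<Sum>f\<in>F. \<Sum>m\<in>M. if f \<star> m \<in> E' then 1 else 0)" by (rule sum.swap)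
  also have "\<dots> = (\<Sum>f\<in>F. card {m \<in> M. f \<star> m \<in> E'})"
    using M by (simp flip: sum.inter_filter)
  also have "\<dots> = (\<Sum>f\<in>F. card E')"
  proof (rule sum.cong[OF refl])
    fix f assume f: "f \<in> F"
    then have fG: "f \<in> carrier G" using F(2) by auto
    have "{m \<in> M. f \<star> m \<in> E'} = (\<lambda>e. inv\<^bsub>G\<^esub> f \<star> e) ` E'"
    proof (intro equalityI subsetI)
      fix m assume m: "m \<in> {m \<in> M. f \<star> m \<in> E'}"
      then have "m \<in> carrier G" using M(2) by auto
      then have "m = inv\<^bsub>G\<^esub> f \<star> (f \<star> m)" using fG by (simp flip: G.m_assoc)
      then show "m \<in> (\<lambda>e. inv\<^bsub>G\<^esub> f \<star> e) ` E'" using m by blast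
    next
      fix m assume "m \<in> (\<lambda>e. inv\<^bsub>G\<^esub> f \<star> e) ` E'"
      then obtain e where e: "e \<in> E'" "m = inv\<^bsub>G\<^esub> f \<star> e" by blast
      then have "e \<in> carrier G" using E(2) E'(1) by auto
      then have "f \<star> m = e" using fG by (simp add: e(2) flip: G.m_assoc)
      then show "m \<in> {m \<in> M. f \<star> m \<in> E'}" using e f E'(1) by (auto simp: M_eq)
    qed
    moreover have "inj_on (\<lambda>e. inv\<^bsub>G\<^esub> f \<star> e) E'"
      using f F(2) E(2) E'(1) by (intro inj_onI) (metis G.inv_closed G.Units_eq G.Units_l_cancel subsetD)
    ultimately show "card {m \<in> M. f \<star> m \<in> E'} = card E'" by (simp add: card_image)
  qed
  finally have total: "(\<Sum>m\<in>M. card {f \<in> F. f \<star> m \<in> E'}) = card F * card E'" by simp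
  have "\<exists>m\<in>M. c / 2 * card F \<le> card {f \<in> F. f \<star> m \<in> E'}"
  proof (rule ccontr)
    assume "\<not> ?thesis"
    then have "(\<Sum>m\<in>M. real (card {f \<in> F. f \<star> m \<in> E'})) < (\<Sum>m\<in>M. c / 2 * card F)"
      using M by (intro sum_strict_mono) auto
    then have less: "real (card F * card E') < card M * (c / 2 * card F)"
      unfolding total[symmetric] by simp
    have "c > 0"
    proof (rule ccontr)
      assume "\<not> c > 0"
      then have "real (card M) * (c / 2 * real (card F)) \<le> 0"
        by (intro mult_nonneg_nonpos mult_nonpos_nonneg) auto
      then show False using less of_nat_0_le_iff[of "card F * card E'", where 'a = real] by linarith
    qed
    then have "card M * (c / 2 * card F) \<le> (2 * card E) * (c / 2 * card F)"
      using cardM by (intro mult_right_mono) auto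
    also have "\<dots> = card F * (c * card E)" by simp
    also have "\<dots> \<le> card F * card E'" unfolding of_nat_mult using E'(3) by (intro mult_left_mono) auto
    finally show False using less by simp
  qed
  then obtain m where m: "m \<in> M" "c / 2 * card F \<le> card {f \<in> F. f \<star> m \<in> E'}" by blast
  let ?F' = "{f \<in> F. f \<star> m \<in> E'}"
  have mG: "m \<in> carrier G" using m M by auto
  have "indep k A (topspace T) ?F'"
  proof (rule independence_setI[OF _ _ subset_refl])
    show "finite ?F'" "?F' \<subseteq> carrier G" using F by auto
    fix \<sigma> assume \<sigma>: "\<sigma> \<in> ?F' \<rightarrow> {1..k}"
    have E'': "indep k A (topspace T) ((\<lambda>f. f \<star> m) ` ?F')"
      using X.one_closed by (intro independence_set_subset[OF E'(2)]) auto
    have cancel_m: "f \<star> m \<star> inv\<^bsub>G\<^esub> m = f" if "f \<in> F" for f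
      using that F(2) mG by (auto simp: G.m_assoc)
    have "(\<lambda>e. \<sigma> (e \<star> inv\<^bsub>G\<^esub> m)) \<in> (\<lambda>f. f \<star> m) ` ?F' \<rightarrow> {1..k}"
      using \<sigma> cancel_m by (auto simp: Pi_iff)
    then obtain z where z: "z \<in> topspace T"
      "\<And>e. e \<in> (\<lambda>f. f \<star> m) ` ?F' \<Longrightarrow> \<phi> e z \<in> A (\<sigma> (e \<star> inv\<^bsub>G\<^esub> m))"
      by (rule independence_setE[OF E'']) (rule that)
    have "\<phi> f (\<phi> m z) \<in> A (\<sigma> f)" if "f \<in> ?F'" for f
    proof -
      have "f \<in> F" "f \<in> carrier G" using that F(2) by auto
      moreover have "f \<star> m \<in> (\<lambda>f. f \<star> m) ` ?F'" using that by (rule imageI)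
      ultimately show ?thesis
        using z(2)[of "f \<star> m"] z(1) cancel_m[of f] \<phi>_comp[of f m z] mG by simp
    qed
    then show "\<exists>z\<in>topspace T. \<forall>s\<in>?F'. \<phi> s z \<in> A (\<sigma> s)"
      using z(1) mG by (intro bexI[of _ "\<phi> m z"] ballI) simp_all
  qed
  with m(2) show ?thesis by (intro exI[of _ ?F'] conjI) auto
qed

section \<open>Densities along Folner sequences\<close>

lemma Folner_eventually_invariant:
  fixes \<epsilon> :: real
  assumes Fn: "left_Folner_sequence G Fn" and K: "finite K" "K \<subseteq> carrier G" and "0 < \<epsilon>"
  shows "\<forall>\<^sub>F n in sequentially. real (card ((K <#>\<^bsub>G\<^esub> Fn n) - Fn n)) \<le> \<epsilon> * card (Fn n)"
proof -
  have "(\<lambda>n. real (card ((K <#>\<^bsub>G\<^esub> Fn n) - Fn n)) / real (card (Fn n))) \<longlonglongrightarrow> 0"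
    using Fn K unfolding left_Folner_sequence_def by blast
  then have "\<forall>\<^sub>F n in sequentially. real (card ((K <#>\<^bsub>G\<^esub> Fn n) - Fn n)) / real (card (Fn n)) < \<epsilon>"
    by (rule order_tendstoD) fact
  moreover have "card (Fn n) > 0" for n
    using Fn by (simp add: left_Folner_sequence_def card_gt_0_iff)
  ultimately show ?thesis by (auto elim!: eventually_mono simp: divide_less_eq)
qed

text \<open>For a given \<open>F\<close> all late terms are almost invariant under the inverses of
  \<open>F\<close>, so among infinitely many rich terms one is also almost invariant, and its
  independence set transfers to \<open>F\<close>. The weak form with infinitely many terms is what a
  pigeonhole along the sequence delivers.\<close>

lemma positive_densityI_Folner:
  fixes c :: real
  assumes Fn: "left_Folner_sequence G Fn" and c: "0 < c"
    and ev: "\<exists>\<^sub>F n in sequentially. \<exists>F'\<subseteq>Fn n. indep k A (topspace T) F' \<and>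
        c * card (Fn n) \<le> card F'"
  shows "pos_density k A"
  unfolding positive_density_def
proof (intro exI[of _ "c / 2"] conjI allI impI)
  fix F assume F: "finite F \<and> F \<subseteq> carrier G"
  have Fn': "finite (Fn n)" "Fn n \<noteq> {}" "Fn n \<subseteq> carrier G" for n
    using Fn by (auto simp: left_Folner_sequence_def)
  let ?K = "(\<lambda>s. inv\<^bsub>G\<^esub> s) ` F"
  have K: "finite ?K" "?K \<subseteq> carrier G" using F by auto
  have ev': "\<forall>\<^sub>F n in sequentially. real (card ((?K <#>\<^bsub>G\<^esub> Fn n) - Fn n)) \<le> 1 * real (card (Fn n))"
    by (rule Folner_eventually_invariant[OF Fn K]) simp
  obtain n where "(\<exists>F'\<subseteq>Fn n. indep k A (topspace T) F' \<and> c * card (Fn n) \<le> card F') \<and>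
      real (card ((?K <#>\<^bsub>G\<^esub> Fn n) - Fn n)) \<le> 1 * real (card (Fn n))"
    using frequently_ex[OF frequently_eventually_frequently[OF ev ev']] by (elim exE) (rule that)
  then have n: "real (card ((?K <#>\<^bsub>G\<^esub> Fn n) - Fn n)) \<le> card (Fn n)"
    "\<exists>F'\<subseteq>Fn n. indep k A (topspace T) F' \<and> c * card (Fn n) \<le> card F'"
    by simp_all
  from n(2) obtain E' where E': "E' \<subseteq> Fn n" "indep k A (topspace T) E'"
    "c * card (Fn n) \<le> card E'" by (elim exE conjE) (rule that)
  from n(1) have "card ((?K <#>\<^bsub>G\<^esub> Fn n) - Fn n) \<le> card (Fn n)" by simp
  then show "\<exists>F'\<subseteq>F. indep k A (topspace T) F' \<and> c / 2 * real (card F) \<le> real (card F')"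
    using independence_set_transfer[of F "Fn n" E' k A c] F Fn' E' by simp
qed (use c in simp)

lemma Folner_sequence_exists: obtains Fn where "left_Folner_sequence G Fn"
  using amenable by (auto simp: countable_amenable_group_def)

lemma positive_densityI_invariant:
  fixes c \<epsilon> :: real
  assumes K: "finite K" "K \<subseteq> carrier G" "0 < \<epsilon>" and c: "0 < c"
    and *: "\<And>F. finite F \<Longrightarrow> F \<subseteq> carrier G \<Longrightarrow> real (card ((K <#>\<^bsub>G\<^esub> F) - F)) \<le> \<epsilon> * real (card F) \<Longrightarrow>
      \<exists>F'\<subseteq>F. indep k A (topspace T) F' \<and> c * real (card F) \<le> real (card F')"
  shows "pos_density k A"
proof -
  obtain Fn where Fn: "left_Folner_sequence G Fn" by (rule Folner_sequence_exists)
  then have Fn': "finite (Fn n)" "Fn n \<subseteq> carrier G" for n by (auto simp: left_Folner_sequence_def)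
  show ?thesis
    using Folner_eventually_invariant[OF Fn K] Fn' *
    by (intro positive_densityI_Folner[OF Fn c] eventually_frequently) (auto elim!: eventually_mono)
qed

lemma IE_tuples_iff:
  "x \<in> IE k \<longleftrightarrow> x \<in> (\<Pi>\<^sub>E i\<in>{1..k}. carrier X) \<and>
     (\<forall>U. (\<forall>i\<in>{1..k}. openin T (U i) \<and> x i \<in> U i) \<longrightarrow> pos_density k U)"
proof -
  have "(\<exists>K c \<epsilon>. finite K \<and> K \<noteq> {} \<and> K \<subseteq> carrier G \<and> c > (0::real) \<and> \<epsilon> > (0::real) \<and>
           (\<forall>F. finite F \<and> F \<subseteq> carrier G \<and>
                real (card ((K <#>\<^bsub>G\<^esub> F) - F)) \<le> \<epsilon> * real (card F) \<longrightarrow>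
              (\<exists>F'\<subseteq>F. indep k U (topspace T) F' \<and>
                 real (card F') \<ge> c * real (card F)))) \<longleftrightarrow> pos_density k U" (is "?L \<longleftrightarrow> _") for U
  proof
    assume ?L
    then obtain K c \<epsilon> where "finite K \<and> K \<noteq> {} \<and> K \<subseteq> carrier G \<and> c > (0::real) \<and> \<epsilon> > (0::real) \<and>
      (\<forall>F. finite F \<and> F \<subseteq> carrier G \<and> real (card ((K <#>\<^bsub>G\<^esub> F) - F)) \<le> \<epsilon> * real (card F) \<longrightarrow>
        (\<exists>F'\<subseteq>F. indep k U (topspace T) F' \<and> real (card F') \<ge> c * real (card F)))"
      by (elim exE) (rule that)
    then show "pos_density k U"
      by (intro positive_densityI_invariant[of K \<epsilon> c]) simp_all
  next
    assume "pos_density k U"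
    then obtain c where "c > 0" "\<And>F. finite F \<Longrightarrow> F \<subseteq> carrier G \<Longrightarrow>
     \<exists>F'\<subseteq>F. indep k U (topspace T) F' \<and> c * real (card F) \<le> real (card F')"
      by (rule positive_densityE) (rule that)
    \<comment> \<open>For K consisting of the identity, K F - F is empty, so every finite
      \<open>F\<close> passes the invariance test.\<close>
    then show ?L by (intro exI[of _ "{\<one>\<^bsub>G\<^esub>}"] exI[of _ c] exI[of _ 1]) simp
  qed
  then show ?thesis unfolding IE_tuples_def topspace_T by simp
qed

text \<open>For every subset C of an independence set choose a point visiting \<open>A\<close> at
  the times in C and \<open>B\<close> at the others, and label each time in C by a member of the
  cover that is visited. \<open>exists_constant_choice\<close> extracts a positive proportion of
  times on which one label suffices.\<close>

lemma positive_density_split: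
  assumes I: "finite I" and pd: "pos_density 2 (set_pair A B)" and A: "A \<inter> carrier X \<subseteq> (\<Union>i\<in>I. U i)"
  shows "\<exists>i\<in>I. pos_density 2 (set_pair (U i) B)"
proof -
  obtain c where c: "c > 0" and ind: "\<And>F. finite F \<Longrightarrow> F \<subseteq> carrier G \<Longrightarrow>
     \<exists>F'\<subseteq>F. indep 2 (set_pair A B) (topspace T) F' \<and> c * real (card F) \<le> real (card F')"
    by (rule positive_densityE[OF pd]) (rule that)
  \<comment> \<open>Testing density on a single group element produces a point of \<open>A\<close>,
    so the cover cannot be empty.\<close>
  obtain F0 where F0: "F0 \<subseteq> {\<one>\<^bsub>G\<^esub>}" "indep 2 (set_pair A B) (topspace T) F0" "c \<le> card F0"
    using ind[of "{\<one>\<^bsub>G\<^esub>}"] by auto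
  moreover have "F0 \<noteq> {}" using F0(3) c by auto
  ultimately have F01: "F0 = {\<one>\<^bsub>G\<^esub>}" by blast
  have "(\<lambda>_. 1) \<in> F0 \<rightarrow> {1..2::nat}" by auto
  then obtain z where "z \<in> carrier X" "\<phi> \<one>\<^bsub>G\<^esub> z \<in> A"
    using independence_setE[OF F0(2)] F01 by (metis insertI1 set_pair_def topspace_T)
  then have "I \<noteq> {}" using A by auto
  obtain c' :: real where c': "0 < c'"
    "\<And>(F :: 'g set) \<tau>. finite F \<Longrightarrow> F \<noteq> {} \<Longrightarrow> \<forall>A\<subseteq>F. \<forall>s\<in>A. \<tau> A s \<in> I \<Longrightarrow>
      \<exists>i\<in>I. \<exists>J\<subseteq>F. c' * card F \<le> card J \<and> (\<forall>B\<subseteq>J. \<exists>A\<subseteq>F. A \<inter> J = B \<and> (\<forall>s\<in>B. \<tau> A s = i))"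
    by (rule exists_constant_choice[OF I \<open>I \<noteq> {}\<close>, where 'a = 'g]) (rule that)
  have step: "\<exists>i\<in>I. \<exists>J\<subseteq>F. indep 2 (set_pair (U i) B) (topspace T) J \<and> (c' * c) * card F \<le> card J"
    if F: "finite F" "F \<subseteq> carrier G" "F \<noteq> {}" for F
  proof -
    obtain F' where F': "F' \<subseteq> F" "indep 2 (set_pair A B) (topspace T) F'" "c * card F \<le> card F'"
      using ind F by blast
    have fin: "finite F'" using F' F finite_subset by auto
    have "card F' > 0" using F'(3) c F by (smt (verit) card_gt_0_iff mult_pos_pos of_nat_0_less_iff)
    then have "F' \<noteq> {}" by auto
    have "\<exists>z\<in>carrier X. (\<forall>s\<in>C. \<phi> s z \<in> A) \<and> (\<forall>s\<in>F' - C. \<phi> s z \<in> B)" if C: "C \<subseteq> F'" for C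
    proof -
      have "(\<lambda>s. if s \<in> C then 1 else 2) \<in> F' \<rightarrow> {1..2::nat}" by auto
      then obtain z where "z \<in> topspace T" "\<And>s. s \<in> F' \<Longrightarrow> \<phi> s z \<in> set_pair A B (if s \<in> C then 1 else 2)"
        using independence_setE[OF F'(2)] by metis
      then have z: "z \<in> carrier X" "s \<in> F' \<Longrightarrow> \<phi> s z \<in> set_pair A B (if s \<in> C then 1 else 2)" for s by auto
      show ?thesis
      proof (intro bexI[of _ z] conjI ballI z(1))
        show "\<phi> s z \<in> A" if "s \<in> C" for s using z(2)[of s] that C by (auto simp: set_pair_def)
        show "\<phi> s z \<in> B" if "s \<in> F' - C" for s using z(2)[of s] that by (simp add: set_pair_def)
      qed
    qed
    then obtain z where z: "\<And>C. C \<subseteq> F' \<Longrightarrow> z C \<in> carrier X"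
      "\<And>C s. C \<subseteq> F' \<Longrightarrow> s \<in> C \<Longrightarrow> \<phi> s (z C) \<in> A" "\<And>C s. C \<subseteq> F' \<Longrightarrow> s \<in> F' - C \<Longrightarrow> \<phi> s (z C) \<in> B"
      by metis
    have ex_i: "\<exists>i\<in>I. \<phi> s (z C) \<in> U i" if "C \<subseteq> F'" "s \<in> C" for C s
    proof -
      have "s \<in> carrier G" using that F'(1) F(2) by blast
      then have "\<phi> s (z C) \<in> A \<inter> carrier X" using z(1)[OF that(1)] z(2)[OF that] by simp
      then show ?thesis using A by blast
    qed
    define \<tau> where "\<tau> C s = (SOME i. i \<in> I \<and> \<phi> s (z C) \<in> U i)" for C s
    have \<tau>: "\<tau> C s \<in> I" "\<phi> s (z C) \<in> U (\<tau> C s)" if "C \<subseteq> F'" "s \<in> C" for C s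
      using someI_ex[of "\<lambda>i. i \<in> I \<and> \<phi> s (z C) \<in> U i"] ex_i[OF that] unfolding \<tau>_def by blast+
    obtain i J where iJ: "i \<in> I" "J \<subseteq> F'" "c' * card F' \<le> card J"
      "\<And>B. B \<subseteq> J \<Longrightarrow> \<exists>C\<subseteq>F'. C \<inter> J = B \<and> (\<forall>s\<in>B. \<tau> C s = i)"
      using c'(2)[OF fin \<open>F' \<noteq> {}\<close>, of \<tau>] \<tau>(1) by auto
    have "indep 2 (set_pair (U i) B) (topspace T) J"
    proof (rule independence_setI[OF _ _ subset_refl])
      show "finite J" by (rule finite_subset[OF iJ(2) fin])
      show "J \<subseteq> carrier G" using iJ(2) F'(1) F(2) by simp
      fix \<sigma> assume \<sigma>: "\<sigma> \<in> J \<rightarrow> {1..2::nat}"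
      obtain C where C: "C \<subseteq> F'" "C \<inter> J = {s \<in> J. \<sigma> s = 1}" "\<And>s. s \<in> J \<Longrightarrow> \<sigma> s = 1 \<Longrightarrow> \<tau> C s = i"
        using iJ(4)[of "{s \<in> J. \<sigma> s = 1}"] by auto
      have "\<phi> s (z C) \<in> set_pair (U i) B (\<sigma> s)" if s: "s \<in> J" for s
      proof (cases "\<sigma> s = 1")
        case True
        then show ?thesis using C s \<tau>(2)[OF C(1), of s] by (auto simp: set_pair_def)
      next
        case False
        then have "s \<in> F' - C" using C s iJ(2) by blast
        then show ?thesis using False z(3)[OF C(1)] by (simp add: set_pair_def)
      qed
      then show "\<exists>z\<in>topspace T. \<forall>s\<in>J. \<phi> s z \<in> set_pair (U i) B (\<sigma> s)" using z(1)[OF C(1)] by auto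
    qed
    moreover have "(c' * c) * card F \<le> card J"
    proof -
      have "(c' * c) * card F \<le> c' * card F'"
        using c'(1) F'(3) by (simp add: mult.assoc)
      then show ?thesis using iJ(3) by linarith
    qed
    moreover have "J \<subseteq> F" using iJ(2) F'(1) by (rule subset_trans)
    ultimately show ?thesis using iJ(1) by (intro bexI[of _ i] exI[of _ J] conjI)
  qed
  \<comment> \<open>The label found by \<open>step\<close> depends on the finite set; as
    \<open>I\<close> is finite, one label occurs for infinitely many terms of the sequence.\<close>
  obtain Fn where Fn: "left_Folner_sequence G Fn" by (rule Folner_sequence_exists)
  then have "\<forall>n. \<exists>i\<in>I. \<exists>J\<subseteq>Fn n. indep 2 (set_pair (U i) B) (topspace T) J
      \<and> (c' * c) * card (Fn n) \<le> card J"
    by (intro allI step) (auto simp: left_Folner_sequence_def)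
  then have freq: "\<exists>\<^sub>F n in sequentially. \<exists>i\<in>I. \<exists>J\<subseteq>Fn n. indep 2 (set_pair (U i) B) (topspace T) J
      \<and> (c' * c) * card (Fn n) \<le> card J"
    by (intro eventually_frequently) auto
  obtain i where "i \<in> I" "\<exists>\<^sub>F n in sequentially. \<exists>J\<subseteq>Fn n. indep 2 (set_pair (U i) B) (topspace T) J
      \<and> (c' * c) * card (Fn n) \<le> card J"
    using frequently_bex_finite[OF I freq] by (elim bexE) (rule that)
  then show ?thesis using positive_densityI_Folner[OF Fn, of "c' * c"] c c'(1) by auto
qed

lemma positive_density_pair_mono:
  assumes "pos_density 2 (set_pair A B)" "A \<inter> carrier X \<subseteq> A'" "B \<inter> carrier X \<subseteq> B'"
  shows "pos_density 2 (set_pair A' B')"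
  by (rule positive_density_relabel[OF assms(1), of id]) (use assms in \<open>auto simp: set_pair_def\<close>)

lemma positive_density_pair_swap:
  assumes "pos_density 2 (set_pair A B)"
  shows "pos_density 2 (set_pair B A)"
  by (rule positive_density_relabel[OF assms(1), of "\<lambda>i. 3 - i"]) (auto simp: set_pair_def)

text \<open>If every x in \<open>K1\<close> had neighbourhoods \<open>U x\<close> of x and
  \<open>W x\<close> of \<open>K2\<close> without positive density, finitely many \<open>U x\<close>
  would cover \<open>K1\<close>. Their union, paired with the intersection of the corresponding
  \<open>W x\<close>, has positive density, and splitting the union contradicts the choice for one
  of these x.\<close>

lemma positive_density_point_left:
  assumes K: "compactin T K1"
    and pd: "\<And>O1 O2. openin T O1 \<Longrightarrow> openin T O2 \<Longrightarrow> K1 \<subseteq> O1 \<Longrightarrow> K2 \<subseteq> O2 \<Longrightarrow>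
      pos_density 2 (set_pair O1 O2)"
    and K2: "K2 \<subseteq> carrier X"
  obtains x where "x \<in> K1" "\<And>U O2. openin T U \<Longrightarrow> openin T O2 \<Longrightarrow> x \<in> U \<Longrightarrow> K2 \<subseteq> O2 \<Longrightarrow>
      pos_density 2 (set_pair U O2)"
proof (rule ccontr)
  assume "\<not> thesis"
  then have "\<not> (\<exists>x\<in>K1. \<forall>U O2. openin T U \<longrightarrow> openin T O2 \<longrightarrow> x \<in> U \<longrightarrow> K2 \<subseteq> O2 \<longrightarrow>
      pos_density 2 (set_pair U O2))"
    using that by meson
  then have "\<forall>x\<in>K1. \<exists>U W. openin T U \<and> openin T W \<and> x \<in> U \<and> K2 \<subseteq> W \<and>
      \<not> pos_density 2 (set_pair U W)"
    by simp
  then obtain U W where UW': "\<forall>x\<in>K1. openin T (U x) \<and> openin T (W x) \<and> x \<in> U x \<and> K2 \<subseteq> W x \<and>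
      \<not> pos_density 2 (set_pair (U x) (W x))"
    unfolding bchoice_iff by blast
  then have UW: "\<And>x. x \<in> K1 \<Longrightarrow> openin T (U x)" "\<And>x. x \<in> K1 \<Longrightarrow> openin T (W x)"
    "\<And>x. x \<in> K1 \<Longrightarrow> x \<in> U x" "\<And>x. x \<in> K1 \<Longrightarrow> K2 \<subseteq> W x"
    "\<And>x. x \<in> K1 \<Longrightarrow> \<not> pos_density 2 (set_pair (U x) (W x))"
    by blast+
  have "\<exists>\<F>. finite \<F> \<and> \<F> \<subseteq> U ` K1 \<and> K1 \<subseteq> \<Union>\<F>"
    by (rule compactinD[OF K]) (use UW in auto)
  then obtain I where I: "finite I" "I \<subseteq> K1" "K1 \<subseteq> (\<Union>x\<in>I. U x)"
    by (metis finite_subset_image)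
  define O2 where "O2 = topspace T \<inter> (\<Inter>x\<in>I. W x)"
  have "openin T O2" unfolding O2_def using I UW
    by (cases "I = {}") (auto intro!: openin_Inter openin_Int)
  then have "pos_density 2 (set_pair (\<Union>x\<in>I. U x) O2)"
  proof (intro pd)
    show "openin T (\<Union>x\<in>I. U x)" using UW(1) I(2) by (intro openin_Union) auto
    show "K2 \<subseteq> O2" unfolding O2_def topspace_T using UW(4) I(2) K2 by blast
  qed (use I in auto)
  then obtain x where x: "x \<in> I" "pos_density 2 (set_pair (U x) O2)"
    using positive_density_split[OF I(1)] by blast
  then have "pos_density 2 (set_pair (U x) (W x))"
    by (auto intro!: positive_density_pair_mono[OF x(2)] simp: O2_def)
  then show False using UW(5) x I by blast
qed

text \<open>The first set shrinks to a point x; then the roles are exchanged and the second set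
  shrinks against \<open>{x}\<close>.\<close>

lemma positive_density_point_pair:
  assumes "compactin T K1" "compactin T K2"
    and pd: "\<And>O1 O2. openin T O1 \<Longrightarrow> openin T O2 \<Longrightarrow> K1 \<subseteq> O1 \<Longrightarrow> K2 \<subseteq> O2 \<Longrightarrow>
      pos_density 2 (set_pair O1 O2)"
  obtains x y where "x \<in> K1" "y \<in> K2"
    "\<And>U V. openin T U \<Longrightarrow> openin T V \<Longrightarrow> x \<in> U \<Longrightarrow> y \<in> V \<Longrightarrow> pos_density 2 (set_pair U V)"
proof -
  have sub: "K1 \<subseteq> carrier X" "K2 \<subseteq> carrier X" using assms(1,2) compactin_subset_topspace by force+
  obtain x where x: "x \<in> K1" "\<And>U O2. openin T U \<Longrightarrow> openin T O2 \<Longrightarrow> x \<in> U \<Longrightarrow> K2 \<subseteq> O2 \<Longrightarrow>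
      pos_density 2 (set_pair U O2)"
    by (rule positive_density_point_left[OF assms(1) pd sub(2)]) (assumption+, rule that)
  have swap: "pos_density 2 (set_pair O2 U)"
    if "openin T O2" "openin T U" "K2 \<subseteq> O2" "{x} \<subseteq> U" for O2 U
    by (rule positive_density_pair_swap, rule x(2)) (use that in auto)
  have "{x} \<subseteq> carrier X" using sub x(1) by auto
  show ?thesis
  proof (rule positive_density_point_left[OF assms(2) swap \<open>{x} \<subseteq> carrier X\<close>])
    fix y assume y: "y \<in> K2" "\<And>V U. openin T V \<Longrightarrow> openin T U \<Longrightarrow> y \<in> V \<Longrightarrow> {x} \<subseteq> U \<Longrightarrow>
      pos_density 2 (set_pair V U)"
    show thesis
      by (rule that[OF x(1) y(1)], rule positive_density_pair_swap, rule y(2)) simp_all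
  qed simp_all
qed

end

section \<open>Haar measure\<close>

context algebraic_action
begin

lemma openin_preimage:
  assumes "continuous_map S T f" "openin T U"
  shows "openin S {x \<in> topspace S. f x \<in> U}"
  using assms by (simp add: continuous_map_def)

lemma Borel_space: "Borel_prob_measure T M \<Longrightarrow> space M = carrier X"
  by (simp add: Borel_prob_measure_def)

lemma Borel_sets_open: "Borel_prob_measure T M \<Longrightarrow> openin T U \<Longrightarrow> U \<in> sets M"
  by (auto simp: Borel_prob_measure_def)

lemma Borel_sets_closed:
  assumes "Borel_prob_measure T M" "closedin T C"
  shows "C \<in> sets M"
proof -
  have "carrier X - C \<in> sets M"
    using assms by (intro Borel_sets_open) (auto simp: closedin_def)
  then have "carrier X - (carrier X - C) \<in> sets M"
    using sets.compl_sets Borel_space[OF assms(1)] by metis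
  moreover have "carrier X - (carrier X - C) = C" using closedin_subset[OF assms(2)] by auto
  ultimately show ?thesis by simp
qed

lemma Borel_finite: "Borel_prob_measure T M \<Longrightarrow> finite_measure M"
  by (intro finite_measureI) (simp add: Borel_prob_measure_def)

lemma Borel_measure_space: "Borel_prob_measure T M \<Longrightarrow> measure M (carrier X) = 1"
  by (simp add: Borel_prob_measure_def measure_def)

lemma Borel_measurable:
  assumes "Borel_prob_measure T M" "f \<in> space N \<rightarrow> carrier X"
    "\<And>U. openin T U \<Longrightarrow> f -` U \<inter> space N \<in> sets N"
  shows "f \<in> measurable N M"
proof (rule measurable_sigma_sets[of M "carrier X" "{U. openin T U}"])
  show "sets M = sigma_sets (carrier X) {U. openin T U}"
    using assms(1) by (simp add: Borel_prob_measure_def)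
  show "{U. openin T U} \<subseteq> Pow (carrier X)" using openin_subset by force
qed (use assms in auto)

lemma continuous_Borel_measurable:
  assumes "Borel_prob_measure T M" "continuous_map T T f"
  shows "f \<in> measurable M M"
proof (rule Borel_measurable[OF assms(1)])
  show "f \<in> space M \<rightarrow> carrier X"
    using assms by (auto simp: Borel_space continuous_map_def)
  fix U assume "openin T U"
  moreover have "f -` U \<inter> space M = {x \<in> topspace T. f x \<in> U}"
    using assms by (auto simp: Borel_space)
  ultimately show "f -` U \<inter> space M \<in> sets M"
    using assms openin_preimage[of T f U] by (intro Borel_sets_open) auto
qed

text \<open>A closed subset of the compact space \<open>X \<times> X\<close> is an intersection of finite unions of open
  boxes, hence belongs to the product \<open>\<sigma>\<close>-algebra.\<close>

lemma left_division_measurable: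
  assumes M: "Borel_prob_measure T M" and N: "Borel_prob_measure T N" and R: "Borel_prob_measure T R"
  shows "(\<lambda>(x, y). inv\<^bsub>X\<^esub> x \<cdot> y) \<in> measurable (M \<Otimes>\<^sub>M N) R"
proof (rule Borel_measurable[OF R])
  let ?f = "\<lambda>(x, y). inv\<^bsub>X\<^esub> x \<cdot> y"
  have sp: "space (M \<Otimes>\<^sub>M N) = carrier X \<times> carrier X"
    using M N by (simp add: space_pair_measure Borel_space)
  then show "?f \<in> space (M \<Otimes>\<^sub>M N) \<rightarrow> carrier X" by auto
  fix U assume U: "openin T U"
  define C where "C = carrier X - U"
  have "closedin T C" using U by (auto simp: C_def closedin_def Diff_Diff_Int openin_subset Int_absorb1)
  \<comment> \<open>The decreasing open sets \<open>W n\<close> leave room between the compact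
    preimage of \<open>C\<close> and the open preimage of \<open>W n\<close>, and a finite union of
    open boxes fits in between.\<close>
  then have "gdelta_in T C" by (rule closed_imp_gdelta_in[OF metrizable_T])
  then obtain W where "(\<forall>n. openin T (W n)) \<and> (\<forall>n. W (Suc n) \<subseteq> W n) \<and> \<Inter>(range W) = C"
    unfolding gdelta_in_descending by (elim exE) (rule that)
  then have W: "\<And>n. openin T (W n)" "\<Inter>(range W) = C" by simp_all
  let ?P = "prod_topology T T"
  define K where "K = {p \<in> topspace ?P. ?f p \<in> C}"
  have cont: "continuous_map ?P T ?f"
    unfolding case_prod_beta'
    by (intro continuous_mult continuous_inv continuous_map_fst continuous_map_snd)
  have "closedin ?P K" unfolding K_def
    by (rule closedin_continuous_map_preimage[OF cont \<open>closedin T C\<close>])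
  then have K: "compactin ?P K"
    using compact_T by (intro closedin_compact_space) (simp_all add: compact_space_prod_topology)
  have "\<exists>B. B \<in> sets (M \<Otimes>\<^sub>M N) \<and> K \<subseteq> B \<and> B \<subseteq> {p \<in> topspace ?P. ?f p \<in> W n}" for n
  proof -
    let ?W = "{p \<in> topspace ?P. ?f p \<in> W n}"
    let ?\<B> = "{b. b \<subseteq> ?W \<and> (\<exists>U V. openin T U \<and> openin T V \<and> b = U \<times> V)}"
    have oW: "openin ?P ?W" by (rule openin_preimage[OF cont W(1)])
    have "K \<subseteq> ?W" using W(2) by (auto simp: K_def)
    have "\<exists>b\<in>?\<B>. p \<in> b" if "p \<in> K" for p
    proof -
      have "(fst p, snd p) \<in> ?W" using that \<open>K \<subseteq> ?W\<close> by auto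
      then obtain U V where "openin T U" "openin T V" "fst p \<in> U" "snd p \<in> V" "U \<times> V \<subseteq> ?W"
        using oW[unfolded openin_prod_topology_alt] by meson
      then show ?thesis by (intro bexI[of _ "U \<times> V"]) (auto simp: mem_Times_iff)
    qed
    then have cov: "K \<subseteq> \<Union>?\<B>" by blast
    have opn: "openin ?P b" if "b \<in> ?\<B>" for b
      using that by (auto simp: openin_prod_Times_iff)
    obtain \<F> where \<F>: "finite \<F>" "\<F> \<subseteq> ?\<B>" "K \<subseteq> \<Union>\<F>"
      using compactinD[OF K opn cov] by auto
    have "b \<in> sets (M \<Otimes>\<^sub>M N)" if "b \<in> \<F>" for b
    proof -
      have "b \<in> ?\<B>" using that \<F>(2) by (rule subsetD[rotated])
      then obtain U V where "openin T U \<and> openin T V \<and> b = U \<times> V"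
        by (elim CollectE conjE exE) (rule that, simp)
      then have UV: "openin T U" "openin T V" "b = U \<times> V" by simp_all
      show ?thesis unfolding UV(3)
        by (intro pair_measureI Borel_sets_open[OF M] Borel_sets_open[OF N] UV)
    qed
    then have "\<Union>\<F> \<in> sets (M \<Otimes>\<^sub>M N)" using \<F>(1) by (intro sets.finite_Union) auto
    moreover have "\<Union>\<F> \<subseteq> ?W"
    proof (rule Union_least)
      show "b \<subseteq> ?W" if "b \<in> \<F>" for b using subsetD[OF \<F>(2) that] by simp
    qed
    ultimately show ?thesis using \<F>(3) by (intro exI[of _ "\<Union>\<F>"] conjI)
  qed
  then have "\<forall>n. \<exists>B. B \<in> sets (M \<Otimes>\<^sub>M N) \<and> K \<subseteq> B \<and> B \<subseteq> {p \<in> topspace ?P. ?f p \<in> W n}" by (rule allI)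
  then obtain B where "\<forall>n. B n \<in> sets (M \<Otimes>\<^sub>M N) \<and> K \<subseteq> B n \<and> B n \<subseteq> {p \<in> topspace ?P. ?f p \<in> W n}"
    unfolding choice_iff by (elim exE) (rule that)
  then have B: "B n \<in> sets (M \<Otimes>\<^sub>M N)" "K \<subseteq> B n" "B n \<subseteq> {p \<in> topspace ?P. ?f p \<in> W n}" for n
    by simp_all
  have "\<Inter>(range B) = K"
  proof
    show "K \<subseteq> \<Inter>(range B)" using B(2) by auto
    show "\<Inter>(range B) \<subseteq> K"
    proof
      fix p assume "p \<in> \<Inter>(range B)"
      then have "p \<in> {p \<in> topspace ?P. ?f p \<in> W n}" for n
        using B(3)[of n] by (intro subsetD[OF B(3)[of n]]) simp
      then have "p \<in> topspace ?P" "?f p \<in> \<Inter>(range W)" by simp_all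
      then show "p \<in> K" unfolding K_def W(2) by (intro CollectI conjI)
    qed
  qed
  then have "K \<in> sets (M \<Otimes>\<^sub>M N)" using sets.countable_INT'[of UNIV B] B(1) by auto
  then have "space (M \<Otimes>\<^sub>M N) - K \<in> sets (M \<Otimes>\<^sub>M N)" by (rule sets.compl_sets)
  moreover have "?f -` U \<inter> space (M \<Otimes>\<^sub>M N) = space (M \<Otimes>\<^sub>M N) - K"
    unfolding sp K_def C_def by auto
  ultimately show "?f -` U \<inter> space (M \<Otimes>\<^sub>M N) \<in> sets (M \<Otimes>\<^sub>M N)" by simp
qed

lemma l_coset_eq:
  assumes "x \<in> carrier X" "A \<subseteq> carrier X"
  shows "x <#\<^bsub>X\<^esub> A = {y \<in> carrier X. inv\<^bsub>X\<^esub> x \<cdot> y \<in> A}"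
proof (intro equalityI subsetI)
  fix y assume "y \<in> x <#\<^bsub>X\<^esub> A"
  then obtain a where "a \<in> A" "y = x \<cdot> a" by (auto simp: l_coset_def)
  moreover from this have "a \<in> carrier X" using assms by auto
  ultimately show "y \<in> {y \<in> carrier X. inv\<^bsub>X\<^esub> x \<cdot> y \<in> A}"
    using assms by (simp flip: X.m_assoc)
next
  fix y assume y: "y \<in> {y \<in> carrier X. inv\<^bsub>X\<^esub> x \<cdot> y \<in> A}"
  then have "y = x \<cdot> (inv\<^bsub>X\<^esub> x \<cdot> y)" using assms by (simp flip: X.m_assoc)
  then show "y \<in> x <#\<^bsub>X\<^esub> A" using y by (auto simp: l_coset_def)
qed

lemma Haar_Borel: "normalized_Haar_measure X T M \<Longrightarrow> Borel_prob_measure T M"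
  by (simp add: normalized_Haar_measure_def)

lemma Borel_sets_subset: "Borel_prob_measure T M \<Longrightarrow> A \<in> sets M \<Longrightarrow> A \<subseteq> carrier X"
  using sets.sets_into_space Borel_space by metis

text \<open>Evaluate \<open>M \<Otimes> N\<close> on \<open>{(x, y). x\<inverse> y \<in> A}\<close> in both orders.\<close>

lemma Haar_measure_inverse:
  assumes M: "normalized_Haar_measure X T M" and N: "normalized_Haar_measure X T N" and A: "A \<in> sets N"
  shows "emeasure N A = emeasure M {x \<in> carrier X. inv\<^bsub>X\<^esub> x \<in> A}"
proof -
  note bM = Haar_Borel[OF M] and bN = Haar_Borel[OF N]
  interpret M: finite_measure M by (rule Borel_finite[OF bM])
  interpret N: finite_measure N by (rule Borel_finite[OF bN])
  interpret pair_sigma_finite M N ..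
  have AX: "A \<subseteq> carrier X" using bN A by (rule Borel_sets_subset)
  let ?f = "\<lambda>(x, y). inv\<^bsub>X\<^esub> x \<cdot> y"
  define S where "S = ?f -` A \<inter> space (M \<Otimes>\<^sub>M N)"
  have S: "S \<in> sets (M \<Otimes>\<^sub>M N)" unfolding S_def
    by (rule measurable_sets[OF left_division_measurable[OF bM bN bN] A])
  have S_eq: "S = {(x, y). x \<in> carrier X \<and> y \<in> carrier X \<and> inv\<^bsub>X\<^esub> x \<cdot> y \<in> A}"
    using bM bN by (auto simp: S_def space_pair_measure Borel_space)
  let ?B = "{x \<in> carrier X. inv\<^bsub>X\<^esub> x \<in> A}"
  have "continuous_map T T (\<lambda>x. inv\<^bsub>X\<^esub> x)" by (intro continuous_inv) simp
  then have "(\<lambda>x. inv\<^bsub>X\<^esub> x) -` A \<inter> space M \<in> sets M"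
    using A bM bN
    by (intro measurable_sets[OF continuous_Borel_measurable]) (auto simp: Borel_prob_measure_def)
  moreover have "(\<lambda>x. inv\<^bsub>X\<^esub> x) -` A \<inter> space M = ?B" using bM by (auto simp: Borel_space)
  ultimately have B: "?B \<in> sets M" by simp
  have "emeasure (M \<Otimes>\<^sub>M N) S = (\<integral>\<^sup>+x. emeasure N (Pair x -` S) \<partial>M)"
    by (rule N.emeasure_pair_measure_alt[OF S])
  also have "\<dots> = (\<integral>\<^sup>+x. emeasure N A \<partial>M)"
  proof (rule nn_integral_cong)
    fix x assume "x \<in> space M"
    then have x: "x \<in> carrier X" using bM by (simp add: Borel_space)
    then have "Pair x -` S = x <#\<^bsub>X\<^esub> A" using AX by (auto simp: S_eq l_coset_eq)
    then show "emeasure N (Pair x -` S) = emeasure N A"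
      using N x A by (simp add: normalized_Haar_measure_def)
  qed
  also have "\<dots> = emeasure N A" using bM by (simp add: Borel_prob_measure_def)
  finally have 1: "emeasure (M \<Otimes>\<^sub>M N) S = emeasure N A" .
  have "emeasure (M \<Otimes>\<^sub>M N) S = (\<integral>\<^sup>+y. emeasure M ((\<lambda>x. (x, y)) -` S) \<partial>N)"
    by (rule emeasure_pair_measure_alt2[OF S])
  also have "\<dots> = (\<integral>\<^sup>+y. emeasure M ?B \<partial>N)"
  proof (rule nn_integral_cong)
    fix y assume "y \<in> space N"
    then have y: "y \<in> carrier X" using bN by (simp add: Borel_space)
    \<comment> \<open>Writing x = y \<cdot> b, the condition on x becomes that the inverse of b lies
      in \<open>A\<close>; hence this section is also a left translate.\<close>
    then have "(\<lambda>x. (x, y)) -` S = y <#\<^bsub>X\<^esub> ?B"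
      by (auto simp: S_eq l_coset_eq X.inv_mult_group)
    then show "emeasure M ((\<lambda>x. (x, y)) -` S) = emeasure M ?B"
      using M y B by (simp add: normalized_Haar_measure_def)
  qed
  also have "\<dots> = emeasure M ?B" using bN by (simp add: Borel_prob_measure_def)
  finally show ?thesis using 1 by simp
qed

text \<open>Both \<open>M A\<close> and \<open>N A\<close> equal the \<open>M\<close>-measure of the
  set of inverses of \<open>A\<close>, by the preceding lemma for the pairs \<open>M\<close>,
  \<open>M\<close> and \<open>M\<close>, \<open>N\<close>.\<close>

lemma Haar_measure_unique:
  assumes "normalized_Haar_measure X T M" "normalized_Haar_measure X T N" "A \<in> sets N"
  shows "emeasure M A = emeasure N A"
proof -
  have "A \<in> sets M" using assms by (auto simp: normalized_Haar_measure_def Borel_prob_measure_def)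
  then show ?thesis using assms Haar_measure_inverse[of M N A] Haar_measure_inverse[of M M A] by simp
qed

text \<open>The image of \<open>M\<close> under \<open>\<phi> s\<close> is again invariant under
  left translations, so uniqueness identifies it with \<open>M\<close>.\<close>

lemma Haar_measure_automorphism_invariant:
  assumes M: "normalized_Haar_measure X T M" and s: "s \<in> carrier G" and A: "A \<in> sets M"
  shows "emeasure M {x \<in> carrier X. \<phi> s x \<in> A} = emeasure M A"
proof -
  note bM = Haar_Borel[OF M]
  have meas: "\<phi> s \<in> measurable M M" by (rule continuous_Borel_measurable[OF bM continuous_\<phi>[OF s]])
  have distr: "emeasure (distr M M (\<phi> s)) B = emeasure M {x \<in> carrier X. \<phi> s x \<in> B}"
    if "B \<in> sets M" for B
  proof -
    have "\<phi> s -` B \<inter> space M = {x \<in> carrier X. \<phi> s x \<in> B}" using bM by (auto simp: Borel_space)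
    then show ?thesis using meas that by (simp add: emeasure_distr)
  qed
  have preimage: "{x \<in> carrier X. \<phi> s x \<in> B} \<in> sets M" if "B \<in> sets M" for B
  proof -
    have "\<phi> s -` B \<inter> space M = {x \<in> carrier X. \<phi> s x \<in> B}" using bM by (auto simp: Borel_space)
    then show ?thesis using measurable_sets[OF meas that] by simp
  qed
  have "normalized_Haar_measure X T (distr M M (\<phi> s))"
    unfolding normalized_Haar_measure_def
  proof (intro conjI ballI)
    have "carrier X \<in> sets M" using Borel_sets_open[OF bM openin_carrier] .
    moreover have "{x \<in> carrier X. \<phi> s x \<in> carrier X} = carrier X" using s by auto
    ultimately have "emeasure (distr M M (\<phi> s)) (carrier X) = 1"
      using bM by (simp add: distr Borel_prob_measure_def)
    then show "Borel_prob_measure T (distr M M (\<phi> s))"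
      using bM by (simp add: Borel_prob_measure_def)
    fix x B assume x: "x \<in> carrier X" and "B \<in> sets (distr M M (\<phi> s))"
    then have B: "B \<in> sets M" by simp
    then have BX: "B \<subseteq> carrier X" using bM Borel_sets_subset by blast
    \<comment> \<open>\<open>\<phi> s\<close> sends \<open>?x\<close> to \<open>x\<close>, so the
      preimage of the translate of \<open>B\<close> by \<open>x\<close> is the translate by
      \<open>?x\<close> of the preimage of \<open>B\<close>.\<close>
    let ?x = "\<phi> (inv\<^bsub>G\<^esub> s) x"
    have "continuous_map T T (\<lambda>y. inv\<^bsub>X\<^esub> x \<cdot> y)"
      using x by (intro continuous_mult) auto
    then have "(\<lambda>y. inv\<^bsub>X\<^esub> x \<cdot> y) -` B \<inter> space M \<in> sets M"
      by (intro measurable_sets[OF continuous_Borel_measurable[OF bM]] B)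
    moreover have "(\<lambda>y. inv\<^bsub>X\<^esub> x \<cdot> y) -` B \<inter> space M = x <#\<^bsub>X\<^esub> B"
      using x BX bM by (auto simp: l_coset_eq Borel_space)
    ultimately have xB: "x <#\<^bsub>X\<^esub> B \<in> sets M" by simp
    have "{y \<in> carrier X. \<phi> s y \<in> x <#\<^bsub>X\<^esub> B} = ?x <#\<^bsub>X\<^esub> {y \<in> carrier X. \<phi> s y \<in> B}"
    proof -
      have "\<phi> s (inv\<^bsub>X\<^esub> ?x \<cdot> y) = inv\<^bsub>X\<^esub> x \<cdot> \<phi> s y" if "y \<in> carrier X" for y
        using that x s by (simp add: \<phi>_mult \<phi>_inv)
      then show ?thesis using x s BX by (auto simp: l_coset_eq)
    qed
    then show "emeasure (distr M M (\<phi> s)) (x <#\<^bsub>X\<^esub> B) = emeasure (distr M M (\<phi> s)) B"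
      using M x s preimage[OF B] by (simp add: distr xB B normalized_Haar_measure_def)
  qed
  then have "emeasure (distr M M (\<phi> s)) A = emeasure M A" by (rule Haar_measure_unique[OF _ M A])
  then show ?thesis using distr[OF A] by simp
qed

text \<open>The probabilistic input of all later averaging: for Haar random y, the event that z
  \<cdot> y is in \<open>A\<close> at time s has probability \<mu>(A), whatever z and s are.\<close>

lemma Haar_measure_translate:
  assumes M: "normalized_Haar_measure X T M" and s: "s \<in> carrier G" and z: "z \<in> carrier X"
      and A: "A \<in> sets M"
  shows "{y \<in> carrier X. \<phi> s (z \<cdot> y) \<in> A} \<in> sets M"
    and "measure M {y \<in> carrier X. \<phi> s (z \<cdot> y) \<in> A} = measure M A"
proof -
  note bM = Haar_Borel[OF M]
  have meas: "f -` B \<inter> space M = {x \<in> carrier X. f x \<in> B}" for f B using bM by (auto simp: Borel_space)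
  have B: "{x \<in> carrier X. \<phi> s x \<in> A} \<in> sets M"
    using measurable_sets[OF continuous_Borel_measurable[OF bM continuous_\<phi>[OF s]] A] by (simp add: meas)
  have "{y \<in> carrier X. z \<cdot> y \<in> {x \<in> carrier X. \<phi> s x \<in> A}} \<in> sets M"
  proof -
    have "continuous_map T T (\<lambda>y. z \<cdot> y)" using z by (intro continuous_mult) auto
    then show ?thesis
      using measurable_sets[OF continuous_Borel_measurable[OF bM] B] unfolding meas by blast
  qed
  moreover have eq: "{y \<in> carrier X. z \<cdot> y \<in> {x \<in> carrier X. \<phi> s x \<in> A}} =
      {y \<in> carrier X. \<phi> s (z \<cdot> y) \<in> A}" using z by auto
  ultimately show "{y \<in> carrier X. \<phi> s (z \<cdot> y) \<in> A} \<in> sets M" by simp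
  have "{y \<in> carrier X. \<phi> s (z \<cdot> y) \<in> A} = inv\<^bsub>X\<^esub> z <#\<^bsub>X\<^esub> {x \<in> carrier X. \<phi> s x \<in> A}"
    unfolding eq[symmetric] using z by (subst l_coset_eq) auto
  then have "emeasure M {y \<in> carrier X. \<phi> s (z \<cdot> y) \<in> A} = emeasure M {x \<in> carrier X. \<phi> s x \<in> A}"
    using M z B by (simp add: normalized_Haar_measure_def)
  then show "measure M {y \<in> carrier X. \<phi> s (z \<cdot> y) \<in> A} = measure M A"
    using Haar_measure_automorphism_invariant[OF M s A] by (simp add: measure_def)
qed

lemma Haar_measure_open_pos:
  assumes M: "normalized_Haar_measure X T M" and U: "openin T U" "U \<noteq> {}"
  shows "0 < measure M U"
proof -
  note bM = Haar_Borel[OF M]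
  interpret finite_measure M by (rule Borel_finite[OF bM])
  have UX: "U \<subseteq> carrier X" using openin_subset[OF U(1)] by simp
  obtain u where u: "u \<in> U" using U(2) by blast
  have opn: "openin T (x <#\<^bsub>X\<^esub> U)" if "x \<in> carrier X" for x
    using openin_preimage[OF continuous_mult[of T "\<lambda>_. inv\<^bsub>X\<^esub> x" "\<lambda>y. y"] U(1)] that UX
    by (simp add: l_coset_eq)
  have "carrier X \<subseteq> \<Union>((\<lambda>x. x <#\<^bsub>X\<^esub> U) ` carrier X)"
  proof
    fix y assume y: "y \<in> carrier X"
    have uX: "u \<in> carrier X" using u UX by auto
    then have "y = (y \<cdot> inv\<^bsub>X\<^esub> u) \<cdot> u" using y by (simp add: X.m_assoc)
    then have "y \<in> (y \<cdot> inv\<^bsub>X\<^esub> u) <#\<^bsub>X\<^esub> U" using u by (auto simp: l_coset_def)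
    then show "y \<in> \<Union>((\<lambda>x. x <#\<^bsub>X\<^esub> U) ` carrier X)"
      by (rule UN_I[rotated]) (use y uX in simp)
  qed
  then have cov: "topspace T \<subseteq> \<Union>((\<lambda>x. x <#\<^bsub>X\<^esub> U) ` carrier X)" by simp
  obtain \<F> where \<F>: "finite \<F>" "\<F> \<subseteq> (\<lambda>x. x <#\<^bsub>X\<^esub> U) ` carrier X" "topspace T \<subseteq> \<Union>\<F>"
    using compactinD[OF compact_T[unfolded compact_space_def] _ cov] opn by auto
  from \<F>(1,2) obtain I where I: "finite I" "I \<subseteq> carrier X" "\<F> = (\<lambda>x. x <#\<^bsub>X\<^esub> U) ` I"
    using finite_subset_image[of \<F> "\<lambda>x. x <#\<^bsub>X\<^esub> U" "carrier X"] by auto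
  with \<F>(3) have cover: "carrier X \<subseteq> (\<Union>x\<in>I. x <#\<^bsub>X\<^esub> U)" by simp
  have UM: "U \<in> sets M" by (rule Borel_sets_open[OF bM U(1)])
  have "1 = measure M (carrier X)" using bM by (simp add: Borel_measure_space)
  also have "\<dots> \<le> measure M (\<Union>x\<in>I. x <#\<^bsub>X\<^esub> U)"
    using I cover opn by (intro finite_measure_mono Borel_sets_open[OF bM]) auto
  also have "\<dots> \<le> (\<Sum>x\<in>I. measure M (x <#\<^bsub>X\<^esub> U))"
    using I opn by (intro finite_measure_subadditive_finite) (auto intro!: Borel_sets_open[OF bM])
  also have "\<dots> = (\<Sum>x\<in>I. measure M U)"
    using M I UM by (intro sum.cong) (auto simp: normalized_Haar_measure_def measure_def)
  finally have "1 \<le> card I * measure M U" by simp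
  then have "measure M U \<noteq> 0" by auto
  then show ?thesis using measure_nonneg[of M U] by linarith
qed

end

text \<open>The first moment method with real weights: weighting two kinds of events lets a single
  point satisfy two requirements, and negative weights bound a count from above.\<close>

lemma exists_point_ge_average:
  fixes c :: "'i \<Rightarrow> real"
  assumes "finite_measure M" "measure M (space M) = 1" "finite I" "\<And>i. i \<in> I \<Longrightarrow> A i \<in> sets M"
  obtains x where "x \<in> space M" "(\<Sum>i\<in>I. c i * measure M (A i)) \<le> (\<Sum>i\<in>I. c i * indicator (A i) x)"
proof (rule ccontr)
  interpret finite_measure M by fact
  let ?f = "\<lambda>x. \<Sum>i\<in>I. c i * indicator (A i) x"
  let ?a = "\<Sum>i\<in>I. c i * measure M (A i)"
  assume "\<not> thesis"
  with that have less: "?f x < ?a" if "x \<in> space M" for x using that by force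
  have int: "integrable M ?f" using assms(4)
    by (intro Bochner_Integration.integrable_sum integrable_mult_right) (auto simp: emeasure_eq_measure)
  have "emeasure M (space M) \<noteq> 0" using assms(2) by (simp add: emeasure_eq_measure)
  then have "integral\<^sup>L M ?f < integral\<^sup>L M (\<lambda>_. ?a)"
    using less by (intro integral_less_AE_space int) auto
  also have "\<dots> = ?a" using assms(2) by simp
  also have "integral\<^sup>L M ?f = ?a"
    using assms(4) by (subst Bochner_Integration.integral_sum)
      (auto intro!: integrable_mult_right sum.cong simp: emeasure_eq_measure Int_absorb2
          sets.sets_into_space)
  finally show False by simp
qed

section \<open>The group structure of IE-tuples\<close>

context algebraic_action
begin

lemma openin_INT_finite:
  assumes "finite I" "\<And>i. i \<in> I \<Longrightarrow> openin T (U i)"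
  shows "openin T (topspace T \<inter> (\<Inter>i\<in>I. U i))"
  using assms
proof (induction I rule: finite_induct)
  case (insert a I)
  have eq: "topspace T \<inter> (\<Inter>i\<in>insert a I. U i) = U a \<inter> (topspace T \<inter> (\<Inter>i\<in>I. U i))" by auto
  show ?case unfolding eq by (rule openin_Int) (use insert in auto)
qed simp

lemma IE_tuplesI:
  assumes "x \<in> (\<Pi>\<^sub>E i\<in>{1..k}. carrier X)"
    and "\<And>U. (\<And>i. i \<in> {1..k} \<Longrightarrow> openin T (U i)) \<Longrightarrow> (\<And>i. i \<in> {1..k} \<Longrightarrow> x i \<in> U i) \<Longrightarrow>
      pos_density k U"
  shows "x \<in> IE k"
  using assms by (simp add: IE_tuples_iff)

lemma IE_tuples_density:
  assumes "x \<in> IE k" "\<And>i. i \<in> {1..k} \<Longrightarrow> openin T (U i)" "\<And>i. i \<in> {1..k} \<Longrightarrow> x i \<in> U i"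
  shows "pos_density k U"
  using assms by (simp add: IE_tuples_iff)

lemma IE_tuples_carrier:
  "x \<in> IE k \<Longrightarrow> i \<in> {1..k} \<Longrightarrow> x i \<in> carrier X"
  by (auto simp: IE_tuples_iff)

lemma IE_tuples_PiE: "x \<in> IE k \<Longrightarrow> x \<in> (\<Pi>\<^sub>E i\<in>{1..k}. carrier X)"
  by (simp add: IE_tuples_iff)

text \<open>The second density is applied inside the independence set \<open>F1\<close> of the first
  tuple. Such a set carries no invariance, which is why density must be available in arbitrary
  finite sets.\<close>

lemma positive_density_mult:
  assumes V: "pos_density k V" and W: "pos_density k W"
    and VW: "\<And>i v w. i \<in> {1..k} \<Longrightarrow> v \<in> V i \<inter> carrier X \<Longrightarrow> w \<in> W i \<inter> carrier X \<Longrightarrow> v \<cdot> w \<in> U i"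
  shows "pos_density k U"
proof -
  obtain c :: real where c: "c > 0" "\<And>F. finite F \<Longrightarrow> F \<subseteq> carrier G \<Longrightarrow>
     \<exists>F'\<subseteq>F. indep k V (topspace T) F' \<and> c * real (card F) \<le> real (card F')"
    by (rule positive_densityE[OF V]) (rule that)
  obtain d :: real where d: "d > 0" "\<And>F. finite F \<Longrightarrow> F \<subseteq> carrier G \<Longrightarrow>
     \<exists>F'\<subseteq>F. indep k W (topspace T) F' \<and> d * real (card F) \<le> real (card F')"
    by (rule positive_densityE[OF W]) (rule that)
  show ?thesis
    unfolding positive_density_def
  proof (intro exI[of _ "d * c"] conjI allI impI)
    show "d * c > 0" using c d by simp
    fix F assume "finite F \<and> F \<subseteq> carrier G"
    then have F: "finite F" "F \<subseteq> carrier G" by simp_all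
    obtain F1 where F1: "F1 \<subseteq> F" "indep k V (topspace T) F1" "c * card F \<le> card F1"
      using c(2)[OF F] by (elim exE conjE) (rule that)
    have fin1: "finite F1" "F1 \<subseteq> carrier G" using F1(2) by (simp_all add: independence_set_def)
    obtain F2 where F2: "F2 \<subseteq> F1" "indep k W (topspace T) F2" "d * card F1 \<le> card F2"
      using d(2)[OF fin1] by (elim exE conjE) (rule that)
    have fin2: "finite F2" "F2 \<subseteq> carrier G" using F2(2) by (simp_all add: independence_set_def)
    have V2: "indep k V (topspace T) F2"
      by (rule independence_set_subset[OF F1(2) F2(1)]) (use X.one_closed in auto)
    have "indep k U (topspace T) F2"
    proof (rule independence_setI[OF fin2 subset_refl])
      fix \<sigma> assume \<sigma>: "\<sigma> \<in> F2 \<rightarrow> {1..k}"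
      obtain v where v: "v \<in> topspace T" "\<And>s. s \<in> F2 \<Longrightarrow> \<phi> s v \<in> V (\<sigma> s)"
        by (rule independence_setE[OF V2 \<sigma>]) (rule that)
      obtain w where w: "w \<in> topspace T" "\<And>s. s \<in> F2 \<Longrightarrow> \<phi> s w \<in> W (\<sigma> s)"
        by (rule independence_setE[OF F2(2) \<sigma>]) (rule that)
      have "\<phi> s (v \<cdot> w) \<in> U (\<sigma> s)" if s: "s \<in> F2" for s
      proof -
        have "s \<in> carrier G" using s fin2(2) by (rule subsetD[rotated])
        then show ?thesis
          using VW[OF funcset_mem[OF \<sigma> s], of "\<phi> s v" "\<phi> s w"] v(1) v(2)[OF s] w(1) w(2)[OF s]
          by (simp add: \<phi>_mult)
      qed
      then show "\<exists>z\<in>topspace T. \<forall>s\<in>F2. \<phi> s z \<in> U (\<sigma> s)"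
        using v(1) w(1) by (intro bexI[of _ "v \<cdot> w"] ballI) simp_all
    qed
    moreover have "(d * c) * card F \<le> card F2"
    proof -
      have "(d * c) * card F \<le> d * card F1" using d(1) F1(3) by (simp add: mult.assoc)
      then show ?thesis using F2(3) by linarith
    qed
    moreover have "F2 \<subseteq> F" using F2(1) F1(1) by (rule subset_trans)
    ultimately show "\<exists>F'\<subseteq>F. indep k U (topspace T) F' \<and> (d * c) * card F \<le> card F'"
      by (intro exI[of _ F2] conjI)
  qed
qed

lemma positive_density_map:
  assumes V: "pos_density k V"
    and f: "\<And>x. x \<in> carrier X \<Longrightarrow> f x \<in> carrier X"
    and VU: "\<And>i s x. i \<in> {1..k} \<Longrightarrow> s \<in> carrier G \<Longrightarrow> x \<in> carrier X \<Longrightarrow> \<phi> s x \<in> V i \<Longrightarrow> \<phi> s (f x) \<in> U i"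
  shows "pos_density k U"
proof -
  have "indep k U (topspace T) F" if F: "indep k V (topspace T) F" for F
  proof -
    have fin: "finite F" "F \<subseteq> carrier G" using F by (simp_all add: independence_set_def)
    show ?thesis
    proof (rule independence_setI[OF fin subset_refl])
      fix \<sigma> assume \<sigma>: "\<sigma> \<in> F \<rightarrow> {1..k}"
      obtain v where v: "v \<in> topspace T" "\<And>s. s \<in> F \<Longrightarrow> \<phi> s v \<in> V (\<sigma> s)"
        by (rule independence_setE[OF F \<sigma>]) (rule that)
      have "\<phi> s (f v) \<in> U (\<sigma> s)" if s: "s \<in> F" for s
        using VU[OF funcset_mem[OF \<sigma> s] subsetD[OF fin(2) s] _ v(2)[OF s]] v(1) by simp
      then show "\<exists>z\<in>topspace T. \<forall>s\<in>F. \<phi> s z \<in> U (\<sigma> s)"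
        using v(1) f by (intro bexI[of _ "f v"] ballI) simp_all
    qed
  qed
  then show ?thesis using V unfolding positive_density_def by meson
qed

lemma open_mult_neighbourhoods:
  assumes U: "openin T U" and ab: "a \<in> carrier X" "b \<in> carrier X" "a \<cdot> b \<in> U"
  obtains V W where "openin T V" "openin T W" "a \<in> V" "b \<in> W"
    "\<And>v w. v \<in> V \<Longrightarrow> w \<in> W \<Longrightarrow> v \<cdot> w \<in> U"
proof -
  let ?P = "prod_topology T T"
  let ?W = "{p \<in> topspace ?P. fst p \<cdot> snd p \<in> U}"
  have "openin ?P ?W"
    by (intro openin_preimage[OF _ U] continuous_mult continuous_map_fst continuous_map_snd)
  moreover have "(a, b) \<in> ?W" using ab by simp
  ultimately obtain V W where VW: "openin T V" "openin T W" "a \<in> V" "b \<in> W" "V \<times> W \<subseteq> ?W"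
    unfolding openin_prod_topology_alt by meson
  have "v \<cdot> w \<in> U" if "v \<in> V" "w \<in> W" for v w
    using subsetD[OF VW(5), of "(v, w)"] that by simp
  with VW(1-4) show ?thesis by (rule that)
qed

lemma IE_tuples_mult:
  assumes x: "x \<in> IE k" and y: "y \<in> IE k"
  shows "(\<lambda>i\<in>{1..k}. x i \<cdot> y i) \<in> IE k"
proof (rule IE_tuplesI)
  note xc = IE_tuples_carrier[OF x] and yc = IE_tuples_carrier[OF y]
  show "(\<lambda>i\<in>{1..k}. x i \<cdot> y i) \<in> (\<Pi>\<^sub>E i\<in>{1..k}. carrier X)" using xc yc by simp
  fix U assume U: "\<And>i. i \<in> {1..k} \<Longrightarrow> openin T (U i)"
    and "\<And>i. i \<in> {1..k} \<Longrightarrow> (\<lambda>i\<in>{1..k}. x i \<cdot> y i) i \<in> U i"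
  then have xy: "\<And>i. i \<in> {1..k} \<Longrightarrow> x i \<cdot> y i \<in> U i" by simp
  have "\<exists>VW. openin T (fst VW) \<and> openin T (snd VW) \<and> x i \<in> fst VW \<and> y i \<in> snd VW \<and>
      (\<forall>v\<in>fst VW. \<forall>w\<in>snd VW. v \<cdot> w \<in> U i)" if i: "i \<in> {1..k}" for i
  proof -
    obtain V W where "openin T V" "openin T W" "x i \<in> V" "y i \<in> W"
      "\<And>v w. v \<in> V \<Longrightarrow> w \<in> W \<Longrightarrow> v \<cdot> w \<in> U i"
      by (rule open_mult_neighbourhoods[OF U[OF i] xc[OF i] yc[OF i] xy[OF i]]) (rule that)
    then show ?thesis by (intro exI[of _ "(V, W)"]) simp
  qed
  then obtain VW where VW: "\<forall>i\<in>{1..k}. openin T (fst (VW i)) \<and> openin T (snd (VW i)) \<and>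
      x i \<in> fst (VW i) \<and> y i \<in> snd (VW i) \<and> (\<forall>v\<in>fst (VW i). \<forall>w\<in>snd (VW i). v \<cdot> w \<in> U i)"
    by (metis (no_types, lifting))
  have "pos_density k (\<lambda>i. fst (VW i))" by (rule IE_tuples_density[OF x]) (use VW in auto)
  moreover have "pos_density k (\<lambda>i. snd (VW i))" by (rule IE_tuples_density[OF y]) (use VW in auto)
  ultimately show "pos_density k U" by (rule positive_density_mult) (use VW in auto)
qed

lemma IE_tuples_inv:
  assumes x: "x \<in> IE k"
  shows "(\<lambda>i\<in>{1..k}. inv\<^bsub>X\<^esub> x i) \<in> IE k"
proof (rule IE_tuplesI)
  note xc = IE_tuples_carrier[OF x]
  show "(\<lambda>i\<in>{1..k}. inv\<^bsub>X\<^esub> x i) \<in> (\<Pi>\<^sub>E i\<in>{1..k}. carrier X)" using xc by simp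
  fix U assume U: "\<And>i. i \<in> {1..k} \<Longrightarrow> openin T (U i)"
    and "\<And>i. i \<in> {1..k} \<Longrightarrow> (\<lambda>i\<in>{1..k}. inv\<^bsub>X\<^esub> x i) i \<in> U i"
  then have xU: "\<And>i. i \<in> {1..k} \<Longrightarrow> inv\<^bsub>X\<^esub> x i \<in> U i" by simp
  have "continuous_map T T (\<lambda>x. inv\<^bsub>X\<^esub> x)" by (intro continuous_inv) simp
  then have "openin T {y \<in> topspace T. inv\<^bsub>X\<^esub> y \<in> U i}" if "i \<in> {1..k}" for i
    using U[OF that] by (rule openin_preimage)
  then have "pos_density k (\<lambda>i. {y \<in> topspace T. inv\<^bsub>X\<^esub> y \<in> U i})"
    by (rule IE_tuples_density[OF x]) (use xc xU in auto)
  then show "pos_density k U"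
    by (rule positive_density_map[where f = "\<lambda>x. inv\<^bsub>X\<^esub> x"]) (simp_all add: \<phi>_inv)
qed

text \<open>Since \<phi> (g s) v = \<phi> g (\<phi> s v), times s at which the preimages
  \<open>V\<close> are independent become times g s for \<open>U\<close>.\<close>

lemma IE_tuples_action:
  assumes x: "x \<in> IE k" and g: "g \<in> carrier G"
  shows "product_action k \<phi> g x \<in> IE k"
proof (rule IE_tuplesI)
  note xc = IE_tuples_carrier[OF x]
  show "product_action k \<phi> g x \<in> (\<Pi>\<^sub>E i\<in>{1..k}. carrier X)" using xc g by (simp add: product_action_def)
  fix U assume U: "\<And>i. i \<in> {1..k} \<Longrightarrow> openin T (U i)"
    and "\<And>i. i \<in> {1..k} \<Longrightarrow> product_action k \<phi> g x i \<in> U i"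
  then have xU: "\<And>i. i \<in> {1..k} \<Longrightarrow> \<phi> g (x i) \<in> U i" by (simp add: product_action_def)
  define V where "V i = {y \<in> topspace T. \<phi> g y \<in> U i}" for i
  have "openin T (V i)" if "i \<in> {1..k}" for i
    unfolding V_def by (rule openin_preimage[OF continuous_\<phi>[OF g] U[OF that]])
  then have "pos_density k V"
    by (rule IE_tuples_density[OF x]) (use xc xU in \<open>auto simp: V_def\<close>)
  then obtain c :: real where c: "c > 0" "\<And>F. finite F \<Longrightarrow> F \<subseteq> carrier G \<Longrightarrow>
     \<exists>F'\<subseteq>F. indep k V (topspace T) F' \<and> c * real (card F) \<le> real (card F')"
    by (rule positive_densityE) (rule that)
  show "pos_density k U"
    unfolding positive_density_def
  proof (intro exI[of _ c] conjI allI impI c(1))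
    fix F assume "finite F \<and> F \<subseteq> carrier G"
    then have F: "finite F" "F \<subseteq> carrier G" by simp_all
    \<comment> \<open>Density of \<open>V\<close> is applied to the left translate of
      \<open>F\<close> by the inverse of g; being stated for every finite set, it asks for no
      invariance that a left translation might destroy.\<close>
    let ?h = "\<lambda>s. inv\<^bsub>G\<^esub> g \<star> s" and ?h' = "\<lambda>s. g \<star> s"
    have hh: "?h' (?h s) = s" "?h (?h' s) = s" if "s \<in> carrier G" for s
      using g that by (simp_all flip: G.m_assoc)
    have inj: "inj_on ?h (carrier G)" by (rule inj_on_inverseI[of _ ?h']) (rule hh(1))
    have hF: "finite (?h ` F)" "?h ` F \<subseteq> carrier G" using F g by auto
    obtain F1 where F1: "F1 \<subseteq> ?h ` F" "indep k V (topspace T) F1" "c * card (?h ` F) \<le> card F1"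
      using c(2)[OF hF] by (elim exE conjE) (rule that)
    have fin1: "finite F1" "F1 \<subseteq> carrier G" using F1(2) by (simp_all add: independence_set_def)
    define F2 where "F2 = ?h' ` F1"
    have fin2: "finite F2" "F2 \<subseteq> carrier G" using fin1 g by (auto simp: F2_def)
    have "F2 \<subseteq> F"
    proof
      fix s assume "s \<in> F2"
      then obtain t where "t \<in> F1" "s = ?h' t" by (auto simp: F2_def)
      moreover from this F1(1) obtain f where "f \<in> F" "t = ?h f" by auto
      ultimately show "s \<in> F" using hh(1)[of f] F(2) by auto
    qed
    moreover have "card F2 = card F1"
    proof -
      have "inj_on ?h' F1" by (rule inj_on_inverseI[of _ ?h]) (use hh(2) fin1(2) in auto)
      then show ?thesis unfolding F2_def by (rule card_image)
    qed
    moreover have "card (?h ` F) = card F" by (rule card_image[OF inj_on_subset[OF inj F(2)]])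
    moreover have "indep k U (topspace T) F2"
    proof (rule independence_setI[OF fin2 subset_refl])
      fix \<sigma> assume \<sigma>: "\<sigma> \<in> F2 \<rightarrow> {1..k}"
      then have \<sigma>': "(\<lambda>s. \<sigma> (?h' s)) \<in> F1 \<rightarrow> {1..k}" by (auto simp: F2_def)
      obtain v where v: "v \<in> topspace T" "\<And>s. s \<in> F1 \<Longrightarrow> \<phi> s v \<in> V (\<sigma> (?h' s))"
        by (rule independence_setE[OF F1(2) \<sigma>']) (rule that)
      have "\<phi> s v \<in> U (\<sigma> s)" if "s \<in> F2" for s
      proof -
        obtain t where t: "t \<in> F1" "s = ?h' t" using \<open>s \<in> F2\<close> by (auto simp: F2_def)
        have "t \<in> carrier G" using t(1) fin1(2) by (rule subsetD[rotated])
        then show ?thesis using v(2)[OF t(1)] v(1) g by (simp add: t(2) V_def \<phi>_comp)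
      qed
      then show "\<exists>z\<in>topspace T. \<forall>s\<in>F2. \<phi> s z \<in> U (\<sigma> s)" using v(1) by (intro bexI[of _ v] ballI)
    qed
    ultimately show "\<exists>F'\<subseteq>F. indep k U (topspace T) F' \<and> c * card F \<le> card F'"
      using F1(3) by (intro exI[of _ F2] conjI) simp_all
  qed
qed

lemma IE_tuples_invariant: "invariant_subset G (product_action k \<phi>) (IE k)"
  unfolding invariant_subset_def
proof (intro ballI equalityI subsetI)
  fix g x assume g: "g \<in> carrier G"
  show "x \<in> IE k" if "x \<in> product_action k \<phi> g ` IE k"
    using that IE_tuples_action[OF _ g] by auto
  assume x: "x \<in> IE k"
  have "product_action k \<phi> g (product_action k \<phi> (inv\<^bsub>G\<^esub> g) x) = x"
  proof
    fix i
    show "product_action k \<phi> g (product_action k \<phi> (inv\<^bsub>G\<^esub> g) x) i = x i"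
      using IE_tuples_carrier[OF x, of i] g PiE_arb[OF IE_tuples_PiE[OF x], of i]
      by (cases "i \<in> {1..k}") (simp_all add: product_action_def)
  qed
  then show "x \<in> product_action k \<phi> g ` IE k"
    using IE_tuples_action[OF x, of "inv\<^bsub>G\<^esub> g"] g by (intro image_eqI[of _ _ "product_action k \<phi> (inv\<^bsub>G\<^esub>
        g) x"]) simp_all
qed

text \<open>A box that lacks positive density excludes all of its points, not only the tuple for
  which it was found, so the complement is open.\<close>

lemma IE_tuples_closed: "closedin (product_topology (\<lambda>_. T) {1..k}) (IE k)"
  unfolding closedin_def
proof
  let ?P = "product_topology (\<lambda>_. T) {1..k}"
  show "IE k \<subseteq> topspace ?P" using IE_tuples_PiE by auto
  show "openin ?P (topspace ?P - IE k)"
    unfolding openin_subopen[of ?P "topspace ?P - IE k"]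
  proof
    fix x assume x: "x \<in> topspace ?P - IE k"
    then obtain U where U: "\<forall>i\<in>{1..k}. openin T (U i) \<and> x i \<in> U i" "\<not> pos_density k U"
      by (auto simp: IE_tuples_iff)
    show "\<exists>S. openin ?P S \<and> x \<in> S \<and> S \<subseteq> topspace ?P - IE k"
    proof (intro exI[of _ "PiE {1..k} U"] conjI subsetI DiffI)
      show "openin ?P (PiE {1..k} U)" using U(1) by (simp add: openin_PiE_gen)
      show "x \<in> PiE {1..k} U" using x U(1) by (auto simp: PiE_iff)
      fix y assume y: "y \<in> PiE {1..k} U"
      have "U i \<subseteq> carrier X" if "i \<in> {1..k}" for i using U(1) openin_subset that by fastforce
      with y have "y i \<in> carrier X" if "i \<in> {1..k}" for i using that by (meson PiE_mem subsetD)
      then show "y \<in> topspace ?P" using y by (auto simp: PiE_iff)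
      show "y \<notin> IE k"
      proof
        assume "y \<in> IE k"
        then have "pos_density k U" by (rule IE_tuples_density) (use U(1) y in auto)
        then show False using U(2) by simp
      qed
    qed
  qed
qed

section \<open>IE-pairs and the set IE(X)\<close>

definition pair_tuple :: "'x \<Rightarrow> 'x \<Rightarrow> nat \<Rightarrow> 'x" where
  "pair_tuple x y = (\<lambda>i\<in>{1..2}. if i = 1 then x else y)"

lemma IE_group_eq: "IE_grp = {x \<in> carrier X. pair_tuple x \<one>\<^bsub>X\<^esub> \<in> IE 2}"
  by (simp add: IE_group_def pair_tuple_def)

lemma pair_tuple_IE_iff:
  assumes xy: "x \<in> carrier X" "y \<in> carrier X"
  shows "pair_tuple x y \<in> IE 2 \<longleftrightarrow>
    (\<forall>U V. openin T U \<longrightarrow> openin T V \<longrightarrow> x \<in> U \<longrightarrow> y \<in> V \<longrightarrow> pos_density 2 (set_pair U V))"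
proof (intro iffI allI impI)
  fix U V assume x: "pair_tuple x y \<in> IE 2" and "openin T U" "openin T V" "x \<in> U" "y \<in> V"
  then show "pos_density 2 (set_pair U V)"
    by (intro IE_tuples_density[OF x]) (auto simp: set_pair_def pair_tuple_def)
next
  assume *: "\<forall>U V. openin T U \<longrightarrow> openin T V \<longrightarrow> x \<in> U \<longrightarrow> y \<in> V \<longrightarrow> pos_density 2 (set_pair U V)"
  show "pair_tuple x y \<in> IE 2"
  proof (rule IE_tuplesI)
    show "pair_tuple x y \<in> (\<Pi>\<^sub>E i\<in>{1..2}. carrier X)" using xy by (simp add: pair_tuple_def)
    fix U :: "nat \<Rightarrow> 'x set" assume "\<And>i. i \<in> {1..2} \<Longrightarrow> openin T (U i)" "\<And>i. i \<in> {1..2}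
        \<Longrightarrow> pair_tuple x y i \<in> U i"
    from this[of 1] this[of 2] have "openin T (U 1)" "openin T (U 2)" "x \<in> U 1" "y \<in> U 2"
      by (simp_all add: pair_tuple_def)
    then have "pos_density 2 (set_pair (U 1) (U 2))" using * by simp
    then show "pos_density 2 U"
    proof (rule positive_density_relabel[where h = id])
      fix i :: nat assume "i \<in> {1..2}"
      then have "i = 1 \<or> i = 2" by auto
      then show "set_pair (U 1) (U 2) (id i) \<inter> topspace T \<subseteq> U i" by (auto simp: set_pair_def)
    qed auto
  qed
qed

lemma pair_tuple_mult:
  assumes "pair_tuple x y \<in> IE 2" "pair_tuple x' y' \<in> IE 2"
  shows "pair_tuple (x \<cdot> x') (y \<cdot> y') \<in> IE 2"
proof -
  have "pair_tuple (x \<cdot> x') (y \<cdot> y') = (\<lambda>i\<in>{1..2}. pair_tuple x y i \<cdot> pair_tuple x' y' i)"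
    by (auto simp: pair_tuple_def restrict_def)
  then show ?thesis using IE_tuples_mult[OF assms] by simp
qed

lemma IE_tuples_subpair:
  assumes x: "x \<in> IE k" and ij: "i \<in> {1..k}" "j \<in> {1..k}"
  shows "pair_tuple (x i) (x j) \<in> IE 2"
  unfolding pair_tuple_IE_iff[OF IE_tuples_carrier[OF x ij(1)] IE_tuples_carrier[OF x ij(2)]]
proof (intro allI impI)
  fix U V assume UV: "openin T U" "openin T V" "x i \<in> U" "x j \<in> V"
  \<comment> \<open>Intersecting the two conditions, rather than distinguishing cases, also covers i
    = j, where the entry must lie in \<open>U\<close> and in \<open>V\<close>.\<close>
  define W where "W l = (if l = i then U else carrier X) \<inter> (if l = j then V else carrier X)" for l
  have "pos_density k W"
  proof (rule IE_tuples_density[OF x])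
    show "openin T (W l)" for l using UV by (auto simp: W_def intro!: openin_Int)
    show "x l \<in> W l" if "l \<in> {1..k}" for l using UV IE_tuples_carrier[OF x that] by (auto simp: W_def)
  qed
  then show "pos_density 2 (set_pair U V)"
    by (rule positive_density_relabel[where h = "\<lambda>l. if l = 1 then i else j"])
      (use ij in \<open>auto simp: set_pair_def W_def split: if_splits\<close>)
qed

lemma IE_group_closed: "closedin T IE_grp"
proof -
  have "continuous_map T (product_topology (\<lambda>_. T) {1..2}) (\<lambda>x. pair_tuple x \<one>\<^bsub>X\<^esub>)"
    unfolding continuous_map_componentwise
  proof (intro conjI ballI)
    show "continuous_map T T (\<lambda>x. pair_tuple x \<one>\<^bsub>X\<^esub> i)" if "i \<in> {1..2}" for i
      using that by (cases "i = 1") (simp_all add: pair_tuple_def)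
  qed (auto simp: pair_tuple_def)
  then have "closedin T {x \<in> topspace T. pair_tuple x \<one>\<^bsub>X\<^esub> \<in> IE 2}"
    by (rule closedin_continuous_map_preimage[OF _ IE_tuples_closed])
  then show ?thesis by (simp add: IE_group_eq)
qed

lemma IE_group_invariant: "invariant_subset G \<phi> IE_grp"
proof -
  have step: "\<phi> g x \<in> IE_grp" if "g \<in> carrier G" "x \<in> IE_grp" for g x
  proof -
    have x: "x \<in> carrier X" "pair_tuple x \<one>\<^bsub>X\<^esub> \<in> IE 2" using that by (simp_all add: IE_group_eq)
    have "product_action 2 \<phi> g (pair_tuple x \<one>\<^bsub>X\<^esub>) = pair_tuple (\<phi> g x) \<one>\<^bsub>X\<^esub>"
      using that by (auto simp: product_action_def pair_tuple_def restrict_def)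
    then show ?thesis using IE_tuples_action[OF x(2) that(1)] x(1) that by (simp add: IE_group_eq)
  qed
  show ?thesis unfolding invariant_subset_def
  proof (intro ballI equalityI subsetI)
    fix g x assume g: "g \<in> carrier G"
    show "x \<in> IE_grp" if "x \<in> \<phi> g ` IE_grp" using that step[OF g] by auto
    assume x: "x \<in> IE_grp"
    then have "x \<in> carrier X" by (simp add: IE_group_eq)
    then show "x \<in> \<phi> g ` IE_grp"
      using step[OF _ x, of "inv\<^bsub>G\<^esub> g"] g by (intro image_eqI[of _ _ "\<phi> (inv\<^bsub>G\<^esub> g) x"]) simp_all
  qed
qed

end

section \<open>Diagonal tuples and the subgroup laws\<close>

locale algebraic_action_Haar = algebraic_action G X T \<phi>
  for G :: "('g, 'm) monoid_scheme" and X :: "('x, 'n) monoid_scheme"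
    and T :: "'x topology" and \<phi> :: "'g \<Rightarrow> 'x \<Rightarrow> 'x" +
  fixes \<mu> :: "'x measure"
  assumes Haar: "normalized_Haar_measure X T \<mu>"
begin

lemma Borel_\<mu>: "Borel_prob_measure T \<mu>" by (rule Haar_Borel[OF Haar])

lemma measure_\<mu>_space: "measure \<mu> (space \<mu>) = 1"
  using Borel_measure_space[OF Borel_\<mu>] Borel_space[OF Borel_\<mu>] by simp

text \<open>When all entries agree, every choice makes the same demand, so one point returning often
  to \<open>V\<close> is enough. The expected number of times in \<open>F\<close> at which a Haar
  random point lies in \<open>V\<close> is \<mu>(V) |F|.\<close>

lemma positive_density_constant:
  assumes V: "openin T V" "V \<noteq> {}"
  shows "pos_density k (\<lambda>_. V)"
  unfolding positive_density_def
proof (intro exI[of _ "measure \<mu> V"] conjI allI impI)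
  show "measure \<mu> V > 0" by (rule Haar_measure_open_pos[OF Haar V])
  fix F assume "finite F \<and> F \<subseteq> carrier G"
  then have F: "finite F" "F \<subseteq> carrier G" by simp_all
  define A where "A s = {y \<in> carrier X. \<phi> s (\<one>\<^bsub>X\<^esub> \<cdot> y) \<in> V}" for s
  have A: "A s \<in> sets \<mu>" "measure \<mu> (A s) = measure \<mu> V" if "s \<in> F" for s
    unfolding A_def using Haar_measure_translate[OF Haar, of s "\<one>\<^bsub>X\<^esub>" V] that F Borel_sets_open[OF Borel_\<mu>
        V(1)]
    by auto
  obtain y where y: "y \<in> space \<mu>" "(\<Sum>s\<in>F. 1 * measure \<mu> (A s)) \<le> (\<Sum>s\<in>F. 1 * indicator (A s) y)"
    by (rule exists_point_ge_average[OF Borel_finite[OF Borel_\<mu>] measure_\<mu>_space F(1) A(1)])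
  have yX: "y \<in> carrier X" using y(1) Borel_space[OF Borel_\<mu>] by simp
  let ?J = "{s \<in> F. y \<in> A s}"
  have "(\<Sum>s\<in>F. 1 * indicator (A s) y) = real (card ?J)"
    using F by (simp add: indicator_def Int_def flip: sum.inter_filter)
  with y(2) A(2) have "measure \<mu> V * card F \<le> card ?J" by (simp add: mult.commute)
  moreover have "indep k (\<lambda>_. V) (topspace T) ?J"
    by (rule independence_setI) (use F yX in \<open>auto simp: A_def\<close>)
  ultimately show "\<exists>F'\<subseteq>F. indep k (\<lambda>_. V) (topspace T) F' \<and> measure \<mu> V * card F \<le> card F'"
    by (intro exI[of _ ?J] conjI) auto
qed

lemma IE_tuples_diagonal:
  assumes y: "y \<in> carrier X"
  shows "(\<lambda>i\<in>{1..k}. y) \<in> IE k"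
proof (rule IE_tuplesI)
  show "(\<lambda>i\<in>{1..k}. y) \<in> (\<Pi>\<^sub>E i\<in>{1..k}. carrier X)" using y by simp
  fix U :: "nat \<Rightarrow> 'x set" assume U: "\<And>i. i \<in> {1..k} \<Longrightarrow> openin T (U i)" "\<And>i. i \<in> {1..k}
      \<Longrightarrow> (\<lambda>i\<in>{1..k}. y) i \<in> U i"
  let ?V = "topspace T \<inter> (\<Inter>i\<in>{1..k}. U i)"
  have "openin T ?V" using U(1) by (intro openin_INT_finite) auto
  moreover have "?V \<noteq> {}" using U(2) y by auto
  ultimately have "pos_density k (\<lambda>_. ?V)" by (rule positive_density_constant)
  then show "pos_density k U"
    by (rule positive_density_relabel[where h = id]) auto
qed

lemma pair_tuple_diagonal: "y \<in> carrier X \<Longrightarrow> pair_tuple y y \<in> IE 2"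
  using IE_tuples_diagonal[of y 2] by (simp add: pair_tuple_def)

lemma IE_tuples_subgroup: "subgroup (IE k) (product_group {1..k} (\<lambda>_. X))"
proof
  show "IE k \<subseteq> carrier (product_group {1..k} (\<lambda>_. X))" using IE_tuples_PiE by auto
  show "x \<otimes>\<^bsub>product_group {1..k} (\<lambda>_. X)\<^esub> y \<in> IE k"
    if "x \<in> IE k" "y \<in> IE k" for x y
    using IE_tuples_mult[OF that] by (simp add: product_group_def)
  show "\<one>\<^bsub>product_group {1..k} (\<lambda>_. X)\<^esub> \<in> IE k"
    using IE_tuples_diagonal[of "\<one>\<^bsub>X\<^esub>" k] by (simp add: product_group_def)
  show "inv\<^bsub>product_group {1..k} (\<lambda>_. X)\<^esub> x \<in> IE k" if "x \<in> IE k" for x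
    using IE_tuples_inv[OF that] IE_tuples_PiE[OF that] X.group_axioms by simp
qed

text \<open>An IE-pair (x, y) is multiplied on either side by the diagonal pair of the inverse of y,
  which turns its second entry into the identity.\<close>

lemma IE_group_quotient:
  assumes "pair_tuple x y \<in> IE 2" "x \<in> carrier X" "y \<in> carrier X"
  shows "x \<cdot> inv\<^bsub>X\<^esub> y \<in> IE_grp" and "inv\<^bsub>X\<^esub> y \<cdot> x \<in> IE_grp"
proof -
  have d: "pair_tuple (inv\<^bsub>X\<^esub> y) (inv\<^bsub>X\<^esub> y) \<in> IE 2" using assms by (intro pair_tuple_diagonal) simp
  show "x \<cdot> inv\<^bsub>X\<^esub> y \<in> IE_grp"
    using pair_tuple_mult[OF assms(1) d] assms by (simp add: IE_group_eq)
  show "inv\<^bsub>X\<^esub> y \<cdot> x \<in> IE_grp"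
    using pair_tuple_mult[OF d assms(1)] assms by (simp add: IE_group_eq)
qed

text \<open>For normality, (g, g) times (x, 1) is the IE-pair (g \<cdot> x, g), and dividing it by g
  gives the conjugate of x.\<close>

lemma IE_group_normal: "IE_grp \<lhd> X"
  unfolding X.normal_inv_iff
proof
  have mult: "x \<cdot> y \<in> IE_grp" if "x \<in> IE_grp" "y \<in> IE_grp" for x y
    using pair_tuple_mult[of x "\<one>\<^bsub>X\<^esub>" y "\<one>\<^bsub>X\<^esub>"] that by (simp add: IE_group_eq)
  have inv: "inv\<^bsub>X\<^esub> x \<in> IE_grp" if "x \<in> IE_grp" for x
  proof -
    have "(\<lambda>i\<in>{1..2}. inv\<^bsub>X\<^esub> pair_tuple x \<one>\<^bsub>X\<^esub> i) = pair_tuple (inv\<^bsub>X\<^esub> x) \<one>\<^bsub>X\<^esub>"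
      by (auto simp: pair_tuple_def restrict_def)
    then show ?thesis using that IE_tuples_inv[of "pair_tuple x \<one>\<^bsub>X\<^esub>" 2] by (simp add: IE_group_eq)
  qed
  have one: "\<one>\<^bsub>X\<^esub> \<in> IE_grp" using pair_tuple_diagonal[of "\<one>\<^bsub>X\<^esub>"] by (simp add: IE_group_eq)
  show "subgroup IE_grp X"
    by (rule X.subgroupI) (use mult inv one in \<open>auto simp: IE_group_eq\<close>)
  show "\<forall>g\<in>carrier X. \<forall>x\<in>IE_grp. g \<cdot> x \<cdot> inv\<^bsub>X\<^esub> g \<in> IE_grp"
  proof (intro ballI)
    fix g x assume g: "g \<in> carrier X" and x: "x \<in> IE_grp"
    have "pair_tuple (g \<cdot> x) (g \<cdot> \<one>\<^bsub>X\<^esub>) \<in> IE 2"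
      using pair_tuple_mult[OF pair_tuple_diagonal[OF g]] x by (simp add: IE_group_eq)
    then show "g \<cdot> x \<cdot> inv\<^bsub>X\<^esub> g \<in> IE_grp"
      using IE_group_quotient(1)[of "g \<cdot> x" g] g x by (simp add: IE_group_eq)
  qed
qed

text \<open>All entries other than the i-th are identities and can share one neighbourhood of the
  identity, so independence for two sets relabels to independence for k sets.\<close>

lemma IE_tuples_single:
  assumes x: "x \<in> IE_grp" and i: "i \<in> {1..k}"
  shows "(\<lambda>j\<in>{1..k}. if j = i then x else \<one>\<^bsub>X\<^esub>) \<in> IE k"
proof (rule IE_tuplesI)
  have xX: "x \<in> carrier X" and xp: "pair_tuple x \<one>\<^bsub>X\<^esub> \<in> IE 2" using x by (simp_all add: IE_group_eq)
  then show "(\<lambda>j\<in>{1..k}. if j = i then x else \<one>\<^bsub>X\<^esub>) \<in> (\<Pi>\<^sub>E i\<in>{1..k}. carrier X)" by simp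
  fix U assume U: "\<And>j. j \<in> {1..k} \<Longrightarrow> openin T (U j)"
    and "\<And>j. j \<in> {1..k} \<Longrightarrow> (\<lambda>j\<in>{1..k}. if j = i then x else \<one>\<^bsub>X\<^esub>) j \<in> U j"
  then have xU: "\<And>j. j \<in> {1..k} \<Longrightarrow> (if j = i then x else \<one>\<^bsub>X\<^esub>) \<in> U j" by simp
  let ?V = "topspace T \<inter> (\<Inter>j\<in>{1..k} - {i}. U j)"
  have "openin T ?V" using U by (intro openin_INT_finite) auto
  moreover have "\<one>\<^bsub>X\<^esub> \<in> ?V"
  proof -
    have "\<one>\<^bsub>X\<^esub> \<in> U j" if "j \<in> {1..k} - {i}" for j using xU[of j] that by simp
    then show ?thesis by simp
  qed
  ultimately have "pos_density 2 (set_pair (U i) ?V)"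
    using xp[unfolded pair_tuple_IE_iff[OF xX X.one_closed]] U[OF i] xU[OF i] by simp
  then show "pos_density k U"
    by (rule positive_density_relabel[where h = "\<lambda>j. if j = i then 1 else 2"])
      (auto simp: set_pair_def split: if_splits)
qed

text \<open>The tuple is a product of tuples with at most one nontrivial entry; the induction on
  \<open>m\<close> multiplies in one entry at a time.\<close>

lemma IE_tuples_product:
  assumes x: "x \<in> {1..k} \<rightarrow> IE_grp"
  shows "(\<lambda>i\<in>{1..k}. x i) \<in> IE k"
proof -
  have "(\<lambda>i\<in>{1..k}. if i \<le> m then x i else \<one>\<^bsub>X\<^esub>) \<in> IE k" if "m \<le> k" for m
    using that
  proof (induction m)
    case 0
    have eq: "(\<lambda>i\<in>{1..k}. if i \<le> 0 then x i else \<one>\<^bsub>X\<^esub>) = (\<lambda>i\<in>{1..k}. \<one>\<^bsub>X\<^esub>)" by (auto simp: restrict_def)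
    show ?case unfolding eq by (rule IE_tuples_diagonal) simp
  next
    case (Suc m)
    then have m: "Suc m \<in> {1..k}" by auto
    note IH = Suc.IH[OF Suc_leD[OF Suc.prems]]
    have xX: "x i \<in> carrier X" if "i \<in> {1..k}" for i using funcset_mem[OF x that]
        by (simp add: IE_group_eq)
    have eq: "(\<lambda>i\<in>{1..k}. if i \<le> Suc m then x i else \<one>\<^bsub>X\<^esub>) =
        (\<lambda>i\<in>{1..k}. (\<lambda>i\<in>{1..k}. if i \<le> m then x i else \<one>\<^bsub>X\<^esub>) i \<cdot> (\<lambda>j\<in>{1..k}.
            if j = Suc m then x (Suc m) else \<one>\<^bsub>X\<^esub>) i)"
      using xX xX[OF m] by (intro restrict_ext) (auto simp: le_Suc_eq)
    show ?case unfolding eq by (rule IE_tuples_mult[OF IH IE_tuples_single[OF funcset_mem[OF x m] m]])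
  qed
  from this[of k] show ?thesis
    by (rule back_subst[where P = "\<lambda>z. z \<in> _"]) (auto simp: restrict_def)
qed

lemma IE_tuples_eq:
  shows "IE k =
      {(\<lambda>i\<in>{1..k}. x i \<cdot> y) |x y. x \<in> {1..k} \<rightarrow> IE_grp \<and> y \<in> carrier X}" (is "_ = ?R")
    and "IE k =
      {(\<lambda>i\<in>{1..k}. y \<cdot> x i) |x y. x \<in> {1..k} \<rightarrow> IE_grp \<and> y \<in> carrier X}" (is "_ = ?L")
proof -
  have mem: "(\<lambda>i\<in>{1..k}. x i \<cdot> y) \<in> IE k" "(\<lambda>i\<in>{1..k}. y \<cdot> x i) \<in> IE k"
    if x: "x \<in> {1..k} \<rightarrow> IE_grp" and y: "y \<in> carrier X" for x y
  proof -
    note * = IE_tuples_product[OF x] IE_tuples_diagonal[OF y, of k]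
    have "(\<lambda>i\<in>{1..k}. x i \<cdot> y) = (\<lambda>i\<in>{1..k}. (\<lambda>i\<in>{1..k}. x i) i \<cdot> (\<lambda>i\<in>{1..k}. y) i)"
      "(\<lambda>i\<in>{1..k}. y \<cdot> x i) = (\<lambda>i\<in>{1..k}. (\<lambda>i\<in>{1..k}. y) i \<cdot> (\<lambda>i\<in>{1..k}. x i) i)"
      by (auto simp: restrict_def)
    then show "(\<lambda>i\<in>{1..k}. x i \<cdot> y) \<in> IE k" "(\<lambda>i\<in>{1..k}. y \<cdot> x i) \<in> IE k"
      using IE_tuples_mult[OF *] IE_tuples_mult[OF *(2,1)] by simp_all
  qed
  have dec: "\<exists>y\<in>carrier X. (\<forall>i\<in>{1..k}. z i \<cdot> inv\<^bsub>X\<^esub> y \<in> IE_grp \<and> inv\<^bsub>X\<^esub> y \<cdot> z i \<in> IE_grp)"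
    if z: "z \<in> IE k" for z
  proof (cases "k = 0")
    case True
    then show ?thesis using X.one_closed by auto
  next
    case False
    \<comment> \<open>The common factor y is the first entry of z: each entry forms an IE-pair with
      it, so their quotients lie in IE(X).\<close>
    then have 1: "1 \<in> {1..k}" by simp
    show ?thesis
      using IE_group_quotient[OF IE_tuples_subpair[OF z _ 1] IE_tuples_carrier[OF z] IE_tuples_carrier[OF
          z 1]]
      by (intro bexI[OF _ IE_tuples_carrier[OF z 1]]) simp
  qed
  show "IE k = ?R"
  proof (intro equalityI subsetI)
    fix z assume z: "z \<in> IE k"
    obtain y where y: "y \<in> carrier X" "\<forall>i\<in>{1..k}. z i \<cdot> inv\<^bsub>X\<^esub> y \<in> IE_grp"
      using dec[OF z] by auto
    have "z = (\<lambda>i\<in>{1..k}. (z i \<cdot> inv\<^bsub>X\<^esub> y) \<cdot> y)"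
      by (rule PiE_ext[OF IE_tuples_PiE[OF z]])
        (use IE_tuples_carrier[OF z] y(1) in \<open>simp_all add: X.m_assoc\<close>)
    then show "z \<in> ?R"
      using y by (intro CollectI exI[of _ "\<lambda>i. z i \<cdot> inv\<^bsub>X\<^esub> y"] exI[of _ y]) simp
  qed (use mem in auto)
  show "IE k = ?L"
  proof (intro equalityI subsetI)
    fix z assume z: "z \<in> IE k"
    obtain y where y: "y \<in> carrier X" "\<forall>i\<in>{1..k}. inv\<^bsub>X\<^esub> y \<cdot> z i \<in> IE_grp"
      using dec[OF z] by auto
    have "z = (\<lambda>i\<in>{1..k}. y \<cdot> (inv\<^bsub>X\<^esub> y \<cdot> z i))"
      by (rule PiE_ext[OF IE_tuples_PiE[OF z]])
        (use IE_tuples_carrier[OF z] y(1) in \<open>simp_all flip: X.m_assoc\<close>)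
    then show "z \<in> ?L"
      using y by (intro CollectI exI[of _ "\<lambda>i. inv\<^bsub>X\<^esub> y \<cdot> z i"] exI[of _ y]) simp
  qed (use mem in auto)
qed

end

section \<open>Measure IE-tuples\<close>

text \<open>A word on \<open>J\<close> has at most |L|^|F - J| extensions to \<open>F\<close>;
  consequently the density of a family among all words does not drop when it is restricted to
  \<open>J\<close>.\<close>

lemma card_le_card_restrict:
  assumes F: "finite F" "finite L" "J \<subseteq> F" and S: "S \<subseteq> F \<rightarrow>\<^sub>E L"
  shows "card S \<le> card ((\<lambda>w. restrict w J) ` S) * card L ^ card (F - J)"
proof -
  let ?R = "(\<lambda>w. restrict w J) ` S"
  have finS: "finite S" using F(1,2) S finite_PiE finite_subset by (metis (no_types, lifting))
  have inj: "inj_on (\<lambda>w. (restrict w J, restrict w (F - J))) S"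
  proof (rule inj_onI)
    fix v w assume v: "v \<in> S" and w: "w \<in> S"
      and eq: "(restrict v J, restrict v (F - J)) = (restrict w J, restrict w (F - J))"
    have "v s = w s" if "s \<in> F" for s
    proof (cases "s \<in> J")
      case True
      then show ?thesis using eq by (metis (no_types, lifting) Pair_inject restrict_apply)
    next
      case False
      then have "s \<in> F - J" using that by simp
      then show ?thesis using eq by (metis (no_types, lifting) Pair_inject restrict_apply)
    qed
    then show "v = w" using subsetD[OF S v] subsetD[OF S w] by (intro PiE_ext)
  qed
  have "(\<lambda>w. (restrict w J, restrict w (F - J))) ` S \<subseteq> ?R \<times> ((F - J) \<rightarrow>\<^sub>E L)"
    using S by fastforce
  then have "card S \<le> card (?R \<times> ((F - J) \<rightarrow>\<^sub>E L))"
    using F finS by (intro card_inj_on_le[OF inj]) (auto intro!: finite_PiE)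
  then show ?thesis using F by (simp add: card_cartesian_product card_PiE)
qed

text \<open>With D the whole space, the definition provides one independence set inside some set
  almost invariant under a prescribed K. For K the inverses of \<open>F\<close> and \<epsilon> = 1
  this independence set transfers to \<open>F\<close>.\<close>

lemma (in algebraic_action) measure_IE_tuples_subset:
  assumes \<nu>: "Borel_prob_measure T \<nu>"
  shows "measure_IE_tuples G T \<phi> \<nu> k \<subseteq> IE k"
proof
  fix x assume x: "x \<in> measure_IE_tuples G T \<phi> \<nu> k"
  show "x \<in> IE k"
  proof (rule IE_tuplesI)
    show "x \<in> (\<Pi>\<^sub>E i\<in>{1..k}. carrier X)" using x by (simp add: measure_IE_tuples_def)
    fix U assume "\<And>i. i \<in> {1..k} \<Longrightarrow> openin T (U i)" "\<And>i. i \<in> {1..k} \<Longrightarrow> x i \<in> U i"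
    then have "\<exists>c \<delta>. c > (0::real) \<and> \<delta> > (0::real) \<and>
           (\<forall>K \<epsilon>. finite K \<and> K \<noteq> {} \<and> K \<subseteq> carrier G \<and> \<epsilon> > (0::real) \<longrightarrow>
             (\<exists>F. finite F \<and> F \<noteq> {} \<and> F \<subseteq> carrier G \<and>
                real (card ((K <#>\<^bsub>G\<^esub> F) - F)) \<le> \<epsilon> * real (card F) \<and>
                (\<forall>D\<in>sets \<nu>. measure \<nu> D \<ge> 1 - \<delta> \<longrightarrow>
                  (\<exists>F'\<subseteq>F. indep k U D F' \<and>
                     real (card F') \<ge> c * real (card F)))))"
      using x unfolding measure_IE_tuples_def by simp
    then obtain c \<delta> where c: "c > (0::real)" "\<delta> > (0::real)" and
      *: "\<And>K \<epsilon>. finite K \<and> K \<noteq> {} \<and> K \<subseteq> carrier G \<and> \<epsilon> > (0::real) \<Longrightarrow>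
             (\<exists>F. finite F \<and> F \<noteq> {} \<and> F \<subseteq> carrier G \<and>
                real (card ((K <#>\<^bsub>G\<^esub> F) - F)) \<le> \<epsilon> * real (card F) \<and>
                (\<forall>D\<in>sets \<nu>. measure \<nu> D \<ge> 1 - \<delta> \<longrightarrow>
                  (\<exists>F'\<subseteq>F. indep k U D F' \<and>
                     real (card F') \<ge> c * real (card F))))"
      by (elim exE conjE) (rule that, assumption, assumption, simp)
    have D: "topspace T \<in> sets \<nu>" "measure \<nu> (topspace T) \<ge> 1 - \<delta>"
      using Borel_sets_open[OF \<nu> openin_carrier] Borel_measure_space[OF \<nu>] c by auto
    show "pos_density k U"
      unfolding positive_density_def
    proof (intro exI[of _ "c / 2"] conjI allI impI)
      fix F assume "finite F \<and> F \<subseteq> carrier G"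
      then have F: "finite F" "F \<subseteq> carrier G" by simp_all
      show "\<exists>F'\<subseteq>F. indep k U (topspace T) F' \<and> c / 2 * real (card F) \<le> real (card F')"
      proof (cases "F = {}")
        case True
        then show ?thesis using X.one_closed by (auto simp: independence_set_def)
      next
        case False
        let ?K = "(\<lambda>s. inv\<^bsub>G\<^esub> s) ` F"
        have "finite ?K \<and> ?K \<noteq> {} \<and> ?K \<subseteq> carrier G \<and> 1 > (0::real)" using F False by auto
        from *[OF this] obtain E where E: "finite E" "E \<noteq> {}" "E \<subseteq> carrier G"
          "real (card ((?K <#>\<^bsub>G\<^esub> E) - E)) \<le> 1 * real (card E)"
          "\<forall>D\<in>sets \<nu>. measure \<nu> D \<ge> 1 - \<delta> \<longrightarrow>
                  (\<exists>F'\<subseteq>E. indep k U D F' \<and> real (card F') \<ge> c * real (card E))"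
          by (elim exE conjE) (rule that)
        obtain E' where E': "E' \<subseteq> E" "indep k U (topspace T) E'" "c * card E \<le> card E'"
          using E(5)[rule_format, OF D] by (elim exE conjE) (rule that)
        show ?thesis by (rule independence_set_transfer[OF F E(1,3,2) _ E']) (use E(4) in simp)
      qed
    qed (use c in simp)
  qed
qed

context algebraic_action_Haar
begin

text \<open>For independent \<open>z \<sigma>\<close> and a Haar random \<open>y\<close>, the fraction of \<open>\<sigma>\<close> with \<open>z \<sigma> \<cdot> y \<in> D\<close> is close to
  one, so these \<open>\<sigma>\<close> shatter a positive proportion of the coordinates at which \<open>y\<close> returns to a
  given neighbourhood of the identity.\<close>

lemma independence_relative_to_large_sets:
  assumes k: "k > 0" and V: "pos_density k V"
    and W: "openin T W" "\<one>\<^bsub>X\<^esub> \<in> W"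
    and VW: "\<And>i v w. i \<in> {1..k} \<Longrightarrow> v \<in> V i \<Longrightarrow> w \<in> W \<Longrightarrow> v \<cdot> w \<in> U i"
  obtains c \<delta> :: real where "c > 0" "\<delta> > 0"
    "\<And>F D. finite F \<Longrightarrow> F \<noteq> {} \<Longrightarrow> F \<subseteq> carrier G \<Longrightarrow> D \<in> sets \<mu> \<Longrightarrow> measure \<mu> D \<ge> 1 - \<delta> \<Longrightarrow>
      \<exists>F'\<subseteq>F. indep k U D F' \<and> c * real (card F) \<le> real (card F')"
proof -
  obtain c :: real where c: "c > 0" "\<And>F. finite F \<Longrightarrow> F \<subseteq> carrier G \<Longrightarrow>
     \<exists>F'\<subseteq>F. indep k V (topspace T) F' \<and> c * real (card F) \<le> real (card F')"
    by (rule positive_densityE[OF V]) (rule that)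
  define v where "v = measure \<mu> W"
  have v: "v > 0" "v \<le> 1"
  proof -
    show "v > 0" unfolding v_def by (rule Haar_measure_open_pos[OF Haar W(1)]) (use W(2) in auto)
    interpret finite_measure \<mu> by (rule Borel_finite[OF Borel_\<mu>])
    show "v \<le> 1" unfolding v_def using bounded_measure[of W] measure_\<mu>_space by simp
  qed
  have L: "finite {1..k}" "{1..k} \<noteq> {}" using k by auto
  obtain c2 :: real where c2: "0 < c2"
    "\<And>(F :: 'g set) S. finite F \<Longrightarrow> F \<noteq> {} \<Longrightarrow> S \<subseteq> F \<rightarrow>\<^sub>E {1..k} \<Longrightarrow>
      (1 - 1 / (4 * card {1..k})) * card {1..k} ^ card F < card S \<Longrightarrow>
      \<exists>J\<subseteq>F. c2 * card F \<le> card J \<and> (\<forall>f\<in>J \<rightarrow> {1..k}. \<exists>w\<in>S. \<forall>s\<in>J. w s = f s)"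
    by (rule dense_shatters_alphabet[OF L, where 'a = 'g]) (rule that)
  show ?thesis
  \<comment> \<open>This \<delta> limits the loss from \<open>D\<close> in the weighted average
    below to 8 k \<delta> = v/2, half of the contribution v of the return times.\<close>
  proof (rule that[of "c2 * (v / 2 * c)" "v / (16 * real k)"])
    show "c2 * (v / 2 * c) > 0" "v / (16 * real k) > 0" using c c2(1) v k by auto
    fix F D assume F: "finite F" "F \<noteq> {}" "F \<subseteq> carrier G" and D: "D \<in> sets \<mu>"
        "measure \<mu> D \<ge> 1 - v / (16 * real k)"
    have DX: "D \<subseteq> carrier X" by (rule Borel_sets_subset[OF Borel_\<mu> D(1)])
    obtain F1 where F1: "F1 \<subseteq> F" "indep k V (topspace T) F1" "c * card F \<le> card F1"
      using c(2)[OF F(1,3)] by (elim exE conjE) (rule that)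
    have fin1: "finite F1" "F1 \<subseteq> carrier G" using F1(2) by (simp_all add: independence_set_def)
    define n where "n = card F1"
    have "c * card F > 0" using c F by (simp add: card_gt_0_iff)
    then have n: "n > 0" using F1(3) by (simp add: n_def)
    let ?S = "F1 \<rightarrow>\<^sub>E {1..k}"
    have finS: "finite ?S" and cardS: "card ?S = k ^ n"
      using fin1 by (simp_all add: n_def card_PiE finite_PiE)
    have "\<forall>\<sigma>\<in>?S. \<exists>z. z \<in> carrier X \<and> (\<forall>s\<in>F1. \<phi> s z \<in> V (\<sigma> s))"
    proof
      fix \<sigma> assume "\<sigma> \<in> ?S"
      then have \<sigma>: "\<sigma> \<in> F1 \<rightarrow> {1..k}" by auto
      obtain z where "z \<in> topspace T" "\<And>s. s \<in> F1 \<Longrightarrow> \<phi> s z \<in> V (\<sigma> s)"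
        by (rule independence_setE[OF F1(2) \<sigma>]) (rule that)
      then show "\<exists>z. z \<in> carrier X \<and> (\<forall>s\<in>F1. \<phi> s z \<in> V (\<sigma> s))" by (intro exI[of _ z]) simp
    qed
    then obtain z where "\<forall>\<sigma>\<in>?S. z \<sigma> \<in> carrier X \<and> (\<forall>s\<in>F1. \<phi> s (z \<sigma>) \<in> V (\<sigma> s))"
      unfolding bchoice_iff by (elim exE) (rule that)
    then have z: "\<And>\<sigma>. \<sigma> \<in> ?S \<Longrightarrow> z \<sigma> \<in> carrier X" "\<And>\<sigma> s. \<sigma> \<in> ?S \<Longrightarrow> s \<in> F1 \<Longrightarrow> \<phi> s (z \<sigma>) \<in> V (\<sigma> s)"
      by simp_all
    \<comment> \<open>\<open>Inl s\<close> is the event that y is in \<open>W\<close> at time s,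
      \<open>Inr \<sigma>\<close> that the translated witness lies in \<open>D\<close>; the latter
      is written with the identity of \<open>G\<close> to fit \<open>Haar_measure_translate\<close>.
      With the weights \<open>a\<close> the first sum is at most 1, the second at most 8k, and the
      average of the total is at least 8k + v/2. Hence one y returns at a fraction at least v/2 of
      the times and also keeps more than a fraction 1 - 1/(8k) of the \<sigma>.\<close>
    define A where "A i = (case i of Inl s \<Rightarrow> {y \<in> carrier X. \<phi> s (\<one>\<^bsub>X\<^esub> \<cdot> y) \<in> W}
        | Inr \<sigma> \<Rightarrow> {y \<in> carrier X. \<phi> \<one>\<^bsub>G\<^esub> (z \<sigma> \<cdot> y) \<in> D})" for i
    define a where "a i = (case i of Inl s \<Rightarrow> 1 / n | Inr \<sigma> \<Rightarrow> 8 * real k / real k ^ n)"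
        for i :: "'g + ('g \<Rightarrow> nat)"
    have AW: "A (Inl s) \<in> sets \<mu>" "measure \<mu> (A (Inl s)) = v" if "s \<in> F1" for s
      using Haar_measure_translate[OF Haar, of s "\<one>\<^bsub>X\<^esub>" W] that fin1 Borel_sets_open[OF Borel_\<mu> W(1)]
      by (auto simp: A_def v_def)
    have AD: "A (Inr \<sigma>) \<in> sets \<mu>" "measure \<mu> (A (Inr \<sigma>)) = measure \<mu> D" if "\<sigma> \<in> ?S" for \<sigma>
      using Haar_measure_translate[OF Haar G.one_closed z(1)[OF that] D(1)] by (simp_all add: A_def)
    have Asets: "A i \<in> sets \<mu>" if "i \<in> F1 <+> ?S" for i using that AW AD by auto
    have fin: "finite (F1 <+> ?S)" using fin1 finS by simp
    obtain y where y: "y \<in> space \<mu>" "(\<Sum>i\<in>F1 <+> ?S. a i * measure \<mu> (A i)) \<le> (\<Sum>i\<in>F1 <+> ?S. a i *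
        indicator (A i) y)"
      by (rule exists_point_ge_average[OF Borel_finite[OF Borel_\<mu>] measure_\<mu>_space fin Asets])
    have yX: "y \<in> carrier X" using y(1) Borel_space[OF Borel_\<mu>] by simp
    define F2 where "F2 = {s \<in> F1. \<phi> s y \<in> W}"
    define S' where "S' = {\<sigma> \<in> ?S. z \<sigma> \<cdot> y \<in> D}"
    have "(\<Sum>i\<in>F1 <+> ?S. a i * measure \<mu> (A i)) = (\<Sum>s\<in>F1. 1 / n * v) + (\<Sum>\<sigma>\<in>?S. 8 * real k / real k ^ n *
        measure \<mu> D)"
      using fin1 finS AW AD by (simp add: sum.Plus a_def)
    also have "\<dots> = v + 8 * real k * measure \<mu> D" using n k cardS by (simp add: n_def[symmetric])
    finally have lhs: "(\<Sum>i\<in>F1 <+> ?S. a i * measure \<mu> (A i)) = v + 8 * real k * measure \<mu> D" .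
    have "(\<Sum>i\<in>F1 <+> ?S. a i * indicator (A i) y) =
        (\<Sum>s\<in>F1. a (Inl s) * indicator (A (Inl s)) y) + (\<Sum>\<sigma>\<in>?S. a (Inr \<sigma>) * indicator (A (Inr \<sigma>)) y)"
      by (subst sum.Plus[OF fin1(1) finS]) (simp add: o_def)
    also have "\<dots> = (\<Sum>s\<in>F1. if \<phi> s y \<in> W then 1 / n else 0) +
        (\<Sum>\<sigma>\<in>?S. if z \<sigma> \<cdot> y \<in> D then 8 * real k / real k ^ n else 0)"
    proof (intro arg_cong2[where f = "(+)"] sum.cong refl)
      show "a (Inl s) * indicator (A (Inl s)) y = (if \<phi> s y \<in> W then 1 / n else 0)" for s
        using yX by (simp add: a_def A_def)
      show "a (Inr \<sigma>) * indicator (A (Inr \<sigma>)) y = (if z \<sigma> \<cdot> y \<in> D then 8 * real k / real k ^ n else 0)"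
        if "\<sigma> \<in> ?S" for \<sigma>
        using z(1)[OF that] yX by (simp add: a_def A_def)
    qed
    also have "\<dots> = card F2 / n + 8 * real k * (card S' / real k ^ n)"
      using fin1 finS by (simp add: F2_def S'_def flip: sum.inter_filter)
    finally have main: "v + 8 * real k * measure \<mu> D \<le> card F2 / n + 8 * real k * (card S' / real k ^ n)"
      using y(2) lhs by simp
    have kD: "8 * real k * measure \<mu> D \<ge> 8 * real k - v / 2"
    proof -
      have "8 * real k * (1 - v / (16 * real k)) \<le> 8 * real k * measure \<mu> D"
        using D(2) by (intro mult_left_mono) auto
      moreover have "8 * real k * (1 - v / (16 * real k)) = 8 * real k - v / 2"
        using k by (simp add: field_simps)
      ultimately show ?thesis by simp
    qed
    have kn: "(k :: real) ^ n > 0" using k by simp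
    have "card S' \<le> k ^ n" unfolding cardS[symmetric] S'_def by (intro card_mono finS) auto
    then have "real (card S') \<le> real k ^ n" by (simp flip: of_nat_power)
    then have "card S' / real k ^ n \<le> 1" using kn by (simp add: field_simps)
    then have "8 * real k * (card S' / real k ^ n) \<le> 8 * real k * 1" by (intro mult_left_mono) auto
    then have "v / 2 \<le> card F2 / n" using main kD by linarith
    then have F2: "v / 2 * n \<le> card F2" using n by (simp add: field_simps)
    have fin2: "F2 \<subseteq> F1" "finite F2" using fin1 by (auto simp: F2_def)
    have "0 < v / 2 * n" using v n by simp
    then have F2ne: "F2 \<noteq> {}" using F2 by auto
    have "card F2 \<le> n" unfolding n_def using fin1 fin2 by (intro card_mono)
    then have "card F2 / n \<le> 1" using n by (simp add: field_simps)
    then have "8 * real k - 1 < 8 * real k * (card S' / real k ^ n)" using main kD v by linarith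
    then have S'1: "(1 - 1 / (8 * real k)) * real k ^ n < card S'"
      using kn k by (simp add: field_simps)
    \<comment> \<open>Restricting to the return times before shattering guarantees that y lies in
      \<open>W\<close> at every coordinate that gets shattered.\<close>
    let ?R = "(\<lambda>w. restrict w F2) ` S'"
    have "card S' \<le> card ?R * card {1..k} ^ card (F1 - F2)"
      using fin1(1) fin2(1) by (intro card_le_card_restrict) (auto simp: S'_def)
    then have "real (card S') \<le> real (card ?R) * real k ^ card (F1 - F2)"
      by (simp flip: of_nat_power of_nat_mult)
    moreover have "real k ^ n = real k ^ card F2 * real k ^ card (F1 - F2)"
      using fin1 fin2 card_mono[OF fin1(1) fin2(1)] by (simp add: n_def card_Diff_subset flip: power_add)
    ultimately have "((1 - 1 / (8 * real k)) * real k ^ card F2) * real k ^ card (F1 - F2) < real (card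
        ?R) * real k ^ card (F1 - F2)"
      using S'1 by (simp add: mult.assoc)
    then have R1: "(1 - 1 / (8 * real k)) * real k ^ card F2 < card ?R"
        by (rule mult_right_less_imp_less) simp
    have "(1 - 1 / (4 * card {1..k})) * card {1..k} ^ card F2 \<le> (1 - 1 / (8 * real k)) * real k ^ card F2"
    proof -
      have ck: "card {1..k} = k" by simp
      show ?thesis unfolding ck of_nat_power
        using k by (intro mult_right_mono) (auto simp: field_simps)
    qed
    then have R2: "(1 - 1 / (4 * card {1..k})) * card {1..k} ^ card F2 < card ?R" using R1 by linarith
    have R: "?R \<subseteq> F2 \<rightarrow>\<^sub>E {1..k}" using fin2(1) by (fastforce simp: S'_def)
    obtain J where J: "J \<subseteq> F2" "c2 * card F2 \<le> card J"
      "\<forall>f\<in>J \<rightarrow> {1..k}. \<exists>w\<in>?R. \<forall>s\<in>J. w s = f s"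
      using c2(2)[OF fin2(2) F2ne R R2] by (elim exE conjE) (rule that)
    have JF1: "J \<subseteq> F1" using J(1) fin2(1) by (rule subset_trans)
    have finJ: "finite J" "J \<subseteq> carrier G"
      using finite_subset[OF JF1 fin1(1)] subset_trans[OF JF1 fin1(2)] by simp_all
    have "indep k U D J"
    proof (rule independence_setI[OF finJ])
      show "D \<subseteq> topspace T" using DX by simp
      fix \<sigma> assume "\<sigma> \<in> J \<rightarrow> {1..k}"
      then obtain w where "w \<in> S'" and w: "\<forall>s\<in>J. restrict w F2 s = \<sigma> s" using J(3) by auto
      then have wS: "w \<in> ?S" "z w \<cdot> y \<in> D" by (simp_all add: S'_def)
      have "\<phi> s (z w \<cdot> y) \<in> U (\<sigma> s)" if s: "s \<in> J" for s
      proof -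
        have s': "s \<in> F2" "s \<in> F1" "s \<in> carrier G" using s J(1) JF1 finJ(2) by auto
        then have "w s = \<sigma> s" using w s by auto
        moreover have "w s \<in> {1..k}" using PiE_mem[OF wS(1) s'(2)] .
        ultimately show ?thesis
          using VW[of "\<sigma> s" "\<phi> s (z w)" "\<phi> s y"] z(2)[OF wS(1) s'(2)] s'(1) z(1)[OF wS(1)] yX s'(3)
          by (simp add: \<phi>_mult F2_def)
      qed
      then show "\<exists>z\<in>D. \<forall>s\<in>J. \<phi> s z \<in> U (\<sigma> s)" using wS(2) by (intro bexI[of _ "z w \<cdot> y"] ballI)
    qed
    moreover have "c2 * (v / 2 * c) * card F \<le> card J"
    proof -
      have "v / 2 * (c * card F) \<le> v / 2 * n" using F1(3) v
          by (intro mult_left_mono) (simp_all add: n_def)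
      then have "c2 * (v / 2 * (c * card F)) \<le> c2 * card F2" using F2 c2(1)
          by (intro mult_left_mono) linarith+
      then show ?thesis using J(2) by (simp add: mult.assoc)
    qed
    moreover have "J \<subseteq> F" using JF1 F1(1) by (rule subset_trans)
    ultimately show "\<exists>F'\<subseteq>F. indep k U D F' \<and> c2 * (v / 2 * c) * card F \<le> card F'"
      by (intro exI[of _ J] conjI)
  qed
qed

text \<open>Writing x i as x i \<cdot> 1 splits each neighbourhood into a product of one of x i and
  one of the identity. The relative independence then obtained holds in every nonempty finite set,
  in particular in a term of a Folner sequence.\<close>

lemma measure_IE_tuples_Haar: "measure_IE_tuples G T \<phi> \<mu> k = IE k"
proof (rule antisym[OF measure_IE_tuples_subset[OF Borel_\<mu>]], rule subsetI)
  fix x assume x: "x \<in> IE k"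
  have "\<exists>c \<delta>. c > (0::real) \<and> \<delta> > (0::real) \<and>
           (\<forall>K \<epsilon>. finite K \<and> K \<noteq> {} \<and> K \<subseteq> carrier G \<and> \<epsilon> > (0::real) \<longrightarrow>
             (\<exists>F. finite F \<and> F \<noteq> {} \<and> F \<subseteq> carrier G \<and>
                real (card ((K <#>\<^bsub>G\<^esub> F) - F)) \<le> \<epsilon> * real (card F) \<and>
                (\<forall>D\<in>sets \<mu>. measure \<mu> D \<ge> 1 - \<delta> \<longrightarrow>
                  (\<exists>F'\<subseteq>F. indep k U D F' \<and>
                     real (card F') \<ge> c * real (card F)))))"
    if U: "\<forall>i\<in>{1..k}. openin T (U i) \<and> x i \<in> U i" for U
  proof -
    have "\<exists>c \<delta>. c > (0::real) \<and> \<delta> > (0::real) \<and> (\<forall>F D. finite F \<longrightarrow> F \<noteq> {} \<longrightarrow> F \<subseteq> carrier G \<longrightarrow>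
        D \<in> sets \<mu> \<longrightarrow> measure \<mu> D \<ge> 1 - \<delta> \<longrightarrow>
        (\<exists>F'\<subseteq>F. indep k U D F' \<and> c * real (card F) \<le> real (card F')))"
    proof (cases "k = 0")
      case True
      \<comment> \<open>For k = 0 there is no choice on a nonempty \<open>F\<close>, so
        \<open>F\<close> itself is independent relative to any \<open>D\<close>.\<close>
      have "indep k U D F" if "finite F" "F \<noteq> {}" "F \<subseteq> carrier G" for F D
        using that True by (auto simp: independence_set_def)
      then show ?thesis by (intro exI[of _ 1]) auto
    next
      case False
      have "\<exists>VW. openin T (fst VW) \<and> openin T (snd VW) \<and> x i \<in> fst VW \<and> \<one>\<^bsub>X\<^esub> \<in> snd VW \<and>
          (\<forall>v\<in>fst VW. \<forall>w\<in>snd VW. v \<cdot> w \<in> U i)" if i: "i \<in> {1..k}" for i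
      proof -
        have Ui: "openin T (U i)" "x i \<cdot> \<one>\<^bsub>X\<^esub> \<in> U i" using U i IE_tuples_carrier[OF x i] by auto
        obtain V W where "openin T V" "openin T W" "x i \<in> V" "\<one>\<^bsub>X\<^esub> \<in> W"
          "\<And>v w. v \<in> V \<Longrightarrow> w \<in> W \<Longrightarrow> v \<cdot> w \<in> U i"
          by (rule open_mult_neighbourhoods[OF Ui(1) IE_tuples_carrier[OF x i] X.one_closed Ui(2)]) (rule
              that)
        then show ?thesis by (intro exI[of _ "(V, W)"]) simp
      qed
      then obtain VW where VW: "\<forall>i\<in>{1..k}. openin T (fst (VW i)) \<and> openin T (snd (VW i)) \<and>
          x i \<in> fst (VW i) \<and> \<one>\<^bsub>X\<^esub> \<in> snd (VW i) \<and> (\<forall>v\<in>fst (VW i). \<forall>w\<in>snd (VW i). v \<cdot> w \<in> U i)"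
        by (metis (no_types, lifting))
      have pd: "pos_density k (\<lambda>i. fst (VW i))" by (rule IE_tuples_density[OF x]) (use VW in auto)
      let ?W = "topspace T \<inter> (\<Inter>i\<in>{1..k}. snd (VW i))"
      have W: "openin T ?W" "\<one>\<^bsub>X\<^esub> \<in> ?W" using VW by (auto intro!: openin_INT_finite simp del: topspace_T)
          simp
      have VWU: "\<And>i v w. i \<in> {1..k} \<Longrightarrow> v \<in> fst (VW i) \<Longrightarrow> w \<in> ?W \<Longrightarrow> v \<cdot> w \<in> U i" using VW by auto
      obtain c \<delta> :: real where "c > 0" "\<delta> > 0"
        "\<And>F D. finite F \<Longrightarrow> F \<noteq> {} \<Longrightarrow> F \<subseteq> carrier G \<Longrightarrow> D \<in> sets \<mu> \<Longrightarrow> measure \<mu> D \<ge> 1 - \<delta> \<Longrightarrow>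
          \<exists>F'\<subseteq>F. indep k U D F' \<and> c * real (card F) \<le> real (card F')"
        by (rule independence_relative_to_large_sets[OF _ pd W VWU]) (use False in simp, assumption+, rule
            that)
      then show ?thesis by - (rule exI[of _ c], rule exI[of _ \<delta>], simp)
    qed
    then obtain c \<delta> where "c > (0::real)" "\<delta> > (0::real)" and
      *: "\<And>F D. finite F \<Longrightarrow> F \<noteq> {} \<Longrightarrow> F \<subseteq> carrier G \<Longrightarrow> D \<in> sets \<mu> \<Longrightarrow> measure \<mu> D \<ge> 1 - \<delta> \<Longrightarrow>
        (\<exists>F'\<subseteq>F. indep k U D F' \<and> c * real (card F) \<le> real (card F'))"
      by (elim exE conjE) (rule that, assumption, assumption, simp)
    show ?thesis
    proof (rule exI[of _ c], rule exI[of _ \<delta>], intro conjI allI impI)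
      show "c > 0" "\<delta> > 0" by fact+
      fix K and \<epsilon> :: real assume K: "finite K \<and> K \<noteq> {} \<and> K \<subseteq> carrier G \<and> \<epsilon> > 0"
      obtain Fn where Fn: "left_Folner_sequence G Fn" by (rule Folner_sequence_exists)
      have "\<forall>\<^sub>F n in sequentially. real (card ((K <#>\<^bsub>G\<^esub> Fn n) - Fn n)) \<le> \<epsilon> * card (Fn n)"
        by (rule Folner_eventually_invariant[OF Fn]) (use K in auto)
      then obtain n where n: "real (card ((K <#>\<^bsub>G\<^esub> Fn n) - Fn n)) \<le> \<epsilon> * card (Fn n)"
        using eventually_happens'[OF sequentially_bot] by auto
      have "finite (Fn n)" "Fn n \<noteq> {}" "Fn n \<subseteq> carrier G" using Fn
          by (auto simp: left_Folner_sequence_def)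
      then show "\<exists>F. finite F \<and> F \<noteq> {} \<and> F \<subseteq> carrier G \<and>
                real (card ((K <#>\<^bsub>G\<^esub> F) - F)) \<le> \<epsilon> * real (card F) \<and>
                (\<forall>D\<in>sets \<mu>. measure \<mu> D \<ge> 1 - \<delta> \<longrightarrow>
                  (\<exists>F'\<subseteq>F. indep k U D F' \<and>
                     real (card F') \<ge> c * real (card F)))"
        using n * by - (rule exI[of _ "Fn n"], intro conjI ballI impI, simp_all)
    qed
  qed
  then show "x \<in> measure_IE_tuples G T \<phi> \<mu> k"
    using IE_tuples_PiE[OF x] unfolding measure_IE_tuples_def topspace_T by simp
qed

end

section \<open>Entropy\<close>

context algebraic_action
begin

section \<open>Separated sets and their maximal cardinality\<close>

definition separated :: "('x \<Rightarrow> 'x \<Rightarrow> real) \<Rightarrow> 'g set \<Rightarrow> real \<Rightarrow> 'x set \<Rightarrow> bool" where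
  "separated \<rho> F \<epsilon> Z \<longleftrightarrow> Z \<subseteq> topspace T \<and> finite Z \<and>
     (\<forall>y\<in>Z. \<forall>z\<in>Z. y \<noteq> z \<longrightarrow> Max ((\<lambda>s. \<rho> (\<phi> s y) (\<phi> s z)) ` F) > \<epsilon>)"

lemma separated_number_eq: "separated_number T \<phi> \<rho> F \<epsilon> = Max {card Z |Z. separated \<rho> F \<epsilon> Z}"
  by (simp add: separated_number_def separated_def)

lemma separated_iff:
  assumes "finite F" "F \<noteq> {}"
  shows "separated \<rho> F \<epsilon> Z \<longleftrightarrow> Z \<subseteq> carrier X \<and> finite Z \<and>
     (\<forall>y\<in>Z. \<forall>z\<in>Z. y \<noteq> z \<longrightarrow> (\<exists>s\<in>F. \<rho> (\<phi> s y) (\<phi> s z) > \<epsilon>))"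
  using assms by (simp add: separated_def Max_gr_iff)

lemma finite_open_cover:
  assumes "\<And>x. x \<in> carrier X \<Longrightarrow> openin T (U x)" "\<And>x. x \<in> carrier X \<Longrightarrow> x \<in> U x"
  obtains I where "finite I" "I \<subseteq> carrier X" "carrier X \<subseteq> (\<Union>x\<in>I. U x)"
proof -
  have cov: "topspace T \<subseteq> \<Union>(U ` carrier X)" using assms(2) by auto
  obtain \<F> where \<F>: "finite \<F>" "\<F> \<subseteq> U ` carrier X" "topspace T \<subseteq> \<Union>\<F>"
    using compactinD[OF compact_T[unfolded compact_space_def] _ cov] assms(1) by auto
  from \<F>(1,2) obtain I where "finite I" "I \<subseteq> carrier X" "\<F> = U ` I"
    using finite_subset_image[of \<F> U "carrier X"] by auto
  then show ?thesis using \<F>(3) by (intro that[of I]) auto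
qed

text \<open>Recording, for every s in \<open>F\<close>, the centre of an \<epsilon>/2-ball
  containing \<phi> s z determines z within a separated set. Finiteness is what gives the
  \<open>Max\<close> in \<open>separated_number\<close> its intended meaning.\<close>

lemma separated_bounded:
  assumes \<rho>: "compatible_metric T \<rho>" and F: "finite F" "F \<noteq> {}" "F \<subseteq> carrier G" and \<epsilon>: "\<epsilon> > 0"
  shows "finite {card Z |Z. separated \<rho> F \<epsilon> Z}"
proof -
  interpret Metric_space "carrier X" \<rho> using \<rho> by (simp add: compatible_metric_def)
  have top: "mtopology = T" using \<rho> by (simp add: compatible_metric_def)
  obtain I where I: "finite I" "I \<subseteq> carrier X" "carrier X \<subseteq> (\<Union>x\<in>I. mball x (\<epsilon> / 2))"
    by (rule finite_open_cover[of "\<lambda>x. mball x (\<epsilon> / 2)"]) (use \<epsilon> openin_mball top in auto)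
  have "\<forall>x\<in>carrier X. \<exists>p. p \<in> I \<and> x \<in> mball p (\<epsilon> / 2)" using I(3) by blast
  then obtain b where "\<forall>x\<in>carrier X. b x \<in> I \<and> x \<in> mball (b x) (\<epsilon> / 2)"
    unfolding bchoice_iff by (elim exE) (rule that)
  then have b: "b x \<in> I" "\<rho> (b x) x < \<epsilon> / 2" if "x \<in> carrier X" for x using that by auto
  have bound: "card Z \<le> card I ^ card F" if Z: "separated \<rho> F \<epsilon> Z" for Z
  proof -
    have Z': "Z \<subseteq> carrier X" "finite Z" "\<And>y z. y \<in> Z \<Longrightarrow> z \<in> Z \<Longrightarrow> y \<noteq> z \<Longrightarrow> \<exists>s\<in>F. \<rho> (\<phi> s y) (\<phi> s z) > \<epsilon>"
      using Z F by (simp_all add: separated_iff)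
    let ?f = "\<lambda>z. \<lambda>s\<in>F. b (\<phi> s z)"
    have "inj_on ?f Z"
    proof (rule inj_onI, rule ccontr)
      fix y z assume yz: "y \<in> Z" "z \<in> Z" "?f y = ?f z" "y \<noteq> z"
      obtain s where s: "s \<in> F" "\<rho> (\<phi> s y) (\<phi> s z) > \<epsilon>" using Z'(3)[OF yz(1,2,4)] by blast
      note X = \<phi>_closed[OF subsetD[OF F(3) s(1)] subsetD[OF Z'(1) yz(1)]]
        \<phi>_closed[OF subsetD[OF F(3) s(1)] subsetD[OF Z'(1) yz(2)]]
      have "b (\<phi> s y) = b (\<phi> s z)" using fun_cong[OF yz(3), of s] s(1) by simp
      then have "\<rho> (\<phi> s y) (\<phi> s z) \<le> \<rho> (\<phi> s y) (b (\<phi> s y)) + \<rho> (b (\<phi> s z)) (\<phi> s z)"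
        using triangle[of "\<phi> s y" "b (\<phi> s y)" "\<phi> s z"] X b(1) I(2) by auto
      then show False using s(2) b(2)[OF X(1)] b(2)[OF X(2)] by (simp add: commute)
    qed
    moreover have "?f ` Z \<subseteq> F \<rightarrow>\<^sub>E I"
    proof (rule image_subsetI)
      fix z assume "z \<in> Z"
      then have "b (\<phi> s z) \<in> I" if "s \<in> F" for s using that F(3) Z'(1) by (intro b(1) \<phi>_closed) auto
      then show "?f z \<in> F \<rightarrow>\<^sub>E I" by simp
    qed
    ultimately have "card Z \<le> card (F \<rightarrow>\<^sub>E I)" using F I
        by (intro card_inj_on_le) (auto intro!: finite_PiE)
    then show ?thesis using F by (simp add: card_PiE)
  qed
  show ?thesis by (rule finite_subset[of _ "{..card I ^ card F}"]) (use bound in auto)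
qed

lemma card_le_separated_number:
  assumes "compatible_metric T \<rho>" "finite F" "F \<noteq> {}" "F \<subseteq> carrier G" "\<epsilon> > 0" "separated \<rho> F \<epsilon> Z"
  shows "card Z \<le> separated_number T \<phi> \<rho> F \<epsilon>"
  unfolding separated_number_eq using separated_bounded[OF assms(1-5)] assms(6) by (intro Max_ge) auto

lemma separated_number_attained:
  assumes "compatible_metric T \<rho>" "finite F" "F \<noteq> {}" "F \<subseteq> carrier G" "\<epsilon> > 0"
  obtains Z where "separated \<rho> F \<epsilon> Z" "card Z = separated_number T \<phi> \<rho> F \<epsilon>"
proof -
  have "separated \<rho> F \<epsilon> {}" by (simp add: separated_def)
  then have "Max {card Z |Z. separated \<rho> F \<epsilon> Z} \<in> {card Z |Z. separated \<rho> F \<epsilon> Z}"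
    using separated_bounded[OF assms] by (intro Max_in) auto
  then show ?thesis using that by (auto simp: separated_number_eq)
qed

text \<open>An independence set \<open>J\<close> for two balls around x and the identity supplies
  2^|J| witnesses, and two of them are far apart at any time where their choices differ. The entropy
  is thus at least c ln 2.\<close>

lemma entropy_pos_if_IE_pair:
  assumes \<rho>: "compatible_metric T \<rho>" and Fn: "left_Folner_sequence G Fn"
    and x: "x \<in> IE_grp" "x \<noteq> \<one>\<^bsub>X\<^esub>"
  shows "topological_entropy T \<phi> \<rho> Fn > 0"
proof -
  interpret Metric_space "carrier X" \<rho> using \<rho> by (simp add: compatible_metric_def)
  have top: "mtopology = T" using \<rho> by (simp add: compatible_metric_def)
  have xX: "x \<in> carrier X" and xp: "pair_tuple x \<one>\<^bsub>X\<^esub> \<in> IE 2" using x(1) by (simp_all add: IE_group_eq)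
  \<comment> \<open>With a third of the distance, points of the two balls are more than r
    apart.\<close>
  define r where "r = \<rho> x \<one>\<^bsub>X\<^esub> / 3"
  have r: "r > 0" using mdist_pos_less[OF x(2) xX X.one_closed] by (simp add: r_def)
  let ?U = "mball x r" and ?V = "mball \<one>\<^bsub>X\<^esub> r"
  have far: "\<rho> a b > r" if a: "a \<in> ?U" and b: "b \<in> ?V" for a b
  proof -
    have "\<rho> x \<one>\<^bsub>X\<^esub> \<le> \<rho> x a + \<rho> a \<one>\<^bsub>X\<^esub>" "\<rho> a \<one>\<^bsub>X\<^esub> \<le> \<rho> a b + \<rho> b \<one>\<^bsub>X\<^esub>"
      using triangle[of x a "\<one>\<^bsub>X\<^esub>"] triangle[of a b "\<one>\<^bsub>X\<^esub>"] a b by auto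
    moreover have "\<rho> x a < r" "\<rho> b \<one>\<^bsub>X\<^esub> < r" using a b commute[of b "\<one>\<^bsub>X\<^esub>"] by auto
    ultimately show ?thesis using r_def by linarith
  qed
  have "pos_density 2 (set_pair ?U ?V)"
    using xp[unfolded pair_tuple_IE_iff[OF xX X.one_closed]] openin_mball[of x r] openin_mball[of "\<one>\<^bsub>X\<^esub>"
        r] xX r
    unfolding top by simp
  then obtain c :: real where c: "c > 0" "\<And>F. finite F \<Longrightarrow> F \<subseteq> carrier G \<Longrightarrow>
     \<exists>F'\<subseteq>F. indep 2 (set_pair ?U ?V) (topspace T) F' \<and> c * real (card F) \<le> real (card F')"
    by (rule positive_densityE) (rule that)
  have bound: "c * ln 2 \<le> ln (real (separated_number T \<phi> \<rho> (Fn n) r)) / real (card (Fn n))" for n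
  proof -
    have F: "finite (Fn n)" "Fn n \<noteq> {}" "Fn n \<subseteq> carrier G" using Fn
        by (auto simp: left_Folner_sequence_def)
    obtain J where J: "J \<subseteq> Fn n" "indep 2 (set_pair ?U ?V) (topspace T) J" "c * card (Fn n) \<le> card J"
      using c(2)[OF F(1,3)] by (elim exE conjE) (rule that)
    have finJ: "finite J" using J(2) by (simp add: independence_set_def)
    let ?S = "J \<rightarrow>\<^sub>E {1..2::nat}"
    have "\<forall>\<sigma>\<in>?S. \<exists>z. z \<in> carrier X \<and> (\<forall>s\<in>J. \<phi> s z \<in> set_pair ?U ?V (\<sigma> s))"
    proof
      fix \<sigma> assume "\<sigma> \<in> ?S"
      then have \<sigma>: "\<sigma> \<in> J \<rightarrow> {1..2}" by auto
      obtain z where "z \<in> topspace T" "\<And>s. s \<in> J \<Longrightarrow> \<phi> s z \<in> set_pair ?U ?V (\<sigma> s)"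
        by (rule independence_setE[OF J(2) \<sigma>]) (rule that)
      then show "\<exists>z. z \<in> carrier X \<and> (\<forall>s\<in>J. \<phi> s z \<in> set_pair ?U ?V (\<sigma> s))" by (intro exI[of _ z]) simp
    qed
    then obtain z where "\<forall>\<sigma>\<in>?S. z \<sigma> \<in> carrier X \<and> (\<forall>s\<in>J. \<phi> s (z \<sigma>) \<in> set_pair ?U ?V (\<sigma> s))"
      unfolding bchoice_iff by (elim exE) (rule that)
    then have z: "\<And>\<sigma>. \<sigma> \<in> ?S \<Longrightarrow> z \<sigma> \<in> carrier X"
      "\<And>\<sigma> s. \<sigma> \<in> ?S \<Longrightarrow> s \<in> J \<Longrightarrow> \<phi> s (z \<sigma>) \<in> set_pair ?U ?V (\<sigma> s)" by simp_all
    have sep: "\<exists>s\<in>J. \<rho> (\<phi> s (z \<sigma>)) (\<phi> s (z \<tau>)) > r" if \<sigma>\<tau>: "\<sigma> \<in> ?S" "\<tau> \<in> ?S" "\<sigma> \<noteq> \<tau>" for \<sigma> \<tau>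
    proof -
      obtain s where s: "s \<in> J" "\<sigma> s \<noteq> \<tau> s" using PiE_ext[OF \<sigma>\<tau>(1,2)] \<sigma>\<tau>(3) by auto
      have "\<sigma> s \<in> {1..2}" "\<tau> s \<in> {1..2}" using PiE_mem[OF \<sigma>\<tau>(1) s(1)] PiE_mem[OF \<sigma>\<tau>(2) s(1)] by auto
      then have "(\<sigma> s = 1 \<and> \<tau> s \<noteq> 1) \<or> (\<sigma> s \<noteq> 1 \<and> \<tau> s = 1)" using s(2) by auto
      then show ?thesis
      proof
        assume "\<sigma> s = 1 \<and> \<tau> s \<noteq> 1"
        then show ?thesis
          using far[of "\<phi> s (z \<sigma>)" "\<phi> s (z \<tau>)"] z(2)[OF \<sigma>\<tau>(1) s(1)] z(2)[OF \<sigma>\<tau>(2) s(1)] s(1)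
          unfolding set_pair_def by (intro bexI[of _ s]) simp_all
      next
        assume "\<sigma> s \<noteq> 1 \<and> \<tau> s = 1"
        then show ?thesis
          using far[of "\<phi> s (z \<tau>)" "\<phi> s (z \<sigma>)"] z(2)[OF \<sigma>\<tau>(1) s(1)] z(2)[OF \<sigma>\<tau>(2) s(1)] s(1)
          unfolding set_pair_def by (intro bexI[of _ s]) (simp_all add: commute)
      qed
    qed
    have inj: "inj_on z ?S"
    proof (rule inj_onI, rule ccontr)
      fix \<sigma> \<tau> assume \<sigma>\<tau>: "\<sigma> \<in> ?S" "\<tau> \<in> ?S" "z \<sigma> = z \<tau>" "\<sigma> \<noteq> \<tau>"
      obtain s where s: "s \<in> J" "\<rho> (\<phi> s (z \<sigma>)) (\<phi> s (z \<tau>)) > r" using sep[OF \<sigma>\<tau>(1,2,4)] by blast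
      have "\<phi> s (z \<sigma>) \<in> carrier X" using s(1) J(1) F(3) z(1)[OF \<sigma>\<tau>(1)] by auto
      then show False using s(2) \<sigma>\<tau>(3) r by simp
    qed
    have "separated \<rho> (Fn n) r (z ` ?S)"
      unfolding separated_iff[OF F(1,2)]
    proof (intro conjI ballI impI)
      show "z ` ?S \<subseteq> carrier X" using z(1) by auto
      show "finite (z ` ?S)" using finJ by (intro finite_imageI finite_PiE) auto
      fix u v assume "u \<in> z ` ?S" "v \<in> z ` ?S" "u \<noteq> v"
      then obtain \<sigma> \<tau> where "\<sigma> \<in> ?S" "\<tau> \<in> ?S" "\<sigma> \<noteq> \<tau>" "u = z \<sigma>" "v = z \<tau>" by auto
      then show "\<exists>s\<in>Fn n. r < \<rho> (\<phi> s u) (\<phi> s v)" using sep[of \<sigma> \<tau>] J(1) by auto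
    qed
    then have "card (z ` ?S) \<le> separated_number T \<phi> \<rho> (Fn n) r"
      by (rule card_le_separated_number[OF \<rho> F r])
    then have "2 ^ card J \<le> separated_number T \<phi> \<rho> (Fn n) r"
      unfolding card_image[OF inj] using finJ by (simp add: card_PiE)
    then have "(2::real) ^ card J \<le> real (separated_number T \<phi> \<rho> (Fn n) r)"
      by (metis of_nat_le_iff of_nat_numeral of_nat_power)
    then have "ln ((2::real) ^ card J) \<le> ln (real (separated_number T \<phi> \<rho> (Fn n) r))"
      by (subst ln_le_cancel_iff) (auto intro: less_le_trans[of 0 "2 ^ card J"])
    then have "card J * ln 2 \<le> ln (real (separated_number T \<phi> \<rho> (Fn n) r))" by (simp add: ln_realpow)
    moreover have "c * card (Fn n) * ln 2 \<le> card J * ln 2" using J(3) by (rule mult_right_mono) simp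
    moreover have "c * ln 2 * card (Fn n) = c * card (Fn n) * ln 2" by simp
    ultimately have "c * ln 2 * card (Fn n) \<le> ln (real (separated_number T \<phi> \<rho> (Fn n) r))" by linarith
    moreover have "real (card (Fn n)) > 0" using F by (simp add: card_gt_0_iff)
    ultimately show ?thesis by (simp only: pos_le_divide_eq)
  qed
  have "ereal 0 < ereal (c * ln 2)" using c(1) by simp
  also have "ereal (c * ln 2) \<le> limsup (\<lambda>n. ereal (ln (real (separated_number T \<phi> \<rho> (Fn n) r)) / real
      (card (Fn n))))"
    using bound by (intro le_Limsup) auto
  also have "\<dots> \<le> topological_entropy T \<phi> \<rho> Fn"
    unfolding topological_entropy_def using r by (intro SUP_upper) simp
  finally show ?thesis by (simp add: zero_ereal_def)
qed

text \<open>The metric need not be invariant under translations, so the tube lemma along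
  \<open>{x}\<close> times X supplies uniformity in g. It serves to undo the random right
  translation: multiplying \<phi> s (z \<cdot> y) by the inverse of \<phi> s y gives back \<phi> s
  z.\<close>

lemma right_translation_small_cover:
  assumes \<rho>: "compatible_metric T \<rho>" and \<epsilon>: "\<epsilon> > 0"
  obtains U and m :: nat where "\<And>j. j < m \<Longrightarrow> openin T (U j)" "carrier X \<subseteq> (\<Union>j<m. U j)"
    "\<And>j a b g. j < m \<Longrightarrow> a \<in> U j \<Longrightarrow> b \<in> U j \<Longrightarrow> g \<in> carrier X \<Longrightarrow> \<rho> (a \<cdot> g) (b \<cdot> g) \<le> \<epsilon>"
proof -
  interpret Metric_space "carrier X" \<rho> using \<rho> by (simp add: compatible_metric_def)
  have top: "mtopology = T" using \<rho> by (simp add: compatible_metric_def)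
  have "\<forall>x\<in>carrier X. \<exists>U. openin T U \<and> x \<in> U \<and> (\<forall>a\<in>U. \<forall>g\<in>carrier X. \<rho> (a \<cdot> g) (x \<cdot> g) < \<epsilon> / 2)"
  proof
    fix x assume x: "x \<in> carrier X"
    let ?P = "prod_topology T T"
    let ?W = "{p \<in> topspace ?P. \<rho> (fst p \<cdot> snd p) (x \<cdot> snd p) \<in> {..<\<epsilon> / 2}}"
    have "continuous_map ?P (mtopology_of (metric (carrier X, \<rho>))) (\<lambda>p. fst p \<cdot> snd p)"
      "continuous_map ?P (mtopology_of (metric (carrier X, \<rho>))) (\<lambda>p. x \<cdot> snd p)"
      unfolding mtopology_of top using x
      by (intro continuous_mult continuous_map_fst continuous_map_snd; simp)+
    from continuous_map_mdist[OF this]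
    have "continuous_map ?P euclidean (\<lambda>p. \<rho> (fst p \<cdot> snd p) (x \<cdot> snd p))" by simp
    then have W: "openin ?P ?W" by (rule openin_continuous_map_preimage) simp
    have sub: "{x} \<times> carrier X \<subseteq> ?W" using x \<epsilon> by auto
    have xT: "x \<in> topspace T" using x by simp
    have cT: "compactin T (carrier X)" using compact_T by (simp add: compact_space_def)
    obtain U V where UV: "openin T U" "x \<in> U" "carrier X \<subseteq> V" "U \<times> V \<subseteq> ?W"
      using tube_lemma_right[OF W cT xT sub] by (elim exE conjE) (rule that)
    have "\<rho> (a \<cdot> g) (x \<cdot> g) < \<epsilon> / 2" if "a \<in> U" "g \<in> carrier X" for a g
      using subsetD[OF UV(4), of "(a, g)"] UV(3) that by auto
    then show "\<exists>U. openin T U \<and> x \<in> U \<and> (\<forall>a\<in>U. \<forall>g\<in>carrier X. \<rho> (a \<cdot> g) (x \<cdot> g) < \<epsilon> / 2)"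
      using UV(1,2) by (intro exI[of _ U]) simp
  qed
  then obtain U where "\<forall>x\<in>carrier X. openin T (U x) \<and> x \<in> U x \<and>
      (\<forall>a\<in>U x. \<forall>g\<in>carrier X. \<rho> (a \<cdot> g) (x \<cdot> g) < \<epsilon> / 2)"
    unfolding bchoice_iff by (elim exE) (rule that)
  then have U: "openin T (U x)" "x \<in> U x" "\<And>a g. a \<in> U x \<Longrightarrow> g \<in> carrier X \<Longrightarrow> \<rho> (a \<cdot> g) (x \<cdot> g) < \<epsilon> / 2"
    if "x \<in> carrier X" for x using that by simp_all
  obtain I where I: "finite I" "I \<subseteq> carrier X" "carrier X \<subseteq> (\<Union>x\<in>I. U x)"
    by (rule finite_open_cover[of U]) (use U in auto)
  obtain e where e: "bij_betw e {0..<card I} I" using ex_bij_betw_nat_finite[OF I(1)] by blast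
  have eI: "e j \<in> carrier X" if "j < card I" for j using bij_betwE[OF e] that I(2) by auto
  show ?thesis
  proof (rule that[of "card I" "\<lambda>j. U (e j)"])
    show "openin T (U (e j))" if "j < card I" for j using U(1)[OF eI[OF that]] .
    have img: "e ` {..<card I} = I" using e by (simp add: bij_betw_def atLeast0LessThan)
    have "(\<Union>j<card I. U (e j)) = (\<Union>x\<in>e ` {..<card I}. U x)" by simp
    then show "carrier X \<subseteq> (\<Union>j<card I. U (e j))" using I(3) by (simp only: img)
    show "\<rho> (a \<cdot> g) (b \<cdot> g) \<le> \<epsilon>"
      if j: "j < card I" and ab: "a \<in> U (e j)" "b \<in> U (e j)" and g: "g \<in> carrier X" for j a b g
    proof -
      have "a \<in> carrier X" "b \<in> carrier X" using ab openin_subset[OF U(1)[OF eI[OF j]]] by auto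
      then have "\<rho> (a \<cdot> g) (b \<cdot> g) \<le> \<rho> (a \<cdot> g) (e j \<cdot> g) + \<rho> (e j \<cdot> g) (b \<cdot> g)"
        using g eI[OF j] by (intro triangle) auto
      then show ?thesis
        using U(3)[OF eI[OF j] ab(1) g] U(3)[OF eI[OF j] ab(2) g] commute[of "b \<cdot> g"
            "e j \<cdot> g"] by linarith
    qed
  qed
qed

end

context algebraic_action_Haar
begin

text \<open>In a metrizable space the open set is an increasing union of closed sets; intersected
  with \<open>C\<close> they exhaust the set in measure.\<close>

lemma open_inner_closed:
  assumes P: "openin T U" "closedin T C" and \<eta>: "\<eta> > 0"
  obtains Q where "closedin T Q" "Q \<subseteq> U \<inter> C" "measure \<mu> (U \<inter> C - Q) < \<eta>"
proof -
  interpret finite_measure \<mu> by (rule Borel_finite[OF Borel_\<mu>])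
  have "fsigma_in T U" by (rule open_imp_fsigma_in[OF metrizable_T P(1)])
  then obtain A where "(\<forall>n::nat. closedin T (A n)) \<and> (\<forall>n. A n \<subseteq> A (Suc n)) \<and> \<Union>(range A) = U"
    unfolding fsigma_in_ascending by (elim exE) (rule that)
  then have A: "\<And>n. closedin T (A n)" "\<And>n. A n \<subseteq> A (Suc n)" "\<Union>(range A) = U" by simp_all
  let ?B = "\<lambda>n. A n \<inter> C"
  have clB: "closedin T (?B n)" for n using A(1) P(2) by (rule closedin_Int)
  then have B: "?B n \<in> sets \<mu>" for n by (rule Borel_sets_closed[OF Borel_\<mu>])
  have un: "(\<Union>n. ?B n) = U \<inter> C" using A(3) by auto
  have UC: "U \<inter> C \<in> sets \<mu>"
    using Borel_sets_open[OF Borel_\<mu> P(1)] Borel_sets_closed[OF Borel_\<mu> P(2)] by (rule sets.Int)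
  have "incseq ?B" using A(2) by (intro incseq_SucI) auto
  then have "(\<lambda>n. measure \<mu> (?B n)) \<longlonglongrightarrow> measure \<mu> (\<Union>n. ?B n)"
    using B by (intro finite_Lim_measure_incseq) auto
  then have "\<forall>\<^sub>F n in sequentially. measure \<mu> (U \<inter> C) - \<eta> < measure \<mu> (?B n)"
    unfolding un using \<eta> by (intro order_tendstoD(1)) auto
  then obtain n where n: "measure \<mu> (U \<inter> C) - \<eta> < measure \<mu> (?B n)"
    using eventually_happens'[OF sequentially_bot] by auto
  have sub: "?B n \<subseteq> U \<inter> C" using un by blast
  have "measure \<mu> (U \<inter> C - ?B n) = measure \<mu> (U \<inter> C) - measure \<mu> (?B n)"
    by (rule finite_measure_Diff[OF UC B sub])
  then show ?thesis using n by (intro that[OF clB[of n] sub]) simp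
qed

text \<open>The cores \<open>Q\<close> are promised for every \<eta> after \<open>m\<close> and
  \<open>idx\<close> are fixed, because the admissible \<eta> will depend on the size of the
  alphabet.\<close>

lemma small_partition:
  assumes \<rho>: "compatible_metric T \<rho>" and \<epsilon>: "\<epsilon> > 0"
  obtains m :: nat and idx :: "'x \<Rightarrow> nat" where "\<And>x. x \<in> carrier X \<Longrightarrow> idx x < m"
    "\<And>a b g. a \<in> carrier X \<Longrightarrow> b \<in> carrier X \<Longrightarrow> g \<in> carrier X \<Longrightarrow> idx a = idx b \<Longrightarrow>
       \<rho> (a \<cdot> g) (b \<cdot> g) \<le> \<epsilon>"
    "\<And>\<eta>. \<eta> > 0 \<Longrightarrow> \<exists>Q. (\<forall>j<m. closedin T (Q j) \<and> Q j \<subseteq> {x \<in> carrier X. idx x = j}) \<and>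
       {x \<in> carrier X. x \<notin> Q (idx x)} \<in> sets \<mu> \<and> measure \<mu> {x \<in> carrier X. x \<notin> Q (idx x)} \<le> \<eta>"
proof -
  interpret finite_measure \<mu> by (rule Borel_finite[OF Borel_\<mu>])
  obtain U and m :: nat where U: "\<And>j. j < m \<Longrightarrow> openin T (U j)" "carrier X \<subseteq> (\<Union>j<m. U j)"
    "\<And>j a b g. j < m \<Longrightarrow> a \<in> U j \<Longrightarrow> b \<in> U j \<Longrightarrow> g \<in> carrier X \<Longrightarrow> \<rho> (a \<cdot> g) (b \<cdot> g) \<le> \<epsilon>"
    by (rule right_translation_small_cover[OF \<rho> \<epsilon>]) (rule that)
  \<comment> \<open>The least index makes each atom the intersection of an open set with a closed
    one, which has closed inner approximations.\<close>
  define idx where "idx x = (LEAST j. x \<in> U j)" for x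
  have idx: "idx x < m" "x \<in> U (idx x)" if x: "x \<in> carrier X" for x
  proof -
    obtain j where j: "j < m" "x \<in> U j" using subsetD[OF U(2) x] by auto
    show "x \<in> U (idx x)" unfolding idx_def by (rule LeastI[of "\<lambda>j. x \<in> U j"]) (rule j(2))
    show "idx x < m" unfolding idx_def using Least_le[of "\<lambda>j. x \<in> U j" j] j by simp
  qed
  let ?C = "\<lambda>j. topspace T - (\<Union>i<j. U i)"
  have P_eq: "{x \<in> carrier X. idx x = j} = U j \<inter> ?C j" if j: "j < m" for j
  proof (intro equalityI subsetI)
    fix x assume "x \<in> {x \<in> carrier X. idx x = j}"
    then have x: "x \<in> carrier X" "idx x = j" by simp_all
    have "x \<notin> U i" if "i < j" for i using not_less_Least[of i "\<lambda>j. x \<in> U j"] that x(2)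
        by (simp add: idx_def)
    then show "x \<in> U j \<inter> ?C j" using x idx(2)[OF x(1)] by auto
  next
    fix x assume x: "x \<in> U j \<inter> ?C j"
    have "(LEAST j. x \<in> U j) = j" using x by (intro Least_equality) (auto simp: not_less[symmetric])
    then show "x \<in> {x \<in> carrier X. idx x = j}" using x by (simp add: idx_def)
  qed
  have clC: "closedin T (?C j)" if "j < m" for j
    using U(1) that by (intro closedin_diff closedin_topspace openin_Union) auto
  show ?thesis
  proof (rule that[of idx m])
    show "idx x < m" if "x \<in> carrier X" for x using idx(1)[OF that] .
    show "\<rho> (a \<cdot> g) (b \<cdot> g) \<le> \<epsilon>"
      if "a \<in> carrier X" "b \<in> carrier X" "g \<in> carrier X" "idx a = idx b" for a b g
      using U(3)[OF idx(1)[OF that(1)] idx(2)[OF that(1)] _ that(3)] idx(2)[OF that(2)] that(4) by simp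
    fix \<eta> :: real assume \<eta>: "\<eta> > 0"
    have m: "m > 0" using idx(1)[OF X.one_closed] by simp
    have "\<forall>j\<in>{..<m}. \<exists>Q. closedin T Q \<and> Q \<subseteq> U j \<inter> ?C j \<and> measure \<mu> (U j \<inter> ?C j - Q) < \<eta> / m"
    proof
      fix j assume "j \<in> {..<m}"
      then have j: "j < m" by simp
      have "\<eta> / m > 0" using \<eta> m by simp
      then obtain Q where "closedin T Q" "Q \<subseteq> U j \<inter> ?C j" "measure \<mu> (U j \<inter> ?C j - Q) < \<eta> / m"
        by (rule open_inner_closed[OF U(1)[OF j] clC[OF j]]) (rule that)
      then show "\<exists>Q. closedin T Q \<and> Q \<subseteq> U j \<inter> ?C j \<and> measure \<mu> (U j \<inter> ?C j - Q) < \<eta> / m"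
        by (intro exI[of _ Q] conjI)
    qed
    then obtain Q where "\<forall>j\<in>{..<m}. closedin T (Q j) \<and> Q j \<subseteq> U j \<inter> ?C j
        \<and> measure \<mu> (U j \<inter> ?C j - Q j) < \<eta> / m"
      unfolding bchoice_iff by (elim exE) (rule that)
    then have Q: "closedin T (Q j)" "Q j \<subseteq> {x \<in> carrier X. idx x = j}"
      "measure \<mu> ({x \<in> carrier X. idx x = j} - Q j) < \<eta> / m" if "j < m" for j
      using that P_eq[OF that] by simp_all
    let ?B = "{x \<in> carrier X. x \<notin> Q (idx x)}" and ?D = "\<lambda>j. {x \<in> carrier X. idx x = j} - Q j"
    have B_eq: "?B = (\<Union>j<m. ?D j)"
    proof (intro equalityI subsetI)
      fix x assume "x \<in> ?B"
      then show "x \<in> (\<Union>j<m. ?D j)" using idx(1)[of x] by (intro UN_I[of "idx x"]) auto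
    qed auto
    have D: "?D j \<in> sets \<mu>" if "j < m" for j
      unfolding P_eq[OF that]
      by (intro sets.Diff[OF sets.Int] Borel_sets_open[OF Borel_\<mu> U(1)[OF that]]
        Borel_sets_closed[OF Borel_\<mu> clC[OF that]] Borel_sets_closed[OF Borel_\<mu> Q(1)[OF that]])
    have "?B \<in> sets \<mu>" unfolding B_eq using D by (intro sets.finite_UN) auto
    moreover have "measure \<mu> ?B \<le> (\<Sum>j<m. measure \<mu> (?D j))"
      unfolding B_eq using D by (intro finite_measure_subadditive_finite) auto
    moreover have "(\<Sum>j<m. measure \<mu> (?D j)) \<le> (\<Sum>j<m. \<eta> / m)"
      using Q(3) by (intro sum_mono) (auto intro: less_imp_le)
    moreover have "(\<Sum>j<m. \<eta> / m) = \<eta>" using m by simp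
    ultimately show "\<exists>Q. (\<forall>j<m. closedin T (Q j) \<and> Q j \<subseteq> {x \<in> carrier X. idx x = j}) \<and>
       {x \<in> carrier X. x \<notin> Q (idx x)} \<in> sets \<mu> \<and> measure \<mu> {x \<in> carrier X. x \<notin> Q (idx x)} \<le> \<eta>"
      using Q(1,2) by (intro exI[of _ Q]) simp
  qed
qed

text \<open>A Haar random right translate moves few points of the orbits of a separated set outside the
  cores, so exponentially many of the names avoid the letters that mark such points.\<close>

lemma independent_cores:
  fixes c :: real
  assumes \<rho>: "compatible_metric T \<rho>" and \<epsilon>: "\<epsilon> > 0" and c: "c > 0"
  obtains m :: nat and Q :: "nat \<Rightarrow> 'x set" and c' :: real
  where "c' > 0" "\<And>j. j < m \<Longrightarrow> closedin T (Q j)" "\<And>i j. i < m \<Longrightarrow> j < m \<Longrightarrow> i \<noteq> j \<Longrightarrow> Q i \<inter> Q j = {}"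
    "\<And>F Z. finite F \<Longrightarrow> F \<noteq> {} \<Longrightarrow> F \<subseteq> carrier G \<Longrightarrow> separated \<rho> F \<epsilon> Z \<Longrightarrow> exp (c * card F) \<le> card Z \<Longrightarrow>
      \<exists>i<m. \<exists>j<m. i \<noteq> j \<and> (\<exists>J\<subseteq>F. indep 2 (set_pair (Q i) (Q j)) (topspace T) J \<and>
        c' * real (card F) \<le> real (card J))"
proof -
  obtain m :: nat and idx :: "'x \<Rightarrow> nat" where idx: "\<And>x. x \<in> carrier X \<Longrightarrow> idx x < m"
    and small: "\<And>a b g. a \<in> carrier X \<Longrightarrow> b \<in> carrier X \<Longrightarrow> g \<in> carrier X \<Longrightarrow> idx a = idx b \<Longrightarrow>
       \<rho> (a \<cdot> g) (b \<cdot> g) \<le> \<epsilon>"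
    and cores: "\<And>\<eta>. \<eta> > 0 \<Longrightarrow> \<exists>Q. (\<forall>j<m. closedin T (Q j) \<and> Q j \<subseteq> {x \<in> carrier X. idx x = j}) \<and>
       {x \<in> carrier X. x \<notin> Q (idx x)} \<in> sets \<mu> \<and> measure \<mu> {x \<in> carrier X. x \<notin> Q (idx x)} \<le> \<eta>"
    by (rule small_partition[OF \<rho> \<epsilon>]) (rule that)
  \<comment> \<open>A letter is an atom together with a flag marking the times outside the core. The
    flag is part of the letter because the set of bad times varies from point to point and cannot be
    deleted from \<open>F\<close>.\<close>
  define L where "L = {..<m} \<times> (UNIV :: bool set)"
  have L: "finite L" "c / 2 > 0" using c by (auto simp: L_def)
  obtain c' :: real where c': "0 < c'"
    "\<And>(F :: 'g set) S. finite F \<Longrightarrow> F \<noteq> {} \<Longrightarrow> S \<subseteq> F \<rightarrow>\<^sub>E L \<Longrightarrow> exp (c / 2 * card F) \<le> card S \<Longrightarrow>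
      \<exists>a\<in>L. \<exists>b\<in>L. a \<noteq> b \<and> (\<exists>J\<subseteq>F. c' * card F \<le> card J \<and>
        (\<forall>f\<in>J \<rightarrow> {a, b}. \<exists>w\<in>S. \<forall>s\<in>J. w s = f s))"
    by (rule constant_pair_shattered[OF L, where 'a = 'g]) (rule that)
  \<comment> \<open>By Markov's inequality at most the fraction \<eta> / (c'/2) = \<theta> of the
    points of \<open>Z\<close> has more than c' n / 2 bad times. At least exp(-c/2) exp(c n) points
    remain, which is at least exp(c n / 2) as n >= 1.\<close>
  define \<theta> where "\<theta> = 1 - exp (- c / 2)"
  have \<theta>: "\<theta> > 0" using c by (simp add: \<theta>_def)
  define \<eta> where "\<eta> = c' / 2 * \<theta>"
  have \<eta>: "\<eta> > 0" using c'(1) \<theta> by (simp add: \<eta>_def)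
  obtain Q where "(\<forall>j<m. closedin T (Q j) \<and> Q j \<subseteq> {x \<in> carrier X. idx x = j}) \<and>
       {x \<in> carrier X. x \<notin> Q (idx x)} \<in> sets \<mu> \<and> measure \<mu> {x \<in> carrier X. x \<notin> Q (idx x)} \<le> \<eta>"
    using cores[OF \<eta>] by (elim exE) (rule that)
  then have Q: "\<And>j. j < m \<Longrightarrow> closedin T (Q j)" "\<And>j. j < m \<Longrightarrow> Q j \<subseteq> {x \<in> carrier X. idx x = j}"
    and Bad: "{x \<in> carrier X. x \<notin> Q (idx x)} \<in> sets \<mu>" "measure \<mu> {x \<in> carrier X. x \<notin> Q (idx x)} \<le> \<eta>"
    by simp_all
  define Bad where "Bad = {x \<in> carrier X. x \<notin> Q (idx x)}"
  note Bad = Bad[folded Bad_def]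
  show ?thesis
  proof (rule that[OF c'(1) Q(1)])
    show "Q i \<inter> Q j = {}" if "i < m" "j < m" "i \<noteq> j" for i j
      using Q(2)[OF that(1)] Q(2)[OF that(2)] that(3) by auto
    fix F Z assume F: "finite F" "F \<noteq> {}" "F \<subseteq> carrier G" and sep: "separated \<rho> F \<epsilon> Z"
        and big: "exp (c * card F) \<le> card Z"
    have Z: "Z \<subseteq> carrier X" "finite Z" "\<And>y z. y \<in> Z \<Longrightarrow> z \<in> Z \<Longrightarrow> y \<noteq> z \<Longrightarrow> \<exists>s\<in>F. \<rho> (\<phi> s y) (\<phi> s z) > \<epsilon>"
      using sep F by (simp_all add: separated_iff)
    define n where "n = card F"
    have n: "n \<ge> 1" using F by (simp add: n_def Suc_le_eq card_gt_0_iff)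
    define A where "A p = {y \<in> carrier X. \<phi> (snd p) (fst p \<cdot> y) \<in> Bad}" for p
    have A: "A p \<in> sets \<mu>" "measure \<mu> (A p) = measure \<mu> Bad" if "p \<in> Z \<times> F" for p
    proof -
      have "snd p \<in> carrier G" "fst p \<in> carrier X" using that Z(1) F(3) by auto
      then show "A p \<in> sets \<mu>" "measure \<mu> (A p) = measure \<mu> Bad"
        unfolding A_def by (rule Haar_measure_translate[OF Haar _ _ Bad(1)])+
    qed
    have finZF: "finite (Z \<times> F)" using Z(2) F(1) by simp
    \<comment> \<open>The weights -1 select a y whose number of bad pairs of a point and a time is
      at most the average.\<close>
    obtain y where y: "y \<in> space \<mu>"
      "(\<Sum>p\<in>Z \<times> F. - 1 * measure \<mu> (A p)) \<le> (\<Sum>p\<in>Z \<times> F. - 1 * indicator (A p) y)"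
      by (rule exists_point_ge_average[OF Borel_finite[OF Borel_\<mu>] measure_\<mu>_space finZF A(1)])
    have yX: "y \<in> carrier X" using y(1) Borel_space[OF Borel_\<mu>] by simp
    define bad where "bad z = {s \<in> F. \<phi> s (z \<cdot> y) \<in> Bad}" for z
    have "(\<Sum>p\<in>Z \<times> F. indicator (A p) y) = (\<Sum>z\<in>Z. \<Sum>s\<in>F. indicator (A (z, s)) y :: real)"
      by (simp add: sum.cartesian_product)
    also have "\<dots> = (\<Sum>z\<in>Z. real (card (bad z)))"
    proof (rule sum.cong[OF refl])
      fix z
      have "(\<Sum>s\<in>F. indicator (A (z, s)) y :: real) = (\<Sum>s\<in>F. if \<phi> s (z \<cdot> y) \<in> Bad then 1 else 0)"
        using yX by (intro sum.cong) (auto simp: A_def)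
      then show "(\<Sum>s\<in>F. indicator (A (z, s)) y :: real) = real (card (bad z))"
        using F(1) by (simp add: bad_def Int_def flip: sum.inter_filter)
    qed
    finally have "(\<Sum>z\<in>Z. real (card (bad z))) \<le> (\<Sum>p\<in>Z \<times> F. measure \<mu> (A p))"
      using y(2) by (simp add: sum_negf)
    also have "\<dots> = card Z * n * measure \<mu> Bad"
      using A(2) by (simp add: n_def card_cartesian_product)
    also have "\<dots> \<le> card Z * n * \<eta>" using Bad(2) by (intro mult_left_mono) auto
    finally have total: "(\<Sum>z\<in>Z. real (card (bad z))) \<le> card Z * n * \<eta>" .
    define Zg where "Zg = {z \<in> Z. real (card (bad z)) \<le> c' / 2 * n}"
    have Zg: "Zg \<subseteq> Z" "finite Zg" using Z(2) by (auto simp: Zg_def)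
    have "card (Z - Zg) * (c' / 2 * n) = (\<Sum>z\<in>Z - Zg. c' / 2 * n)" by simp
    also have "\<dots> \<le> (\<Sum>z\<in>Z - Zg. real (card (bad z)))" by (intro sum_mono) (auto simp: Zg_def)
    also have "\<dots> \<le> (\<Sum>z\<in>Z. real (card (bad z)))" using Z(2) by (intro sum_mono2) auto
    also have "\<dots> \<le> (card Z * \<theta>) * (c' / 2 * n)" using total by (simp add: \<eta>_def ac_simps)
    finally have "card (Z - Zg) \<le> card Z * \<theta>" using c'(1) n by (simp add: mult_le_cancel_right)
    moreover have "real (card (Z - Zg)) = real (card Z) - real (card Zg)"
      using Zg Z(2) card_mono[OF Z(2) Zg(1)] by (simp add: card_Diff_subset)
    ultimately have "exp (- c / 2) * card Z \<le> card Zg" by (simp add: \<theta>_def algebra_simps)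
    moreover have "exp (- c / 2) * exp (c * n) \<le> exp (- c / 2) * card Z"
      using big by (intro mult_left_mono) (simp_all add: n_def)
    moreover have "exp (c / 2 * n) \<le> exp (- c / 2) * exp (c * n)"
    proof -
      have "c / 2 * 1 \<le> c / 2 * n" using n c by (intro mult_left_mono) auto
      then show ?thesis by (simp flip: exp_add)
    qed
    ultimately have Zgbig: "exp (c / 2 * card F) \<le> card Zg" unfolding n_def by linarith
    define word where "word z = (\<lambda>s\<in>F. (idx (\<phi> s (z \<cdot> y)), s \<in> bad z))" for z
    have cl: "\<phi> s (z \<cdot> y) \<in> carrier X" "s \<in> carrier G" "z \<in> carrier X" if "s \<in> F" "z \<in> Z" for s z
    proof -
      show "s \<in> carrier G" "z \<in> carrier X" using that F(3) Z(1) by auto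
      then show "\<phi> s (z \<cdot> y) \<in> carrier X" using yX by simp
    qed
    have "inj_on word Zg"
    proof (rule inj_onI, rule ccontr)
      fix u v assume uv: "u \<in> Zg" "v \<in> Zg" "word u = word v" "u \<noteq> v"
      have uvZ: "u \<in> Z" "v \<in> Z" using uv(1,2) Zg(1) by auto
      obtain s where s: "s \<in> F" "\<rho> (\<phi> s u) (\<phi> s v) > \<epsilon>" using Z(3)[OF uvZ uv(4)] by blast
      note u = cl[OF s(1) uvZ(1)] and v = cl[OF s(1) uvZ(2)]
      have "idx (\<phi> s (u \<cdot> y)) = idx (\<phi> s (v \<cdot> y))"
        using fun_cong[OF uv(3), of s] s(1) by (simp add: word_def)
      \<comment> \<open>Equal atoms keep the two points close under any common right factor; taking
        the inverse of \<phi> s y contradicts the separation of u and v.\<close>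
      then have "\<rho> (\<phi> s (u \<cdot> y) \<cdot> inv\<^bsub>X\<^esub> \<phi> s y) (\<phi> s (v \<cdot> y) \<cdot> inv\<^bsub>X\<^esub> \<phi> s y) \<le> \<epsilon>"
        using u v yX by (intro small) auto
      then show False using s(2) u v yX by (simp add: \<phi>_mult X.m_assoc)
    qed
    then have "card (word ` Zg) = card Zg" by (rule card_image)
    with Zgbig have Sbig: "exp (c / 2 * card F) \<le> card (word ` Zg)" by simp
    have S: "word ` Zg \<subseteq> F \<rightarrow>\<^sub>E L"
    proof (rule image_subsetI)
      fix z assume "z \<in> Zg"
      then have "z \<in> Z" using Zg(1) by auto
      then have "idx (\<phi> s (z \<cdot> y)) < m" if "s \<in> F" for s using idx[OF cl(1)[OF that]] by simp
      then show "word z \<in> F \<rightarrow>\<^sub>E L" by (simp add: word_def L_def)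
    qed
    obtain a b J where ab: "a \<in> L" "b \<in> L" "a \<noteq> b" and J: "J \<subseteq> F" "c' * card F \<le> card J"
      and sh: "\<forall>f\<in>J \<rightarrow> {a, b}. \<exists>w\<in>word ` Zg. \<forall>s\<in>J. w s = f s"
      using c'(2)[OF F(1,2) S Sbig] by (elim bexE exE conjE) (rule that)
    have finJ: "finite J" "J \<subseteq> carrier G" using finite_subset[OF J(1) F(1)] subset_trans[OF J(1) F(3)]
        by simp_all
    \<comment> \<open>If a shattered letter were flagged, the constant word in it would make all of
      \<open>J\<close> bad for some z, giving at least c' n bad times where only half as many are
      allowed.\<close>
    have good: "\<not> snd l" if l: "l = a \<or> l = b" for l
    proof
      assume "snd l"
      have "(\<lambda>_. l) \<in> J \<rightarrow> {a, b}" using l by auto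
      then obtain z where z: "z \<in> Zg" "\<forall>s\<in>J. word z s = l" using sh by auto
      have "J \<subseteq> bad z"
      proof
        fix s assume s: "s \<in> J"
        then have "word z s = l" "s \<in> F" using z(2) J(1) by auto
        then show "s \<in> bad z" using \<open>snd l\<close> by (auto simp: word_def)
      qed
      then have "card J \<le> card (bad z)" using F(1) by (intro card_mono) (auto simp: bad_def)
      also have "real (card (bad z)) \<le> c' / 2 * n" using z(1) by (simp add: Zg_def)
      finally have "c' * n \<le> c' / 2 * n" using J(2) by (simp add: n_def)
      then show False using c'(1) n by simp
    qed
    have fst_m: "fst a < m" "fst b < m" using ab by (auto simp: L_def)
    have "fst a \<noteq> fst b"
    proof
      assume "fst a = fst b"
      moreover have "snd a = snd b" using good[of a] good[of b] by simp
      ultimately have "a = b" by (rule prod_eqI)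
      then show False using ab(3) by contradiction
    qed
    moreover have "indep 2 (set_pair (Q (fst a)) (Q (fst b))) (topspace T) J"
    proof (rule independence_setI[OF finJ subset_refl])
      fix \<sigma> :: "'g \<Rightarrow> nat" assume \<sigma>: "\<sigma> \<in> J \<rightarrow> {1..2}"
      have f: "(\<lambda>s. if \<sigma> s = 1 then a else b) \<in> J \<rightarrow> {a, b}" by simp
      obtain z where z: "z \<in> Zg" "\<forall>s\<in>J. word z s = (if \<sigma> s = 1 then a else b)"
        using bspec[OF sh f] by auto
      have zZ: "z \<in> Z" using z(1) Zg(1) by auto
      have "\<phi> s (z \<cdot> y) \<in> set_pair (Q (fst a)) (Q (fst b)) (\<sigma> s)" if s: "s \<in> J" for s
      proof -
        have sF: "s \<in> F" using s J(1) by auto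
        have w: "word z s = (if \<sigma> s = 1 then a else b)" using z(2) s by simp
        then have "\<not> snd (word z s)" using good by simp
        then have "\<phi> s (z \<cdot> y) \<in> Q (idx (\<phi> s (z \<cdot> y)))"
          using sF cl(1)[OF sF zZ] by (simp add: word_def bad_def Bad_def)
        moreover have "idx (\<phi> s (z \<cdot> y)) = fst (if \<sigma> s = 1 then a else b)"
          using arg_cong[OF w, of fst] sF by (simp add: word_def)
        ultimately show ?thesis by (simp add: set_pair_def split: if_splits)
      qed
      then show "\<exists>z\<in>topspace T. \<forall>s\<in>J. \<phi> s z \<in> set_pair (Q (fst a)) (Q (fst b)) (\<sigma> s)"
        using subsetD[OF Z(1) zZ] yX by (intro bexI[of _ "z \<cdot> y"] ballI) simp_all
    qed
    ultimately show "\<exists>i<m. \<exists>j<m. i \<noteq> j \<and> (\<exists>J\<subseteq>F. indep 2 (set_pair (Q i) (Q j)) (topspace T) J \<and>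
        c' * real (card F) \<le> real (card J))"
      using fst_m J by - (rule exI[of _ "fst a"], rule conjI, assumption, rule exI[of _ "fst b"], simp,
          rule exI[of _ J], simp)
  qed
qed

text \<open>The cores do not depend on n, so one pair of them is independent with uniform density
  infinitely often. These cores are compact and disjoint, so localization yields an IE-pair of
  distinct points, and the quotient of its entries is not the identity.\<close>

lemma IE_group_nontrivial_if_entropy_pos:
  assumes \<rho>: "compatible_metric T \<rho>" and Fn: "left_Folner_sequence G Fn"
    and h: "topological_entropy T \<phi> \<rho> Fn > 0"
  obtains x where "x \<in> IE_grp" "x \<noteq> \<one>\<^bsub>X\<^esub>"
proof -
  have F: "finite (Fn n)" "Fn n \<noteq> {}" "Fn n \<subseteq> carrier G" for n using Fn
      by (auto simp: left_Folner_sequence_def)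
  let ?h = "\<lambda>\<epsilon> n. ln (real (separated_number T \<phi> \<rho> (Fn n) \<epsilon>)) / real (card (Fn n))"
  obtain \<epsilon> where \<epsilon>: "\<epsilon> > 0" "limsup (\<lambda>n. ereal (?h \<epsilon> n)) > 0"
    using h by (auto simp: topological_entropy_def less_SUP_iff)
  \<comment> \<open>A rate strictly below the upper limit is exceeded infinitely often, and each
    such n has a separated set with at least exp(c' |Fn n|) points.\<close>
  obtain c' where c': "ereal 0 < ereal c'" "ereal c' < limsup (\<lambda>n. ereal (?h \<epsilon> n))"
    using ereal_dense2[OF \<epsilon>(2)] by (auto simp: zero_ereal_def)
  then have c: "c' > 0" by simp
  have "\<not> (\<forall>\<^sub>F n in sequentially. ereal (?h \<epsilon> n) \<le> ereal c')"
  proof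
    assume "\<forall>\<^sub>F n in sequentially. ereal (?h \<epsilon> n) \<le> ereal c'"
    then have "limsup (\<lambda>n. ereal (?h \<epsilon> n)) \<le> ereal c'" by (rule Limsup_bounded)
    then show False using c'(2) by simp
  qed
  then have freq: "\<exists>\<^sub>F n in sequentially. ?h \<epsilon> n > c'" by (simp add: not_eventually not_le)
  obtain m :: nat and Q :: "nat \<Rightarrow> 'x set" and d :: real
  where d: "d > 0" and Q: "\<And>j. j < m \<Longrightarrow> closedin T (Q j)" "\<And>i j. i < m \<Longrightarrow> j < m \<Longrightarrow> i \<noteq> j \<Longrightarrow> Q i \<inter> Q j = {}"
    and ind: "\<And>F Z. finite F \<Longrightarrow> F \<noteq> {} \<Longrightarrow> F \<subseteq> carrier G \<Longrightarrow> separated \<rho> F \<epsilon> Z \<Longrightarrow> exp (c' * card F) \<le> card Z \<Longrightarrow>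
      \<exists>i<m. \<exists>j<m. i \<noteq> j \<and> (\<exists>J\<subseteq>F. indep 2 (set_pair (Q i) (Q j)) (topspace T) J \<and>
        d * real (card F) \<le> real (card J))"
    by (rule independent_cores[OF \<rho> \<epsilon>(1) c]) (rule that)
  let ?I = "{p \<in> {..<m} \<times> {..<m}. fst p \<noteq> snd p}"
  let ?R = "\<lambda>n p. \<exists>J\<subseteq>Fn n. indep 2 (set_pair (Q (fst p)) (Q (snd p))) (topspace T) J \<and>
        d * real (card (Fn n)) \<le> real (card J)"
  have step: "\<exists>p\<in>?I. ?R n p" if n: "?h \<epsilon> n > c'" for n
  proof -
    obtain Z where Z: "separated \<rho> (Fn n) \<epsilon> Z" "card Z = separated_number T \<phi> \<rho> (Fn n) \<epsilon>"
      by (rule separated_number_attained[OF \<rho> F \<epsilon>(1)]) (rule that)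
    have "card (Fn n) > 0" using F by (simp add: card_gt_0_iff)
    then have less: "c' * card (Fn n) < ln (real (card Z))" using n Z(2) by (simp add: field_simps)
    moreover have "0 \<le> c' * card (Fn n)" using c by simp
    ultimately have "ln (real (card Z)) > 0" by linarith
    then have "card Z > 0" by (cases "card Z = 0") auto
    then have "exp (c' * card (Fn n)) \<le> card Z" using less
        by (metis exp_le_cancel_iff exp_ln less_imp_le of_nat_0_less_iff)
    from ind[OF F Z(1) this] obtain i j where "i < m" "j < m" "i \<noteq> j"
      "\<exists>J\<subseteq>Fn n. indep 2 (set_pair (Q i) (Q j)) (topspace T) J \<and>
        d * real (card (Fn n)) \<le> real (card J)"
      by (elim exE conjE) (rule that, assumption+, intro exI conjI)
    then show ?thesis by (intro bexI[of _ "(i, j)"]) simp_all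
  qed
  have "\<exists>\<^sub>F n in sequentially. \<exists>p\<in>?I. ?R n p" by (rule frequently_elim1[OF freq]) (rule step)
  then obtain p where p: "p \<in> ?I" "\<exists>\<^sub>F n in sequentially. ?R n p"
    by (rule bexE[OF frequently_bex_finite[rotated]]) (simp, rule that)
  then have pd: "pos_density 2 (set_pair (Q (fst p)) (Q (snd p)))"
    by (intro positive_densityI_Folner[OF Fn d])
  have ij: "fst p < m" "snd p < m" "fst p \<noteq> snd p" using p(1) by auto
  have "compactin T (Q (fst p))" "compactin T (Q (snd p))"
    using Q(1)[OF ij(1)] Q(1)[OF ij(2)] compact_T by (auto intro: closedin_compact_space)
  then obtain x y where xy: "x \<in> Q (fst p)" "y \<in> Q (snd p)"
    "\<And>U V. openin T U \<Longrightarrow> openin T V \<Longrightarrow> x \<in> U \<Longrightarrow> y \<in> V \<Longrightarrow> pos_density 2 (set_pair U V)"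
  proof (rule positive_density_point_pair)
    show "pos_density 2 (set_pair O1 O2)" if "Q (fst p) \<subseteq> O1" "Q (snd p) \<subseteq> O2" for O1 O2
      by (rule positive_density_pair_mono[OF pd]) (use that in auto)
  qed (rule that)
  have X: "x \<in> carrier X" "y \<in> carrier X"
    using xy(1,2) closedin_subset[OF Q(1)[OF ij(1)]] closedin_subset[OF Q(1)[OF ij(2)]] by auto
  have "pair_tuple x y \<in> IE 2" unfolding pair_tuple_IE_iff[OF X] using xy(3) by simp
  then have "x \<cdot> inv\<^bsub>X\<^esub> y \<in> IE_grp" by (rule IE_group_quotient(1)[OF _ X])
  moreover have "x \<cdot> inv\<^bsub>X\<^esub> y \<noteq> \<one>\<^bsub>X\<^esub>"
  proof
    assume "x \<cdot> inv\<^bsub>X\<^esub> y = \<one>\<^bsub>X\<^esub>"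
    then have "x = y" using X by (metis X.inv_equality X.inv_inv X.inv_closed)
    then show False using xy(1,2) Q(2)[OF ij] by auto
  qed
  ultimately show ?thesis by (rule that)
qed

end

section \<open>Quotients\<close>

context algebraic_action_Haar
begin

context
  fixes Y
  assumes Y: "Y \<lhd> X" "closedin T Y" "invariant_subset G \<phi> Y"
begin

lemma Y_subgroup: "subgroup Y X" and Y_subset: "Y \<subseteq> carrier X"
  using Y(1) by (auto simp: normal_def dest: subgroup.subset)

lemma coset_self: "x \<in> carrier X \<Longrightarrow> x \<in> Y #>\<^bsub>X\<^esub> x"
  using Y_subgroup by (intro X.rcos_self)

lemma carrier_Mod: "carrier (X Mod Y) = (\<lambda>x. Y #>\<^bsub>X\<^esub> x) ` carrier X"
  by (auto simp: FactGroup_def RCOSETS_def)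

lemma one_Mod: "\<one>\<^bsub>X Mod Y\<^esub> = Y #>\<^bsub>X\<^esub> \<one>\<^bsub>X\<^esub>"
  using Y_subset by (simp add: FactGroup_def X.coset_mult_one)

lemma topspace_quotient:
  "topspace (quotient_topology T (\<lambda>x. Y #>\<^bsub>X\<^esub> x)) = (\<lambda>x. Y #>\<^bsub>X\<^esub> x) ` carrier X"
  by (simp add: topspace_quotient_topology)

lemma quotient_action_coset:
  assumes g: "g \<in> carrier G" and x: "x \<in> carrier X"
  shows "quotient_action X Y \<phi> g (Y #>\<^bsub>X\<^esub> x) = Y #>\<^bsub>X\<^esub> \<phi> g x"
proof -
  have "quotient_action X Y \<phi> g (Y #>\<^bsub>X\<^esub> x) = \<phi> g ` (Y #>\<^bsub>X\<^esub> x)"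
    using x by (simp add: quotient_action_def carrier_Mod)
  also have "\<dots> = (\<lambda>h. \<phi> g (h \<cdot> x)) ` Y" by (auto simp: r_coset_def)
  also have "\<dots> = (\<lambda>h. \<phi> g h \<cdot> \<phi> g x) ` Y"
    using Y_subset g x by (intro image_cong refl \<phi>_mult) auto
  also have "\<dots> = (\<lambda>h. h \<cdot> \<phi> g x) ` (\<phi> g ` Y)" by (simp add: image_image)
  also have "\<phi> g ` Y = Y" using Y(3) g by (simp add: invariant_subset_def)
  finally show ?thesis by (auto simp: r_coset_def)
qed

text \<open>Cosets lift to points and the coset map is equivariant. Density questions about X/Y
  thereby become questions about the saturated preimages in X.\<close>

lemma independence_set_quotient:
  "independence_set G (quotient_topology T (\<lambda>x. Y #>\<^bsub>X\<^esub> x)) (quotient_action X Y \<phi>) k U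
      (topspace (quotient_topology T (\<lambda>x. Y #>\<^bsub>X\<^esub> x))) F \<longleftrightarrow>
    indep k (\<lambda>i. {x \<in> carrier X. Y #>\<^bsub>X\<^esub> x \<in> U i}) (topspace T) F"
  (is "independence_set G ?T ?\<phi> k U (topspace ?T) F \<longleftrightarrow> indep k ?V (topspace T) F")
proof
  assume L: "independence_set G ?T ?\<phi> k U (topspace ?T) F"
  then have F: "finite F" "F \<subseteq> carrier G" by (simp_all add: independence_set_def)
  show "indep k ?V (topspace T) F"
  proof (rule independence_setI[OF F subset_refl])
    fix \<sigma> assume \<sigma>: "\<sigma> \<in> F \<rightarrow> {1..k}"
    obtain C where C: "C \<in> topspace ?T" "\<And>s. s \<in> F \<Longrightarrow> ?\<phi> s C \<in> U (\<sigma> s)"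
      by (rule independence_setE[OF L \<sigma>]) (rule that)
    obtain z where z: "z \<in> carrier X" "C = Y #>\<^bsub>X\<^esub> z" using C(1) unfolding topspace_quotient by blast
    have "\<phi> s z \<in> ?V (\<sigma> s)" if "s \<in> F" for s
      using C(2)[OF that] quotient_action_coset[OF subsetD[OF F(2) that] z(1)] z \<phi>_closed[OF subsetD[OF
          F(2) that] z(1)]
      by simp
    then show "\<exists>z\<in>topspace T. \<forall>s\<in>F. \<phi> s z \<in> ?V (\<sigma> s)" using z(1) by (intro bexI[of _ z] ballI) simp_all
  qed
next
  assume R: "indep k ?V (topspace T) F"
  then have F: "finite F" "F \<subseteq> carrier G" by (simp_all add: independence_set_def)
  show "independence_set G ?T ?\<phi> k U (topspace ?T) F"
  proof (rule independence_setI[OF F subset_refl])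
    fix \<sigma> assume \<sigma>: "\<sigma> \<in> F \<rightarrow> {1..k}"
    obtain z where z: "z \<in> topspace T" "\<And>s. s \<in> F \<Longrightarrow> \<phi> s z \<in> ?V (\<sigma> s)"
      by (rule independence_setE[OF R \<sigma>]) (rule that)
    then have zX: "z \<in> carrier X" by simp
    have "?\<phi> s (Y #>\<^bsub>X\<^esub> z) \<in> U (\<sigma> s)" if "s \<in> F" for s
      using z(2)[OF that] quotient_action_coset[OF subsetD[OF F(2) that] zX] by simp
    then show "\<exists>C\<in>topspace ?T. \<forall>s\<in>F. ?\<phi> s C \<in> U (\<sigma> s)"
      using zX unfolding topspace_quotient by (intro bexI[of _ "Y #>\<^bsub>X\<^esub> z"] ballI) simp_all
  qed
qed

text \<open>By the tube lemma along \<open>{x}\<close> times the compact \<open>Y\<close>, cosets of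
  points near x stay inside \<open>W\<close>. So a neighbourhood in X of a whole coset contains a
  saturated open neighbourhood of it.\<close>

lemma openin_cosets_subset:
  assumes W: "openin T W"
  shows "openin T {x \<in> carrier X. Y #>\<^bsub>X\<^esub> x \<subseteq> W}"
  unfolding openin_subopen[of T "{x \<in> carrier X. Y #>\<^bsub>X\<^esub> x \<subseteq> W}"]
proof
  fix x assume "x \<in> {x \<in> carrier X. Y #>\<^bsub>X\<^esub> x \<subseteq> W}"
  then have x: "x \<in> carrier X" "Y #>\<^bsub>X\<^esub> x \<subseteq> W" by simp_all
  let ?P = "prod_topology T T"
  let ?O = "{p \<in> topspace ?P. snd p \<cdot> fst p \<in> W}"
  have oO: "openin ?P ?O"
    by (intro openin_preimage[OF _ W] continuous_mult continuous_map_fst continuous_map_snd)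
  have cY: "compactin T Y" by (rule closedin_compact_space[OF compact_T Y(2)])
  have sub: "{x} \<times> Y \<subseteq> ?O" using x Y_subset by (auto simp: r_coset_def)
  have xT: "x \<in> topspace T" using x(1) by simp
  obtain U V where UV: "openin T U" "x \<in> U" "Y \<subseteq> V" "U \<times> V \<subseteq> ?O"
    using tube_lemma_right[OF oO cY xT sub] by (elim exE conjE) (rule that)
  have "u \<in> {x \<in> carrier X. Y #>\<^bsub>X\<^esub> x \<subseteq> W}" if u: "u \<in> U" for u
  proof -
    have "h \<cdot> u \<in> W" if "h \<in> Y" for h using subsetD[OF UV(4), of "(u, h)"] UV(3) u that by auto
    moreover have "u \<in> carrier X" using u openin_subset[OF UV(1)] by auto
    ultimately show ?thesis by (auto simp: r_coset_def)
  qed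
  then show "\<exists>U. openin T U \<and> x \<in> U \<and> U \<subseteq> {x \<in> carrier X. Y #>\<^bsub>X\<^esub> x \<subseteq> W}"
    using UV(1,2) by (intro exI[of _ U] conjI subsetI)
qed

text \<open>One inclusion pulls neighbourhoods back along the coset map. For the other,
  \<open>C\<close> and \<open>Y\<close> are the compact fibres over the two entries of the pair in
  X/Y, and localization finds an IE-pair x in \<open>C\<close>, y in \<open>Y\<close>.\<close>

lemma IE_group_quotient_image:
  "(\<lambda>x. Y #>\<^bsub>X\<^esub> x) ` IE_grp =
    IE_group G (X Mod Y) (quotient_topology T (\<lambda>x. Y #>\<^bsub>X\<^esub> x)) (quotient_action X Y \<phi>)"
proof (intro equalityI subsetI)
  let ?q = "\<lambda>x. Y #>\<^bsub>X\<^esub> x"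
  let ?T = "quotient_topology T ?q" and ?\<phi> = "quotient_action X Y \<phi>"
  fix C assume "C \<in> ?q ` IE_grp"
  then obtain x where C: "C = ?q x" and x: "x \<in> carrier X" "pair_tuple x \<one>\<^bsub>X\<^esub> \<in> IE 2"
    by (auto simp: IE_group_eq)
  let ?t = "\<lambda>i\<in>{1..2}. if i = (1::nat) then C else \<one>\<^bsub>X Mod Y\<^esub>"
  have "?t \<in> IE_tuples G ?T ?\<phi> 2"
    unfolding IE_tuples_def
  proof (intro CollectI conjI allI impI)
    have "\<one>\<^bsub>X Mod Y\<^esub> \<in> ?q ` carrier X" unfolding one_Mod by (rule imageI) simp
    moreover have "C \<in> ?q ` carrier X" unfolding C using x(1) by (rule imageI)
    ultimately show "?t \<in> (\<Pi>\<^sub>E i\<in>{1..2}. topspace ?T)" unfolding topspace_quotient by simp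
    fix U assume U: "\<forall>i\<in>{1..2}. openin ?T (U i) \<and> ?t i \<in> U i"
    let ?V = "\<lambda>i. {x \<in> carrier X. ?q x \<in> U i}"
    have "pos_density 2 ?V"
    proof (rule IE_tuples_density[OF x(2)])
      show "openin T (?V i)" if "i \<in> {1..2}" for i
        using U that by (auto simp: openin_quotient_topology)
      show "pair_tuple x \<one>\<^bsub>X\<^esub> i \<in> ?V i" if "i \<in> {1..2}" for i
        using U[rule_format, OF that] that x by (auto simp: pair_tuple_def C one_Mod X.coset_mult_one[OF
            Y_subset] split: if_splits)
    qed
    then obtain c where "c > 0" "\<And>F. finite F \<Longrightarrow> F \<subseteq> carrier G \<Longrightarrow>
       \<exists>F'\<subseteq>F. indep 2 ?V (topspace T) F' \<and> c * real (card F) \<le> real (card F')"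
      by (rule positive_densityE) (rule that)
    then show "\<exists>K c \<epsilon>. finite K \<and> K \<noteq> {} \<and> K \<subseteq> carrier G \<and> c > (0::real) \<and> \<epsilon> > (0::real) \<and>
           (\<forall>F. finite F \<and> F \<subseteq> carrier G \<and>
                real (card ((K <#>\<^bsub>G\<^esub> F) - F)) \<le> \<epsilon> * real (card F) \<longrightarrow>
              (\<exists>F'\<subseteq>F. independence_set G ?T ?\<phi> 2 U (topspace ?T) F' \<and>
                 real (card F') \<ge> c * real (card F)))"
      unfolding independence_set_quotient
      by - (rule exI[of _ "{\<one>\<^bsub>G\<^esub>}"], rule exI[of _ c], rule exI[of _ 1], simp)
  qed
  moreover have "C \<in> carrier (X Mod Y)" unfolding C carrier_Mod using x(1) by (rule imageI)
  ultimately show "C \<in> IE_group G (X Mod Y) ?T ?\<phi>" by (simp add: IE_group_def)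
next
  let ?q = "\<lambda>x. Y #>\<^bsub>X\<^esub> x"
  let ?T = "quotient_topology T ?q" and ?\<phi> = "quotient_action X Y \<phi>"
  fix C assume C': "C \<in> IE_group G (X Mod Y) ?T ?\<phi>"
  then obtain x0 where x0: "x0 \<in> carrier X" "C = ?q x0" by (auto simp: IE_group_def carrier_Mod)
  let ?t = "\<lambda>i\<in>{1..2}. if i = (1::nat) then C else \<one>\<^bsub>X Mod Y\<^esub>"
  have t: "?t \<in> IE_tuples G ?T ?\<phi> 2" using C' by (simp add: IE_group_def)
  \<comment> \<open>Cosets contained in \<open>W1\<close> or \<open>W2\<close> form open sets of the
    quotient, so the IE-property downstairs applies to arbitrary open sets around the
    fibres.\<close>
  have pd: "pos_density 2 (set_pair W1 W2)"
    if W: "openin T W1" "openin T W2" "C \<subseteq> W1" "Y \<subseteq> W2" for W1 W2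
  proof -
    define U where "U = set_pair {D \<in> ?q ` carrier X. D \<subseteq> W1} {D \<in> ?q ` carrier X. D \<subseteq> W2}"
    have open_U: "openin ?T {D \<in> ?q ` carrier X. D \<subseteq> W}" if "openin T W" for W
    proof -
      have "{x \<in> carrier X. ?q x \<in> {D \<in> ?q ` carrier X. D \<subseteq> W}} = {x \<in> carrier X. ?q x \<subseteq> W}" by auto
      then show ?thesis using openin_cosets_subset[OF that] by (auto simp: openin_quotient_topology)
    qed
    have "Y #>\<^bsub>X\<^esub> \<one>\<^bsub>X\<^esub> = Y" using Y_subset by (rule X.coset_mult_one)
    then have "\<forall>i\<in>{1..2}. openin ?T (U i) \<and> ?t i \<in> U i"
      using open_U W x0 X.one_closed by (auto simp: U_def set_pair_def one_Mod intro!: image_eqI[of Y _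
          "\<one>\<^bsub>X\<^esub>"])
    then have "\<exists>K c \<epsilon>. finite K \<and> K \<noteq> {} \<and> K \<subseteq> carrier G \<and> c > (0::real) \<and> \<epsilon> > (0::real) \<and>
           (\<forall>F. finite F \<and> F \<subseteq> carrier G \<and>
                real (card ((K <#>\<^bsub>G\<^esub> F) - F)) \<le> \<epsilon> * real (card F) \<longrightarrow>
              (\<exists>F'\<subseteq>F. independence_set G ?T ?\<phi> 2 U (topspace ?T) F' \<and>
                 real (card F') \<ge> c * real (card F)))"
      using t unfolding IE_tuples_def by simp
    then obtain K c \<epsilon> where "finite K \<and> K \<noteq> {} \<and> K \<subseteq> carrier G \<and> c > (0::real) \<and> \<epsilon> > (0::real) \<and>
           (\<forall>F. finite F \<and> F \<subseteq> carrier G \<and>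
                real (card ((K <#>\<^bsub>G\<^esub> F) - F)) \<le> \<epsilon> * real (card F) \<longrightarrow>
              (\<exists>F'\<subseteq>F. indep 2 (\<lambda>i. {x \<in> carrier X. ?q x \<in> U i}) (topspace T) F' \<and>
                 real (card F') \<ge> c * real (card F)))"
      unfolding independence_set_quotient by (elim exE) (rule that)
    then have "pos_density 2 (\<lambda>i. {x \<in> carrier X. ?q x \<in> U i})"
      by (intro positive_densityI_invariant[of K \<epsilon> c]) simp_all
    then show ?thesis
      by (rule positive_density_relabel[where h = id])
        (use coset_self in \<open>auto simp: U_def set_pair_def split: if_splits\<close>)
  qed
  have cY: "compactin T Y" by (rule closedin_compact_space[OF compact_T Y(2)])
  have cC: "compactin T C"
  proof -
    have "continuous_map T T (\<lambda>h. h \<cdot> x0)" using x0(1) by (intro continuous_mult) auto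
    then have "compactin T ((\<lambda>h. h \<cdot> x0) ` Y)" by (rule image_compactin[OF cY])
    moreover have "(\<lambda>h. h \<cdot> x0) ` Y = C" by (auto simp: x0(2) r_coset_def)
    ultimately show ?thesis by simp
  qed
  obtain x y where xy: "x \<in> C" "y \<in> Y"
    "\<And>U V. openin T U \<Longrightarrow> openin T V \<Longrightarrow> x \<in> U \<Longrightarrow> y \<in> V \<Longrightarrow> pos_density 2 (set_pair U V)"
    by (rule positive_density_point_pair[OF cC cY pd]) (assumption+, rule that)
  obtain h where h: "h \<in> Y" "x = h \<cdot> x0" using xy(1) by (auto simp: x0(2) r_coset_def)
  have hX: "h \<in> carrier X" and yX: "y \<in> carrier X" using h(1) xy(2) Y_subset by auto
  have xX: "x \<in> carrier X" using h(2) hX x0(1) by simp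
  have "pair_tuple x y \<in> IE 2" unfolding pair_tuple_IE_iff[OF xX yX] using xy(3) by simp
  \<comment> \<open>The inverse of y goes on the left: for x = h \<cdot> x0 with h in
    \<open>Y\<close> it is absorbed by \<open>Y\<close>, so the product stays in the right coset of
    x0.\<close>
  then have mem: "inv\<^bsub>X\<^esub> y \<cdot> x \<in> IE_grp" by (rule IE_group_quotient(2)[OF _ xX yX])
  have "inv\<^bsub>X\<^esub> y \<cdot> x = (inv\<^bsub>X\<^esub> y \<cdot> h) \<cdot> x0" using hX yX x0(1) by (simp add: h(2) X.m_assoc)
  moreover have "inv\<^bsub>X\<^esub> y \<cdot> h \<in> Y"
    using Y_subgroup h(1) xy(2) by (intro subgroup.m_closed subgroup.m_inv_closed)
  ultimately have "inv\<^bsub>X\<^esub> y \<cdot> x \<in> ?q x0" by (auto simp: r_coset_def)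
  then have "?q x0 = ?q (inv\<^bsub>X\<^esub> y \<cdot> x)" by (rule X.repr_independence[OF _ x0(1) Y_subgroup])
  then show "C \<in> ?q ` IE_grp" using mem x0(2) by auto
qed

end

lemma entropy_pos_iff:
  assumes "compatible_metric T \<rho>" "left_Folner_sequence G Fn"
  shows "topological_entropy T \<phi> \<rho> Fn > 0 \<longleftrightarrow> IE_grp \<noteq> {\<one>\<^bsub>X\<^esub>}"
proof
  assume "topological_entropy T \<phi> \<rho> Fn > 0"
  then obtain x where "x \<in> IE_grp" "x \<noteq> \<one>\<^bsub>X\<^esub>"
    by (rule IE_group_nontrivial_if_entropy_pos[OF assms]) (rule that)
  then show "IE_grp \<noteq> {\<one>\<^bsub>X\<^esub>}" by auto
next
  assume "IE_grp \<noteq> {\<one>\<^bsub>X\<^esub>}"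
  moreover have "\<one>\<^bsub>X\<^esub> \<in> IE_grp"
    using IE_group_normal by (auto simp: normal_def dest: subgroup.one_closed)
  ultimately obtain x where "x \<in> IE_grp" "x \<noteq> \<one>\<^bsub>X\<^esub>" by auto
  then show "topological_entropy T \<phi> \<rho> Fn > 0" by (rule entropy_pos_if_IE_pair[OF assms])
qed

end

theorem theorem7p3:
  fixes G :: "('g, 'm) monoid_scheme"
    and X :: "('x, 'n) monoid_scheme"
    and T :: "'x topology"
    and \<phi> :: "'g \<Rightarrow> 'x \<Rightarrow> 'x"
    and \<mu>X :: "'x measure"
  assumes "countable_amenable_group G"
    and "compact_metrizable_group X T"
    and "acts_by_automorphisms G X T \<phi>"
    and "normalized_Haar_measure X T \<mu>X"
  shows
    "(invariant_subset G \<phi> (IE_group G X T \<phi>) \<and>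
      closedin T (IE_group G X T \<phi>) \<and>
      IE_group G X T \<phi> \<lhd> X)
     \<and>
     (\<forall>k::nat.
        invariant_subset G (product_action k \<phi>) (IE_tuples G T \<phi> k) \<and>
        closedin (product_topology (\<lambda>_. T) {1..k}) (IE_tuples G T \<phi> k) \<and>
        subgroup (IE_tuples G T \<phi> k) (product_group {1..k} (\<lambda>_. X)) \<and>
        IE_tuples G T \<phi> k =
          {(\<lambda>i\<in>{1..k}. x i \<otimes>\<^bsub>X\<^esub> y) |x y. x \<in> {1..k} \<rightarrow> IE_group G X T \<phi> \<and> y \<in> carrier X} \<and>
        IE_tuples G T \<phi> k =
          {(\<lambda>i\<in>{1..k}. y \<otimes>\<^bsub>X\<^esub> x i) |x y. x \<in> {1..k} \<rightarrow> IE_group G X T \<phi> \<and> y \<in> carrier X})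
     \<and>
     (\<forall>k::nat.
        (\<forall>\<nu>. Borel_prob_measure T \<nu> \<and> invariant_measure G \<phi> \<nu> \<longrightarrow>
           measure_IE_tuples G T \<phi> \<nu> k \<subseteq> measure_IE_tuples G T \<phi> \<mu>X k) \<and>
        measure_IE_tuples G T \<phi> \<mu>X k = IE_tuples G T \<phi> k)
     \<and>
     (\<forall>\<rho> Fn. compatible_metric T \<rho> \<and> left_Folner_sequence G Fn \<longrightarrow>
        (topological_entropy T \<phi> \<rho> Fn > 0 \<longleftrightarrow> IE_group G X T \<phi> \<noteq> {\<one>\<^bsub>X\<^esub>}))
     \<and>
     (\<forall>Y. Y \<lhd> X \<and> closedin T Y \<and> invariant_subset G \<phi> Y \<longrightarrow>
        (\<lambda>x. Y #>\<^bsub>X\<^esub> x) ` IE_group G X T \<phi> =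
          IE_group G (X Mod Y) (quotient_topology T (\<lambda>x. Y #>\<^bsub>X\<^esub> x)) (quotient_action X Y \<phi>))"
proof -
  interpret algebraic_action_Haar G X T \<phi> \<mu>X
    using assms by unfold_locales
  show ?thesis
  proof (intro conjI allI impI)
    show "invariant_subset G \<phi> (IE_group G X T \<phi>)" "closedin T (IE_group G X T \<phi>)" "IE_group G X T \<phi> \<lhd> X"
      by (rule IE_group_invariant IE_group_closed IE_group_normal)+
  next
    fix k
    show "invariant_subset G (product_action k \<phi>) (IE_tuples G T \<phi> k)"
      "closedin (product_topology (\<lambda>_. T) {1..k}) (IE_tuples G T \<phi> k)"
      "subgroup (IE_tuples G T \<phi> k) (product_group {1..k} (\<lambda>_. X))"
      by (rule IE_tuples_invariant IE_tuples_closed IE_tuples_subgroup)+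
    show "IE_tuples G T \<phi> k =
        {(\<lambda>i\<in>{1..k}. x i \<otimes>\<^bsub>X\<^esub> y) |x y. x \<in> {1..k} \<rightarrow> IE_group G X T \<phi> \<and> y \<in> carrier X}"
      by (rule IE_tuples_eq(1))
    show "IE_tuples G T \<phi> k =
        {(\<lambda>i\<in>{1..k}. y \<otimes>\<^bsub>X\<^esub> x i) |x y. x \<in> {1..k} \<rightarrow> IE_group G X T \<phi> \<and> y \<in> carrier X}"
      by (rule IE_tuples_eq(2))
    show "measure_IE_tuples G T \<phi> \<mu>X k = IE_tuples G T \<phi> k" by (rule measure_IE_tuples_Haar)
    show "measure_IE_tuples G T \<phi> \<nu> k \<subseteq> measure_IE_tuples G T \<phi> \<mu>X k"
      if "Borel_prob_measure T \<nu> \<and> invariant_measure G \<phi> \<nu>" for \<nu>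
      unfolding measure_IE_tuples_Haar using that by (intro measure_IE_tuples_subset) simp
  next
    fix \<rho> Fn assume "compatible_metric T \<rho> \<and> left_Folner_sequence G Fn"
    then show "topological_entropy T \<phi> \<rho> Fn > 0 \<longleftrightarrow> IE_group G X T \<phi> \<noteq> {\<one>\<^bsub>X\<^esub>}"
      by (intro entropy_pos_iff) simp_all
  next
    fix Y assume "Y \<lhd> X \<and> closedin T Y \<and> invariant_subset G \<phi> Y"
    then show "(\<lambda>x. Y #>\<^bsub>X\<^esub> x) ` IE_group G X T \<phi> =
          IE_group G (X Mod Y) (quotient_topology T (\<lambda>x. Y #>\<^bsub>X\<^esub> x)) (quotient_action X Y \<phi>)"
      by (intro IE_group_quotient_image) simp_all
  qed
qed

end
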